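(* Let $k$ be an algebraically closed field of arbitrary characteristic, and let $\mathbb{L}\subseteq\mathbf{P}^3_k$ be a (reduced) union of finitely many lines $\ell_1,\ell_2,\ldots,\ell_s$, $s\ge 1$. (a) If $\mathbb{L}$ is arithmetically Cohen-Macaulay (ACM) and of type $(d-1,d)$ for some integer $d>1$, then $\mathbb{L}$ is either a pseudostar or coplanar. (b) If $\mathbb{L}$ is either a pseudostar or coplanar, then $\mathbb{L}$ has type $(d-1,d)$ for some integer $d>1$.
   Context: Let $S=k[\mathbf{P}^3]=k[x,y,z,w]$. For a subscheme $X\subseteq\mathbf{P}^3$, $I(X)\subseteq S$ denotes its (saturated) homogeneous ideal; for a reduced union of lines, $I(\mathbb{L})=\bigcap_i I(\ell_i)$. $X$ is arithmetically Cohen-Macaulay (ACM) if $S/I(X)$ is a Cohen-Macaulay ring. For a nonzero homogeneous ideal $I$, $\alpha(I)=\min\{t : I_t\neq 0\}$, the least degree of a nonzero form in $I$; write $\alpha(X)=\alpha(I(X))$. The $m$-th symbolic power of $I$ is $I^{(m)}=S\cap\left(\bigcap_{P\in\mathrm{Ass}(I)} I^mS_P\right)$, where $\mathrm{Ass}(I)$ is the set of associated primes of $I$. For reduced $X$, the double scheme $2X$ is the subscheme defined by $I(X)^{(2)}$, so $\alpha(2X)=\alpha(I(X)^{(2)})$. (If $\mathbb{L}=\bigcup_i\ell_i$ with the $\ell_i$ distinct lines, $I(\mathbb{L})^{(2)}=\bigcap_i I(\ell_i)^2$.) $X$ has type $(a,b)$ if $\alpha(X)=a$ and $\alpha(2X)=b$.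 $\mathbb{L}$ is coplanar if all its lines lie in a single plane. $\mathbb{L}$ is a pseudostar (pseudo-star configuration) if there are finitely many distinct planes $H_1,\ldots,H_n\subset\mathbf{P}^3$, $n\ge2$, no three of which contain a common line, such that $\mathbb{L}=\bigcup_{1\le i<j\le n}(H_i\cap H_j)$. *)

theory Defs
  imports
    "HOL-Analysis.Analysis"
    "HOL-Algebra.Algebra"
    "HOL-Algebra.Algebraic_Closure_Type"
    "HOL-Computational_Algebra.Fraction_Field"
    "HOL-Library.Poly_Mapping"
    "HOL-Library.Extended_Nat"
begin

section \<open>Cohen--Macaulay rings\<close>

definition regular_sequence :: "('a, 'b) ring_scheme \<Rightarrow> 'a list \<Rightarrow> bool" where
  "regular_sequence R xs \<longleftrightarrow>
     set xs \<subseteq> carrier R \<and>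
     genideal R (set xs) \<noteq> carrier R \<and>
     (\<forall>i<length xs. \<forall>a\<in>carrier R.
        a \<otimes>\<^bsub>R\<^esub> (xs ! i) \<in> genideal R (set (take i xs)) \<longrightarrow> a \<in> genideal R (set (take i xs)))"

definition ideal_depth :: "('a, 'b) ring_scheme \<Rightarrow> 'a set \<Rightarrow> enat" where
  "ideal_depth R I = (SUP xs\<in>{xs. set xs \<subseteq> I \<and> regular_sequence R xs}. enat (length xs))"

definition prime_height :: "('a, 'b) ring_scheme \<Rightarrow> 'a set \<Rightarrow> enat" where
  "prime_height R P =
     (SUP n\<in>{n. \<exists>p. p n = P \<and> (\<forall>i\<le>n. primeideal (p i) R) \<and> (\<forall>i<n. p i \<subset> p (Suc i))}. enat n)"

text \<open>
  The definition of Eisenbud, \<^emph>\<open>Commutative Algebra\<close>, Section 18.2: depth equals codimension at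
  every maximal ideal (both are unchanged by localizing at that maximal ideal).
\<close>
definition cohen_macaulay :: "('a, 'b) ring_scheme \<Rightarrow> bool" where
  "cohen_macaulay R \<longleftrightarrow>
     cring R \<and> noetherian_ring R \<and>
     (\<forall>M. maximalideal M R \<longrightarrow> ideal_depth R M = prime_height R M)"


section \<open>Associated primes and symbolic powers\<close>

text \<open>The prime annihilators of elements of \<open>R/I\<close>.\<close>
definition associated_primes :: "('a, 'b) ring_scheme \<Rightarrow> 'a set \<Rightarrow> 'a set set" where
  "associated_primes R I =
     {P. primeideal P R \<and> (\<exists>f\<in>carrier R. P = {g \<in> carrier R. g \<otimes>\<^bsub>R\<^esub> f \<in> I})}"

text \<open>\<open>J R\<^sub>P\<close> for an ideal \<open>J\<close> and a prime \<open>P\<close> of a domain \<open>R\<close>, viewed inside the fraction field.\<close>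
definition localized_ideal :: "'a::idom set \<Rightarrow> 'a set \<Rightarrow> 'a fract set" where
  "localized_ideal J P = {Fract a s | a s. a \<in> J \<and> s \<notin> P}"

definition symbolic_power :: "'a::idom set \<Rightarrow> nat \<Rightarrow> 'a set" where
  "symbolic_power I m =
     {f. \<forall>P\<in>associated_primes ring_of_type_algebra I.
           Fract f 1 \<in> localized_ideal (I [^]\<^bsub>ideals_set ring_of_type_algebra\<^esub> m) P}"


section \<open>Forms in four variables and projective three-space\<close>

type_synonym 'k poly4 = "(4 \<Rightarrow>\<^sub>0 nat) \<Rightarrow>\<^sub>0 'k"

abbreviation coord_ring :: "('k::field) poly4 ring" where
  "coord_ring \<equiv> ring_of_type_algebra"

definition eval4 :: "('k::field) poly4 \<Rightarrow> 'k ^ 4 \<Rightarrow> 'k" where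
  "eval4 f v = (\<Sum>m\<in>Poly_Mapping.keys f.
      Poly_Mapping.lookup f m * (\<Prod>i\<in>UNIV. (v $ i) ^ Poly_Mapping.lookup m i))"

definition form_of_degree :: "nat \<Rightarrow> ('k::field) poly4 \<Rightarrow> bool" where
  "form_of_degree t f \<longleftrightarrow>
     (\<forall>m\<in>Poly_Mapping.keys f. (\<Sum>i\<in>UNIV. Poly_Mapping.lookup m i) = t)"

text \<open>
  A point of projective three-space is a one-dimensional subspace of \<open>k\<^sup>4\<close>. Over an algebraically
  closed field a reduced closed subscheme is determined by its set of closed points.
\<close>
definition linear_locus :: "('k::field ^ 4) set \<Rightarrow> ('k ^ 4) set set" where
  "linear_locus V = {p. vec.subspace p \<and> vec.dim p = 1 \<and> p \<subseteq> V}"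

definition is_line :: "('k::field ^ 4) set set \<Rightarrow> bool" where
  "is_line L \<longleftrightarrow> (\<exists>V. vec.subspace V \<and> vec.dim V = 2 \<and> L = linear_locus V)"

definition is_plane :: "('k::field ^ 4) set set \<Rightarrow> bool" where
  "is_plane H \<longleftrightarrow> (\<exists>V. vec.subspace V \<and> vec.dim V = 3 \<and> H = linear_locus V)"

text \<open>The saturated homogeneous ideal of the reduced scheme with point set \<open>Z\<close>.\<close>
definition vanishing_ideal :: "('k::field ^ 4) set set \<Rightarrow> 'k poly4 set" where
  "vanishing_ideal Z =
     genideal coord_ring {f. (\<exists>t. form_of_degree t f) \<and> (\<forall>p\<in>Z. \<forall>v\<in>p. eval4 f v = 0)}"

definition ACM :: "('k::field ^ 4) set set \<Rightarrow> bool" where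
  "ACM Z \<longleftrightarrow> cohen_macaulay (coord_ring Quot vanishing_ideal Z)"

text \<open>Meaningful for nonzero homogeneous ideals.\<close>
definition alpha :: "('k::field) poly4 set \<Rightarrow> nat" where
  "alpha I = (LEAST t. \<exists>f\<in>I. f \<noteq> 0 \<and> form_of_degree t f)"

definition has_type :: "('k::field ^ 4) set set \<Rightarrow> nat \<Rightarrow> nat \<Rightarrow> bool" where
  "has_type Z a b \<longleftrightarrow>
     alpha (vanishing_ideal Z) = a \<and> alpha (symbolic_power (vanishing_ideal Z) 2) = b"

definition coplanar_lines :: "('k::field ^ 4) set set set \<Rightarrow> bool" where
  "coplanar_lines Ls \<longleftrightarrow> (\<exists>H. is_plane H \<and> (\<forall>L\<in>Ls. L \<subseteq> H))"

definition pseudostar :: "('k::field ^ 4) set set \<Rightarrow> bool" where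
  "pseudostar Z \<longleftrightarrow>
     (\<exists>(n::nat) H. n \<ge> 2 \<and> (\<forall>i\<in>{1..n}. is_plane (H i)) \<and> inj_on H {1..n} \<and>
        (\<forall>i j l. 1 \<le> i \<and> i < j \<and> j < l \<and> l \<le> n \<longrightarrow>
           \<not> (\<exists>L. is_line L \<and> L \<subseteq> H i \<inter> H j \<inter> H l)) \<and>
        Z = \<Union> {H i \<inter> H j | i j. 1 \<le> i \<and> i < j \<and> j \<le> n})"

end

theory Submission
  imports Defs "Berlekamp_Zassenhaus.Unique_Factorization_Poly"
begin

hide_const (open) Divisibility.irreducible
hide_const (open) UnivPoly.coeff UnivPoly.monom up_ring.coeff up_ring.monom Polynomials.degree module.smult

text \<open>
  For the forward direction let \<open>F\<close> be a form of degree \<open>d\<close> that is double along the lines. No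
  form of degree \<open>d - 2\<close> vanishes on the lines; by depth at least two, no nonzero form of degree
  \<open>d - 2\<close> on a general plane vanishes at the section points, which are singular points of the
  section of \<open>F\<close>. For a plane curve \<open>f\<close> of degree \<open>e \<ge> 3\<close> whose singular points lie on no curve of
  degree \<open>e - 2\<close>, a dimension count gives a relation \<open>A f = B G\<close> with \<open>deg G \<le> e - 2\<close> and
  \<open>deg B \<le> e - 1\<close>, so \<open>f\<close> is reducible. Inductively the section of \<open>F\<close> splits into \<open>d\<close>
  lines, and the section points are their pairwise intersections, each on exactly two of them.
  For a general plane, \<open>F\<close> does not vanish identically on the line joining the section points of two
  skew lines of the configuration. Hence the lines that cut a given line of the star meet pairwise
  and span a plane, and these \<open>d\<close> planes form the pseudostar.

  Conversely, a product of linear forms attains the type, and the lower bounds follow by restricting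
  a form to general lines in the planes and counting zeros with multiplicity.
\<close>

section \<open>Plane curves with many singular points\<close>

text \<open>The number \<open>d - 2\<close> has two origins that meet here: a form through the lines
  has degree at least \<open>d - 1\<close>, and a product of all but two of \<open>d\<close> linear
  factors has degree \<open>d - 2\<close>. This is why the hypothesis on forms of degree
  \<open>d - 2\<close> can be tested against pairs of lines. The Cohen-Macaulay condition makes the
  ideal I + (h) saturated when the plane h = 0 contains none of the lines, so a plane curve through
  the section points lifts to a surface through the lines. The characteristic is arbitrary: the
  partial derivatives of the section may vanish identically, and singular points cannot be counted
  on polar curves. The relation \<open>A f = B G\<close> avoids derivatives of \<open>f\<close>
  other than their vanishing at the given points, and unique factorization turns it into a factor of
  \<open>f\<close>. The hypothesis passes to factors because a test curve for one factor can be
  multiplied by the other. The plane curves are affine; the line at infinity is chosen off all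
  points that are evaluated.\<close>

lemma underdetermined_system:
  fixes a :: "'i \<Rightarrow> 'j \<Rightarrow> 'k::field"
  assumes "finite J" "finite I" "card J < card I"
  shows "\<exists>c. (\<exists>i\<in>I. c i \<noteq> 0) \<and> (\<forall>j\<in>J. (\<Sum>i\<in>I. c i * a i j) = 0)"
  using assms
proof (induction J arbitrary: I a rule: finite_induct)
  case empty
  then have "I \<noteq> {}" by auto
  then show ?case by (intro exI[of _ "\<lambda>_. 1"]) auto
next
  case (insert j J)
  show ?case
  proof (cases "\<forall>i\<in>I. a i j = 0")
    case True
    have "card J < card I" using insert by simp
    from insert.IH[OF insert.prems(1) this, of a] obtain c where
      "\<exists>i\<in>I. c i \<noteq> 0" "\<forall>j\<in>J. (\<Sum>i\<in>I. c i * a i j) = 0" by blast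
    with True show ?thesis by (intro exI[of _ c]) auto
  next
    case False
    then obtain i0 where i0: "i0 \<in> I" "a i0 j \<noteq> 0" by auto
    \<comment> \<open>Gaussian elimination: the pivot unknown \<open>i0\<close> is removed from the
      remaining equations by means of equation \<open>j\<close>, and its value is recovered from
      that equation afterwards.\<close>
    define a' where "a' i j' = a i j' - a i j / a i0 j * a i0 j'" for i j'
    have "finite (I - {i0})" "card J < card (I - {i0})"
      using insert i0 by auto
    from insert.IH[OF this, of a'] obtain c' where
      c': "\<exists>i\<in>I-{i0}. c' i \<noteq> 0" "\<forall>j\<in>J. (\<Sum>i\<in>I-{i0}. c' i * a' i j) = 0" by blast
    define c where "c = c'(i0 := - (\<Sum>i\<in>I-{i0}. c' i * a i j) / a i0 j)"
    have split: "(\<Sum>i\<in>I. c i * a i j') = c i0 * a i0 j' + (\<Sum>i\<in>I-{i0}. c' i * a i j')" for j'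
      using i0 insert.prems by (subst sum.remove[of I i0]) (auto simp: c_def intro!: sum.cong)
    have "(\<Sum>i\<in>I. c i * a i j) = 0"
      unfolding split using i0 by (simp add: c_def)
    moreover have "(\<Sum>i\<in>I. c i * a i j') = 0" if "j' \<in> J" for j'
    proof -
      have "0 = (\<Sum>i\<in>I-{i0}. c' i * a' i j')" using c'(2) that by simp
      also have "\<dots> = (\<Sum>i\<in>I-{i0}. c' i * a i j') - (\<Sum>i\<in>I-{i0}. c' i * a i j) / a i0 j * a i0 j'"
        by (simp add: a'_def right_diff_distrib sum_subtractf sum_divide_distrib sum_distrib_right sum_distrib_left mult_ac)
      also have "\<dots> = (\<Sum>i\<in>I. c i * a i j')" unfolding split by (simp add: c_def)
      finally show ?thesis by simp
    qed
    moreover have "\<exists>i\<in>I. c i \<noteq> 0" using c'(1) by (auto simp: c_def)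
    ultimately show ?thesis by (intro exI[of _ c]) auto
  qed
qed

section \<open>Total degree of polynomials in two variables\<close>

text \<open>Plane curves are nested polynomials: the outer exponent \<open>i\<close> belongs to the
  second affine coordinate, the inner exponent \<open>j\<close> to the first. The zero polynomial
  satisfies every bound, so its \<open>tdeg\<close> is 0.\<close>

definition tdeg_le :: "nat \<Rightarrow> 'k::zero poly poly \<Rightarrow> bool" where
  "tdeg_le t f \<longleftrightarrow> (\<forall>i j. coeff (coeff f i) j \<noteq> 0 \<longrightarrow> i + j \<le> t)"

definition tdeg :: "'k::zero poly poly \<Rightarrow> nat" where
  "tdeg f = (LEAST t. tdeg_le t f)"

lemma tdeg_leD: "tdeg_le t f \<Longrightarrow> t < i + j \<Longrightarrow> coeff (coeff f i) j = 0"
  unfolding tdeg_le_def by force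

lemma tdeg_le_mono: "tdeg_le t f \<Longrightarrow> t \<le> t' \<Longrightarrow> tdeg_le t' f"
  unfolding tdeg_le_def by force

lemma tdeg_le_0 [simp]: "tdeg_le t 0"
  by (simp add: tdeg_le_def)

lemma tdeg_le_const [simp]: "tdeg_le t [:[:c:]:]"
  by (auto simp: tdeg_le_def coeff_pCons split: nat.splits)

lemma tdeg_le_1 [simp]: "tdeg_le t (1 :: 'k::comm_semiring_1 poly poly)"
  by (auto simp: tdeg_le_def coeff_1)

lemma tdeg_le_add: "tdeg_le t f \<Longrightarrow> tdeg_le t g \<Longrightarrow> tdeg_le t (f + g)"
  unfolding tdeg_le_def by (metis add.left_neutral coeff_add)

lemma tdeg_le_sum: "(\<And>x. x \<in> U \<Longrightarrow> tdeg_le t (f x)) \<Longrightarrow> tdeg_le t (\<Sum>x\<in>U. f x)"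
  by (induction U rule: infinite_finite_induct) (auto intro: tdeg_le_add)

lemma tdeg_le_mult:
  fixes f g :: "'k::comm_semiring_0 poly poly"
  assumes "tdeg_le s f" "tdeg_le t g"
  shows "tdeg_le (s + t) (f * g)"
  unfolding tdeg_le_def
proof (intro allI impI)
  fix i j
  assume "coeff (coeff (f * g) i) j \<noteq> 0"
  then have "(\<Sum>a\<le>i. \<Sum>b\<le>j. coeff (coeff f a) b * coeff (coeff g (i - a)) (j - b)) \<noteq> 0"
    by (simp add: coeff_mult coeff_sum)
  then obtain a where "a \<le> i" "(\<Sum>b\<le>j. coeff (coeff f a) b * coeff (coeff g (i - a)) (j - b)) \<noteq> 0"
    by (metis (no_types, lifting) atMost_iff sum.neutral)
  then obtain b where *: "a \<le> i" "b \<le> j" "coeff (coeff f a) b * coeff (coeff g (i - a)) (j - b) \<noteq> 0"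
    by (metis (no_types, lifting) atMost_iff sum.neutral)
  then have "coeff (coeff f a) b \<noteq> 0" "coeff (coeff g (i - a)) (j - b) \<noteq> 0"
    by auto
  with assms have "a + b \<le> s" "(i - a) + (j - b) \<le> t"
    unfolding tdeg_le_def by blast+
  with * show "i + j \<le> s + t" by linarith
qed

lemma tdeg_le_exists: "\<exists>t. tdeg_le t f"
proof -
  define D where "D = (\<Sum>i\<le>degree f. degree (coeff f i))"
  have "i + j \<le> degree f + D" if "coeff (coeff f i) j \<noteq> 0" for i j
  proof -
    have "i \<le> degree f" using that by (metis coeff_0 le_degree)
    moreover have "j \<le> degree (coeff f i)" using that by (rule le_degree)
    moreover have "degree (coeff f i) \<le> D" unfolding D_def
      by (rule member_le_sum) (use \<open>i \<le> degree f\<close> in auto)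
    ultimately show ?thesis by linarith
  qed
  then show ?thesis unfolding tdeg_le_def by blast
qed

lemma tdeg_le_tdeg: "tdeg_le (tdeg f) f"
  unfolding tdeg_def using tdeg_le_exists by (rule LeastI_ex)

lemma tdeg_le_iff: "tdeg_le t f \<longleftrightarrow> tdeg f \<le> t"
  by (metis Least_le tdeg_def tdeg_le_mono tdeg_le_tdeg)

lemma tdeg_attained:
  assumes "f \<noteq> 0"
  shows "\<exists>i j. i + j = tdeg f \<and> coeff (coeff f i) j \<noteq> 0"
proof (rule ccontr)
  assume *: "\<not> ?thesis"
  show False
  proof (cases "tdeg f")
    case 0
    then have "coeff (coeff f i) j = 0" for i j
      using * tdeg_le_tdeg[of f] unfolding tdeg_le_def by (cases "i + j = 0") force+
    with assms show False by (metis coeff_0 poly_eqI)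
  next
    case (Suc t)
    then have "tdeg_le t f"
      using * tdeg_le_tdeg[of f] unfolding tdeg_le_def by (metis le_Suc_eq)
    with Suc show False by (simp add: tdeg_le_iff)
  qed
qed

text \<open>The coefficient of the product at the sum of the positions that are extremal among
  the monomials of top degree is a single product.\<close>
lemma tdeg_mult:
  fixes f g :: "'k::idom poly poly"
  assumes "f \<noteq> 0" "g \<noteq> 0"
  shows "tdeg (f * g) = tdeg f + tdeg g"
proof (rule antisym)
  show "tdeg (f * g) \<le> tdeg f + tdeg g"
    using tdeg_le_mult[OF tdeg_le_tdeg tdeg_le_tdeg] tdeg_le_iff by blast
  define P where "P f i \<longleftrightarrow> i \<le> tdeg f \<and> coeff (coeff f i) (tdeg f - i) \<noteq> 0"
    for f :: "'k poly poly" and i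
  have ex: "\<exists>m. P h m \<and> (\<forall>i. P h i \<longrightarrow> i \<le> m)" if h: "h \<noteq> 0" for h :: "'k poly poly"
  proof -
    obtain i j where "i + j = tdeg h" "coeff (coeff h i) j \<noteq> 0"
      using tdeg_attained[OF h] by blast
    then have "P h i" unfolding P_def by (metis add_diff_cancel_left' le_add1)
    moreover have "\<forall>y. P h y \<longrightarrow> y \<le> tdeg h" unfolding P_def by blast
    ultimately show ?thesis
      by (metis GreatestI_nat Greatest_le_nat)
  qed
  obtain a where a: "P f a" "\<And>i. P f i \<Longrightarrow> i \<le> a" using ex[OF assms(1)] by blast
  obtain b where b: "P g b" "\<And>i. P g i \<Longrightarrow> i \<le> b" using ex[OF assms(2)] by blast
  define s t where "s = tdeg f" and "t = tdeg g"
  have ab: "a \<le> s" "b \<le> t" using a b by (auto simp: P_def s_def t_def)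
  have z: "coeff (coeff f i * coeff g (a + b - i)) (s + t - (a + b)) =
      (if i = a then coeff (coeff f a) (s - a) * coeff (coeff g b) (t - b) else 0)"
    if "i \<le> a + b" for i
  proof -
    have "coeff (coeff f i) k * coeff (coeff g (a + b - i)) (s + t - (a + b) - k) =
       (if k = s - a \<and> i = a then coeff (coeff f a) (s - a) * coeff (coeff g b) (t - b) else 0)"
      if k: "k \<le> s + t - (a + b)" for k
    proof (cases "coeff (coeff f i) k = 0 \<or> coeff (coeff g (a + b - i)) (s + t - (a + b) - k) = 0")
      case True
      have "\<not> (k = s - a \<and> i = a)"
      proof
        assume "k = s - a \<and> i = a"
        moreover have "s + t - (a + b) - (s - a) = t - b" using ab by simp
        ultimately show False using True a(1) b(1) by (auto simp: P_def s_def t_def)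
      qed
      with True show ?thesis by auto
    next
      case False
      then have "i + k \<le> s" "(a + b - i) + (s + t - (a + b) - k) \<le> t"
        using tdeg_le_tdeg[of f] tdeg_le_tdeg[of g] unfolding tdeg_le_def s_def t_def by blast+
      \<comment> \<open>The four exponents add up to \<open>s + t\<close>, so both degree bounds are
        equalities.\<close>
      with ab k \<open>i \<le> a + b\<close> have ik: "i + k = s" "(a + b - i) + (s + t - (a + b) - k) = t" by linarith+
      have "P f i" using False ik(1) unfolding P_def s_def by (metis add_diff_cancel_left' le_add1)
      moreover have "P g (a + b - i)" using False ik(2) unfolding P_def t_def
        by (metis add_diff_cancel_left' le_add1)
      ultimately have "i \<le> a" "a + b - i \<le> b" using a b by blast+
      with \<open>i \<le> a + b\<close> have "i = a" by linarith
      with ik have "k = s - a" by linarith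
      moreover have "s + t - (a + b) - (s - a) = t - b" using ab by simp
      ultimately show ?thesis using \<open>i = a\<close> by simp
    qed
    then have "coeff (coeff f i * coeff g (a + b - i)) (s + t - (a + b)) =
      (\<Sum>k\<le>s + t - (a + b). (if k = s - a \<and> i = a then coeff (coeff f a) (s - a) * coeff (coeff g b) (t - b) else 0))"
      unfolding coeff_mult by (intro sum.cong) auto
    also have "\<dots> = (if i = a then coeff (coeff f a) (s - a) * coeff (coeff g b) (t - b) else 0)"
      using ab by auto
    finally show ?thesis .
  qed
  have "coeff (coeff (f * g) (a + b)) (s + t - (a + b)) =
     (\<Sum>i\<le>a + b. if i = a then coeff (coeff f a) (s - a) * coeff (coeff g b) (t - b) else 0)"
    unfolding coeff_mult[of f g] coeff_sum using z by (intro sum.cong) auto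
  also have "\<dots> = coeff (coeff f a) (s - a) * coeff (coeff g b) (t - b)" by simp
  finally have "coeff (coeff (f * g) (a + b)) (s + t - (a + b)) \<noteq> 0"
    using a(1) b(1) by (simp add: P_def s_def t_def)
  then have "(a + b) + (s + t - (a + b)) \<le> tdeg (f * g)"
    using tdeg_le_tdeg[of "f * g"] unfolding tdeg_le_def by blast
  with ab show "tdeg f + tdeg g \<le> tdeg (f * g)" by (simp add: s_def t_def)
qed

lemma tdeg_0_iff: "tdeg f = 0 \<longleftrightarrow> (\<exists>c. f = [:[:c:]:])"
proof
  assume "tdeg f = 0"
  then have *: "coeff (coeff f i) j = 0" if "i + j > 0" for i j
    using tdeg_le_tdeg[of f] that by (auto intro: tdeg_leD)
  have "f = [:[:coeff (coeff f 0) 0:]:]"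
    by (rule poly_eqI, rule poly_eqI) (use * in \<open>auto simp: coeff_pCons split: nat.splits\<close>)
  then show "\<exists>c. f = [:[:c:]:]" by blast
next
  assume "\<exists>c. f = [:[:c:]:]"
  then show "tdeg f = 0" using tdeg_le_iff by (metis le_zero_eq tdeg_le_const)
qed

section \<open>Interpolation and linear dependence in bounded degree\<close>

definition deg_set :: "nat \<Rightarrow> (nat \<times> nat) set" where
  "deg_set t = {(i, j). i + j \<le> t}"

lemma deg_set_eq: "deg_set t = (SIGMA i:{..t}. {..t - i})"
  unfolding deg_set_def by auto

lemma finite_deg_set [simp]: "finite (deg_set t)"
  unfolding deg_set_eq by auto

text \<open>Twice the dimension of the space of curves of degree at most \<open>t\<close>; the
  factor 2 keeps later counts free of division.\<close>

lemma card_deg_set: "2 * card (deg_set t) = (t + 1) * (t + 2)"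
proof -
  have "card (deg_set t) = (\<Sum>i\<le>t. Suc (t - i))" unfolding deg_set_eq by simp
  also have "\<dots> = (\<Sum>i\<le>t. Suc i)" by (rule sum.reindex_bij_witness[of _ "\<lambda>i. t - i" "\<lambda>i. t - i"]) auto
  also have "2 * \<dots> = (t + 1) * (t + 2)" by (induction t) auto
  finally show ?thesis .
qed

definition bmonom :: "nat \<times> nat \<Rightarrow> 'k::comm_ring_1 poly poly" where
  "bmonom = (\<lambda>(i, j). monom (monom 1 j) i)"

lemma coeff_bmonom: "coeff (coeff (bmonom (i, j)) i') j' = (if i' = i \<and> j' = j then 1 else 0)"
  by (auto simp: bmonom_def)

lemma tdeg_le_bmonom: "m \<in> deg_set t \<Longrightarrow> tdeg_le t (bmonom m)"
  by (cases m) (auto simp: tdeg_le_def coeff_bmonom deg_set_def split: if_splits)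

lemma coeff_sum_bmonom:
  assumes "finite U"
  shows "coeff (coeff (\<Sum>m\<in>U. [:[:c m:]:] * bmonom m) i) j = (if (i, j) \<in> U then c (i, j) else 0)"
proof -
  have "coeff (coeff (\<Sum>m\<in>U. [:[:c m:]:] * bmonom m) i) j = (\<Sum>m\<in>U. if m = (i, j) then c (i, j) else 0)"
    unfolding coeff_sum by (intro sum.cong) (auto simp: coeff_bmonom split: if_splits)
  also have "\<dots> = (if (i, j) \<in> U then c (i, j) else 0)" using assms by simp
  finally show ?thesis .
qed

definition ev2 :: "'k::comm_ring_1 poly poly \<Rightarrow> 'k \<times> 'k \<Rightarrow> 'k" where
  "ev2 f p = poly (poly f [:snd p:]) (fst p)"

text \<open>Formal partial derivatives, already evaluated at \<open>p\<close>: \<open>dx\<close>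
  fixes the second coordinate and differentiates in the inner variable, \<open>dy\<close>
  differentiates in the outer variable.\<close>

definition dx :: "'k::idom poly poly \<Rightarrow> 'k \<times> 'k \<Rightarrow> 'k" where
  "dx f p = poly (pderiv (poly f [:snd p:])) (fst p)"

definition dy :: "'k::idom poly poly \<Rightarrow> 'k \<times> 'k \<Rightarrow> 'k" where
  "dy f p = ev2 (pderiv f) p"

lemma ev2_simps [simp]:
  "ev2 0 p = 0" "ev2 1 p = 1" "ev2 (f + g) p = ev2 f p + ev2 g p" "ev2 (f * g) p = ev2 f p * ev2 g p"
  "ev2 (- f) p = - ev2 f p" "ev2 (f - g) p = ev2 f p - ev2 g p"
  "ev2 [:[:c:]:] p = c" "ev2 (\<Sum>x\<in>U. h x) p = (\<Sum>x\<in>U. ev2 (h x) p)"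
  "ev2 (\<Prod>x\<in>U. h x) p = (\<Prod>x\<in>U. ev2 (h x) p)" "ev2 (f ^ n) p = ev2 f p ^ n"
  by (auto simp: ev2_def poly_sum poly_prod)

lemma dx_simps [simp]:
  "dx 0 p = 0" "dx (f + g) p = dx f p + dx g p" "dx (f * g) p = ev2 f p * dx g p + ev2 g p * dx f p"
  "dx (- f) p = - dx f p" "dx (f - g) p = dx f p - dx g p" "dx [:[:c:]:] p = 0" 
  "dx (\<Sum>x\<in>U. h x) p = (\<Sum>x\<in>U. dx (h x) p)"
  by (auto simp: dx_def ev2_def pderiv_add pderiv_mult pderiv_minus pderiv_diff poly_sum pderiv_sum)

lemma dy_simps [simp]:
  "dy 0 p = 0" "dy (f + g) p = dy f p + dy g p" "dy (f * g) p = ev2 f p * dy g p + ev2 g p * dy f p"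
  "dy (- f) p = - dy f p" "dy (f - g) p = dy f p - dy g p" "dy [:[:c:]:] p = 0" 
  "dy (\<Sum>x\<in>U. h x) p = (\<Sum>x\<in>U. dy (h x) p)"
  by (auto simp: dy_def pderiv_add pderiv_mult pderiv_minus pderiv_diff pderiv_sum)

lemma ev2_smult [simp]: "ev2 (smult q f) p = poly q (fst p) * ev2 f p"
  by (simp add: ev2_def)

lemma dx_smult [simp]: "dx (smult [:c:] f) p = c * dx f p"
  by (simp add: dx_def pderiv_smult)

lemma dy_smult [simp]: "dy (smult [:c:] f) p = c * dy f p"
  by (simp add: dy_def pderiv_smult)

definition sing_at :: "'k::idom poly poly \<Rightarrow> 'k \<times> 'k \<Rightarrow> bool" where
  "sing_at f p \<longleftrightarrow> ev2 f p = 0 \<and> dx f p = 0 \<and> dy f p = 0"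

text \<open>The unknowns are the coefficients, and every point imposes one linear equation.\<close>

lemma vanishing_form_exists:
  fixes Y :: "('k::field \<times> 'k) set"
  assumes "finite Y" "card Y < card (deg_set t)"
  shows "\<exists>g. g \<noteq> 0 \<and> tdeg_le t g \<and> (\<forall>y\<in>Y. ev2 g y = 0)"
proof -
  from underdetermined_system[OF assms(1) finite_deg_set assms(2), of "\<lambda>m y. ev2 (bmonom m) y"]
  obtain c where c: "\<exists>m\<in>deg_set t. c m \<noteq> 0"
    "\<forall>y\<in>Y. (\<Sum>m\<in>deg_set t. c m * ev2 (bmonom m) y) = 0" by blast
  define g where "g = (\<Sum>m\<in>deg_set t. [:[:c m:]:] * bmonom m)"
  have "tdeg_le t g" unfolding g_def
    by (intro tdeg_le_sum) (metis add_0 tdeg_le_bmonom tdeg_le_const tdeg_le_mult)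
  moreover from c(1) obtain i j where "(i, j) \<in> deg_set t" "c (i, j) \<noteq> 0" by auto
  then have "coeff (coeff g i) j \<noteq> 0" unfolding g_def by (subst coeff_sum_bmonom) auto
  then have "g \<noteq> 0" by auto
  moreover have "\<forall>y\<in>Y. ev2 g y = 0" using c(2) by (simp add: g_def)
  ultimately show ?thesis by blast
qed

text \<open>Here the multipliers are the unknowns and the coefficient positions up to degree
  \<open>t\<close> are the equations.\<close>

lemma bounded_family_dependent:
  fixes w :: "'i \<Rightarrow> 'k::field poly poly"
  assumes "finite K" "card (deg_set t) < card K" "\<And>k. k \<in> K \<Longrightarrow> tdeg_le t (w k)"
  shows "\<exists>c. (\<exists>k\<in>K. c k \<noteq> 0) \<and> (\<Sum>k\<in>K. [:[:c k:]:] * w k) = 0"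
proof -
  from underdetermined_system[OF finite_deg_set assms(1,2), of "\<lambda>k (i, j). coeff (coeff (w k) i) j"]
  obtain c where c: "\<exists>k\<in>K. c k \<noteq> 0"
    "\<And>i j. (i, j) \<in> deg_set t \<Longrightarrow> (\<Sum>k\<in>K. c k * coeff (coeff (w k) i) j) = 0" by fastforce
  have "(\<Sum>k\<in>K. c k * coeff (coeff (w k) i) j) = 0" for i j
  proof (cases "(i, j) \<in> deg_set t")
    case False
    then show ?thesis using assms(3) by (intro sum.neutral) (metis (no_types, lifting) case_prodI deg_set_def mem_Collect_eq mult_zero_right not_le tdeg_leD)
  qed (use c in auto)
  then have "(\<Sum>k\<in>K. [:[:c k:]:] * w k) = 0"
    by (intro poly_eqI) (simp add: coeff_sum)
  with c show ?thesis by blast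
qed

definition lin :: "'k \<Rightarrow> 'k \<Rightarrow> 'k \<Rightarrow> 'k::zero poly poly" where
  "lin \<alpha> \<beta> \<gamma> = [:[:\<alpha>, \<beta>:], [:\<gamma>:]:]"

lemma linear_form:
  assumes "tdeg_le 1 (l :: 'k::idom poly poly)"
  obtains \<alpha> \<beta> \<gamma> where "l = lin \<alpha> \<beta> \<gamma>"
proof
  show "l = lin (coeff (coeff l 0) 0) (coeff (coeff l 0) 1) (coeff (coeff l 1) 0)"
    by (rule poly_eqI, rule poly_eqI)
       (use tdeg_leD[OF assms] in \<open>auto simp: lin_def coeff_pCons split: nat.splits\<close>)
qed

lemma tdeg_le_linear: "tdeg_le 1 (lin \<alpha> \<beta> \<gamma>)"
  by (auto simp: lin_def tdeg_le_def coeff_pCons split: nat.splits)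

lemma ev2_linear [simp]: "ev2 (lin \<alpha> \<beta> \<gamma>) p = \<alpha> + \<beta> * fst p + \<gamma> * snd p"
  by (simp add: lin_def ev2_def algebra_simps)

lemma dx_linear [simp]: "dx (lin \<alpha> \<beta> \<gamma>) p = \<beta>"
  by (simp add: lin_def dx_def pderiv_pCons)

lemma dy_linear [simp]: "dy (lin \<alpha> \<beta> \<gamma>) p = \<gamma>"
  by (simp add: lin_def dy_def ev2_def pderiv_pCons)

section \<open>From singular points to a reducible curve\<close>

text \<open>Take \<open>Z\<close> of least cardinality among the subsets of \<open>Y\<close> that
  lie on no curve of degree \<open>t\<close>. Dropping a point \<open>p\<close> admits such a curve,
  and it cannot pass through \<open>p\<close>: this is the dual form \<open>G p\<close>. A set
  smaller than the dimension of the space of curves would admit a curve by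
  \<open>vanishing_form_exists\<close>.\<close>

lemma minimal_vanishing_subset:
  fixes Y :: "('k::field \<times> 'k) set"
  assumes "finite Y" and no: "\<And>g. g \<noteq> 0 \<Longrightarrow> tdeg_le t g \<Longrightarrow> \<exists>y\<in>Y. ev2 g y \<noteq> 0"
  obtains Z G where "Z \<subseteq> Y" "card (deg_set t) \<le> card Z"
    "\<And>p. p \<in> Z \<Longrightarrow> tdeg_le t (G p)" "\<And>p. p \<in> Z \<Longrightarrow> ev2 (G p) p \<noteq> 0"
    "\<And>p q. p \<in> Z \<Longrightarrow> q \<in> Z \<Longrightarrow> q \<noteq> p \<Longrightarrow> ev2 (G p) q = 0"
proof -
  define Q where "Q Z \<longleftrightarrow> Z \<subseteq> Y \<and> (\<forall>g. g \<noteq> 0 \<longrightarrow> tdeg_le t g \<longrightarrow> (\<exists>y\<in>Z. ev2 g y \<noteq> 0))" for Z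
  have "Q Y" using no by (auto simp: Q_def)
  then obtain Z where Z: "Q Z" "\<And>Z'. Q Z' \<Longrightarrow> card Z \<le> card Z'"
    using ex_has_least_nat[of Q Y card] by blast
  have fin: "finite Z" using Z(1) \<open>finite Y\<close> finite_subset unfolding Q_def by blast
  have "\<exists>g. tdeg_le t g \<and> ev2 g p \<noteq> 0 \<and> (\<forall>q\<in>Z. q \<noteq> p \<longrightarrow> ev2 g q = 0)" if "p \<in> Z" for p
  proof -
    have "card (Z - {p}) < card Z" using card_Diff1_less[OF fin that] .
    then have "\<not> Q (Z - {p})" using Z(2) by (meson not_le)
    then obtain g where "g \<noteq> 0" "tdeg_le t g" "\<forall>q\<in>Z - {p}. ev2 g q = 0"
      using Z(1) unfolding Q_def by blast
    moreover from this(1,2) obtain y where "y \<in> Z" "ev2 g y \<noteq> 0" using Z(1) unfolding Q_def by blast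
    ultimately show ?thesis by (metis Diff_iff singletonD)
  qed
  then obtain G where "\<And>p. p \<in> Z \<Longrightarrow> tdeg_le t (G p)" "\<And>p. p \<in> Z \<Longrightarrow> ev2 (G p) p \<noteq> 0"
    "\<And>p q. p \<in> Z \<Longrightarrow> q \<in> Z \<Longrightarrow> q \<noteq> p \<Longrightarrow> ev2 (G p) q = 0" by metis
  moreover have "card (deg_set t) \<le> card Z"
  proof (rule ccontr)
    assume "\<not> ?thesis"
    then show False using vanishing_form_exists[OF fin, of t] Z(1) unfolding Q_def by auto
  qed
  ultimately show ?thesis using that[of Z G] Z(1) unfolding Q_def by blast
qed

text \<open>Fix \<open>p\<^sub>0\<close> and let \<open>G\<close> be its dual form. Every combination \<open>A f + B G\<close> vanishes at the other
  points \<open>p\<close> to first order along the tangent of \<open>G\<close>. These conditions are independent, as the forms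
  \<open>G\<^sub>p\<^sup>2\<close> and \<open>G\<^sub>p\<^sup>2 \<lambda>\<close> show, and there are too many of them for \<open>(A, B) \<mapsto> A f + B G\<close> to be injective.\<close>
lemma singular_syzygy:
  fixes f :: "'k::field poly poly"
  assumes e: "e \<ge> 3" and f: "tdeg_le e f" and fin: "finite Y" and sing: "\<And>y. y \<in> Y \<Longrightarrow> sing_at f y"
    and no: "\<And>g. g \<noteq> 0 \<Longrightarrow> tdeg_le (e - 2) g \<Longrightarrow> \<exists>y\<in>Y. ev2 g y \<noteq> 0"
  obtains A B G where "G \<noteq> 0" "tdeg_le (e - 2) G" "tdeg_le (e - 1) B" "A \<noteq> 0 \<or> B \<noteq> 0" "A * f = B * G"
proof -
  obtain Z G where Z: "Z \<subseteq> Y" "card (deg_set (e - 2)) \<le> card Z"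
    and G: "\<And>p. p \<in> Z \<Longrightarrow> tdeg_le (e - 2) (G p)" "\<And>p. p \<in> Z \<Longrightarrow> ev2 (G p) p \<noteq> 0"
    "\<And>p q. p \<in> Z \<Longrightarrow> q \<in> Z \<Longrightarrow> q \<noteq> p \<Longrightarrow> ev2 (G p) q = 0"
    by (rule minimal_vanishing_subset[OF fin no]) blast+
  have finZ: "finite Z" using Z(1) fin finite_subset by blast
  obtain n where n: "e = n + 3" using e by (metis add.commute le_Suc_ex)
  have "2 * card (deg_set (n + 1)) = (n + 2) * (n + 3)" by (subst card_deg_set) (simp add: algebra_simps)
  moreover have "e - 2 = n + 1" by (simp add: n)
  ultimately have "2 * card (deg_set (e - 2)) = (n + 2) * (n + 3)" by simp
  then have cardZ: "(n + 2) * (n + 3) \<le> 2 * card Z" using Z(2) by linarith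
  then have "Z \<noteq> {}" by auto
  then obtain p0 where p0: "p0 \<in> Z" by blast
  define G0 where "G0 = G p0"
  define Z0 where "Z0 = Z - {p0}"
  have Z0: "p \<in> Z" "p \<noteq> p0" if "p \<in> Z0" for p using that by (auto simp: Z0_def)
  have "G0 \<noteq> 0" using G(2)[OF p0] by (auto simp: G0_def)
  \<comment> \<open>A nonzero tangent direction of \<open>G0\<close> at \<open>p\<close>; where the
    gradient of \<open>G0\<close> vanishes every direction is tangent and \<open>(1, 0)\<close> is
    taken.\<close>
  define v where "v p = (if dx G0 p = 0 \<and> dy G0 p = 0 then (1, 0) else (- dy G0 p, dx G0 p))" for p
  have v: "fst (v p) * dx G0 p + snd (v p) * dy G0 p = 0" "v p \<noteq> (0, 0)" for p
    by (auto simp: v_def mult.commute)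
  define D where "D h p = fst (v p) * dx h p + snd (v p) * dy h p" for h p
  \<comment> \<open>A line through \<open>p\<close> transversal to \<open>v p\<close>: of the two
    coordinate lines through \<open>p\<close>, one whose derivative along \<open>v p\<close> is
    nonzero.\<close>
  define lam where "lam p = (if fst (v p) \<noteq> 0 then lin (- fst p) 1 0 else lin (- snd p) 0 1)"
    for p :: "'k \<times> 'k"
  have lam: "ev2 (lam p) p = 0" "D (lam p) p \<noteq> 0" "tdeg_le 1 (lam p)" for p
  proof -
    have nz: "fst (v p) \<noteq> 0 \<or> snd (v p) \<noteq> 0" using v(2)[of p] prod_eq_iff[of "v p" "(0, 0)"] by simp
    show "ev2 (lam p) p = 0" by (simp add: lam_def)
    show "D (lam p) p \<noteq> 0"
    proof (cases "fst (v p) = 0")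
      case True
      then have "D (lam p) p = snd (v p)" by (simp add: lam_def D_def)
      with True nz show ?thesis by simp
    next
      case False
      then show ?thesis by (simp add: lam_def D_def)
    qed
    show "tdeg_le 1 (lam p)" by (auto simp: lam_def tdeg_le_linear[simplified])
  qed
  \<comment> \<open>Index set of the family: monomials for the coefficient \<open>A\<close> of
    \<open>f\<close>, monomials for the coefficient \<open>B\<close> of \<open>G0\<close>, and two
    test forms for each remaining point.\<close>
  define K where "K = (Inl ` Inl ` deg_set (e - 3)) \<union> (Inl ` Inr ` deg_set (e - 1)) \<union> (Inr ` (Z0 \<times> (UNIV :: bool set)))"
  define w where "w = (\<lambda>k. case k of Inl (Inl m) \<Rightarrow> bmonom m * f | Inl (Inr m) \<Rightarrow> bmonom m * G0
      | Inr (p, b) \<Rightarrow> G p * G p * (if b then lam p else 1))"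
  \<comment> \<open>With \<open>e = n + 3\<close> and \<open>card Z\<close> at its lower bound,
    \<open>K\<close> has 2n^2 + 10n + 11 elements, while the polynomials of degree at most
    \<open>2 * e - 3\<close> form a space of dimension 2n^2 + 9n + 10. The excess is n + 1.\<close>
  have cardK: "card (deg_set (2 * e - 3)) < card K"
  proof -
    have "card K = card (deg_set n) + card (deg_set (n + 2)) + 2 * card Z0"
      unfolding K_def using finZ
      by (subst card_Un_disjoint; (subst card_Un_disjoint)?)
         (auto simp: card_image inj_on_def Z0_def card_cartesian_product n)
    moreover have "card Z0 = card Z - 1" using p0 finZ by (simp add: Z0_def)
    moreover have "2 * card (deg_set n) = (n + 1) * (n + 2)" "2 * card (deg_set (n + 2)) = (n + 3) * (n + 4)"
      "2 * card (deg_set (2 * e - 3)) = (2 * n + 4) * (2 * n + 5)"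
      unfolding card_deg_set by (simp_all add: n algebra_simps)
    ultimately show ?thesis using cardZ \<open>Z \<noteq> {}\<close> finZ by (simp add: algebra_simps)
  qed
  have finZ0: "finite Z0" using finZ by (simp add: Z0_def)
  have finK: "finite K" using finZ0 by (simp add: K_def)
  have w: "tdeg_le (2 * e - 3) (w k)" if k: "k \<in> K" for k
  proof -
    consider m where "m \<in> deg_set (e - 3)" "k = Inl (Inl m)" | m where "m \<in> deg_set (e - 1)" "k = Inl (Inr m)"
      | p b where "p \<in> Z0" "k = Inr (p, b)" using k unfolding K_def by blast
    then show ?thesis
    proof cases
      case 1
      have "2 * e - 3 = (e - 3) + e" using e by simp
      then show ?thesis using tdeg_le_mult[OF tdeg_le_bmonom[OF 1(1)] f] 1(2) by (simp add: w_def)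
    next
      case 2
      have "2 * e - 3 = (e - 1) + (e - 2)" using e by simp
      then show ?thesis using tdeg_le_mult[OF tdeg_le_bmonom[OF 2(1)] G(1)[OF p0]] 2(2) 
        by (simp add: w_def G0_def)
    next
      case 3
      have "tdeg_le 1 (if b then lam p else 1)" using lam(3)[of p] by (cases b) simp_all
      from tdeg_le_mult[OF tdeg_le_mult[OF G(1) G(1)] this, of p p] Z0[OF 3(1)]
      have *: "tdeg_le (e - 2 + (e - 2) + 1) (G p * G p * (if b then lam p else 1))" by blast
      have "2 * e - 3 = e - 2 + (e - 2) + 1" using e by simp
      then have "tdeg_le (2 * e - 3) (G p * G p * (if b then lam p else 1))" using * by (simp only:)
      moreover have "w k = G p * G p * (if b then lam p else 1)" using 3(2) by (simp add: w_def)
      ultimately show ?thesis by (simp only:)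
    qed
  qed
  have "\<exists>c. (\<exists>k\<in>K. c k \<noteq> 0) \<and> (\<Sum>k\<in>K. [:[:c k:]:] * w k) = 0"
    by (rule bounded_family_dependent[OF finK cardK w])
  then obtain c where "(\<exists>k\<in>K. c k \<noteq> 0) \<and> (\<Sum>k\<in>K. [:[:c k:]:] * w k) = 0" by (rule exE)
  note c = conjunct1[OF this] conjunct2[OF this]
  define A where "A = (\<Sum>m\<in>deg_set (e - 3). [:[:c (Inl (Inl m)):]:] * bmonom m)"
  define B where "B = (\<Sum>m\<in>deg_set (e - 1). [:[:c (Inl (Inr m)):]:] * bmonom m)"
  define R where "R = (\<Sum>p\<in>Z0. \<Sum>b\<in>UNIV. [:[:c (Inr (p, b)):]:] * (G p * G p * (if b then lam p else 1)))"
  have "(\<Sum>k\<in>K. [:[:c k:]:] * w k) =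
     (\<Sum>k\<in>Inl ` Inl ` deg_set (e - 3). [:[:c k:]:] * w k) + (\<Sum>k\<in>Inl ` Inr ` deg_set (e - 1). [:[:c k:]:] * w k)
     + (\<Sum>k\<in>Inr ` (Z0 \<times> UNIV). [:[:c k:]:] * w k)"
    unfolding K_def using finZ0
    by (subst sum.union_disjoint; (subst sum.union_disjoint)?) auto
  also have "(\<Sum>k\<in>Inl ` Inl ` deg_set (e - 3). [:[:c k:]:] * w k) = A * f"
    by (simp only: image_image A_def sum_distrib_right)
       (subst sum.reindex, auto simp: inj_on_def w_def mult_ac)
  also have "(\<Sum>k\<in>Inl ` Inr ` deg_set (e - 1). [:[:c k:]:] * w k) = B * G0"
    by (simp only: image_image B_def sum_distrib_right)
       (subst sum.reindex, auto simp: inj_on_def w_def mult_ac)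
  also have "(\<Sum>k\<in>Inr ` (Z0 \<times> UNIV). [:[:c k:]:] * w k) = R"
    unfolding R_def sum.cartesian_product
    by (subst sum.reindex) (auto simp: inj_on_def w_def intro!: sum.cong)
  finally have eq: "A * f + B * G0 + R = 0" using c(2) by simp
  have cR: "c (Inr (p, False)) = 0 \<and> c (Inr (p, True)) = 0" if p: "p \<in> Z0" for p
  proof -
    have sp: "ev2 f p = 0" "dx f p = 0" "dy f p = 0" using sing[of p] Z0(1)[OF p] Z(1) unfolding sing_at_def by blast+
    have gp: "ev2 G0 p = 0" using G(3)[OF p0 Z0[OF p]] by (simp add: G0_def)
    have z: "ev2 (G q) p = 0" if "q \<in> Z0" "q \<noteq> p" for q using G(3) that Z0 p by metis
    have "ev2 R p = (\<Sum>q\<in>Z0. if q = p then c (Inr (p, False)) * (ev2 (G p) p)\<^sup>2 else 0)"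
      unfolding R_def ev2_simps(8)
      by (intro sum.cong refl) (use z lam(1) in \<open>auto simp: UNIV_bool power2_eq_square\<close>)
    also have "\<dots> = c (Inr (p, False)) * (ev2 (G p) p)\<^sup>2" using p finZ0 by simp
    finally have R0: "ev2 R p = c (Inr (p, False)) * (ev2 (G p) p)\<^sup>2" .
    have "ev2 (A * f + B * G0 + R) p = 0" using eq by simp
    then have c0: "c (Inr (p, False)) = 0" using R0 sp gp G(2)[OF Z0(1)[OF p]] by simp
    have D_sum: "D (\<Sum>q\<in>U. h q) p = (\<Sum>q\<in>U. D (h q) p)" for U :: "('k \<times> 'k) set" and h
      by (simp add: D_def sum.distrib sum_distrib_left)
    \<comment> \<open>The squares matter: for \<open>q \<noteq> p\<close> the square of
      \<open>G q\<close> vanishes doubly at \<open>p\<close>, so it drops out of the derivative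
      along \<open>v p\<close> as well.\<close>
    have "D R p = (\<Sum>q\<in>Z0. if q = p then c (Inr (p, True)) * ((ev2 (G p) p)\<^sup>2 * D (lam p) p) else 0)"
      unfolding R_def D_sum
      by (intro sum.cong refl) (use z lam(1) c0 in \<open>auto simp: UNIV_bool power2_eq_square D_def algebra_simps\<close>)
    also have "\<dots> = c (Inr (p, True)) * ((ev2 (G p) p)\<^sup>2 * D (lam p) p)" using p finZ0 by simp
    finally have DR: "D R p = c (Inr (p, True)) * ((ev2 (G p) p)\<^sup>2 * D (lam p) p)" .
    have "D (A * f + B * G0 + R) p = D (A * f) p + D (B * G0) p + D R p"
      by (simp add: D_def algebra_simps)
    moreover have "D (A * f) p = 0" using sp by (simp add: D_def)
    moreover have "D (B * G0) p = ev2 B p * (fst (v p) * dx G0 p + snd (v p) * dy G0 p)" using gp by (simp add: D_def algebra_simps)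
    ultimately have "D R p = 0" using v(1)[of p] eq by (simp add: D_def)
    with DR c0 show ?thesis using G(2)[OF Z0(1)[OF p]] lam(2)[of p] by simp
  qed
  then have "R = 0" unfolding R_def by (simp add: UNIV_bool)
  with eq have "(- A) * f = B * G0" by (simp add: neg_eq_iff_add_eq_0)
  moreover have "A \<noteq> 0 \<or> B \<noteq> 0"
  proof -
    from c(1) obtain k where k: "k \<in> K" "c k \<noteq> 0" by blast
    have "k \<notin> Inr ` (Z0 \<times> UNIV)"
    proof
      assume "k \<in> Inr ` (Z0 \<times> UNIV)"
      then obtain p b where "p \<in> Z0" "k = Inr (p, b)" by blast
      with cR[of p] k(2) show False by (cases b) auto
    qed
    then consider i j where "(i, j) \<in> deg_set (e - 3)" "k = Inl (Inl (i, j))"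
      | i j where "(i, j) \<in> deg_set (e - 1)" "k = Inl (Inr (i, j))"
      using k(1) unfolding K_def by auto
    then show ?thesis
    proof cases
      case 1
      with k(2) have "coeff (coeff A i) j \<noteq> 0" unfolding A_def by (subst coeff_sum_bmonom) auto
      then show ?thesis by auto
    next
      case 2
      with k(2) have "coeff (coeff B i) j \<noteq> 0" unfolding B_def by (subst coeff_sum_bmonom) auto
      then show ?thesis by auto
    qed
  qed
  moreover have "tdeg_le (e - 1) B" unfolding B_def
    by (intro tdeg_le_sum) (metis add_0 tdeg_le_bmonom tdeg_le_const tdeg_le_mult)
  moreover have "tdeg_le (e - 2) G0" using G(1) p0 by (simp add: G0_def)
  ultimately show ?thesis using that[of G0 B "- A"] \<open>G0 \<noteq> 0\<close> by simp
qed

text \<open>In the factorial ring of polynomials in two variables an irreducible \<open>f\<close> is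
  prime. From \<open>A * f = B * G\<close> it would divide \<open>B\<close> or \<open>G\<close>,
  which are nonzero and of smaller total degree.\<close>

lemma reducible_of_singular:
  fixes f :: "'k::field poly poly"
  assumes e: "tdeg f \<ge> 3" and fin: "finite Y" and sing: "\<And>y. y \<in> Y \<Longrightarrow> sing_at f y"
    and no: "\<And>g. g \<noteq> 0 \<Longrightarrow> tdeg_le (tdeg f - 2) g \<Longrightarrow> \<exists>y\<in>Y. ev2 g y \<noteq> 0"
  obtains g h where "f = g * h" "tdeg g > 0" "tdeg h > 0"
proof -
  have "tdeg (0 :: 'k poly poly) = 0" unfolding tdeg_0_iff by (intro exI[of _ 0]) simp
  then have f0: "f \<noteq> 0" using e by auto
  obtain A B G where *: "G \<noteq> 0" "tdeg_le (tdeg f - 2) G" "tdeg_le (tdeg f - 1) B" "A \<noteq> 0 \<or> B \<noteq> 0" "A * f = B * G"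
    by (rule singular_syzygy[OF e tdeg_le_tdeg fin sing no])
  have "B \<noteq> 0"
  proof
    assume "B = 0"
    then have "A * f = 0" "A \<noteq> 0" using *(4,5) by simp_all
    with f0 show False by simp
  qed
  have unit: "h dvd 1" if h: "tdeg h = 0" "h \<noteq> 0" for h :: "'k poly poly"
  proof -
    obtain c where c: "h = [:[:c:]:]" using h(1) tdeg_0_iff by blast
    then have "c \<noteq> 0" using h(2) by auto
    then have "1 = h * [:[:inverse c:]:]" using c by simp
    then show ?thesis by (rule dvdI)
  qed
  have small: "\<not> f dvd h" if "h \<noteq> 0" "tdeg h < tdeg f" for h
  proof
    assume "f dvd h"
    then obtain q where "h = f * q" by (rule dvdE)
    moreover from this that have "q \<noteq> 0" by auto
    ultimately have "tdeg h = tdeg f + tdeg q" using tdeg_mult[OF f0] by simp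
    with that(2) show False by simp
  qed
  have "\<not> irreducible f"
  proof
    assume "irreducible f"
    then have "prime_elem f" by simp
    moreover have "f dvd B * G" unfolding *(5)[symmetric] by simp
    ultimately have "f dvd B \<or> f dvd G" by (simp add: prime_elem_dvd_mult_iff)
    moreover have "\<not> f dvd B" using small[OF \<open>B \<noteq> 0\<close>] *(3) e unfolding tdeg_le_iff by linarith
    moreover have "\<not> f dvd G" using small[OF *(1)] *(2) e unfolding tdeg_le_iff by linarith
    ultimately show False by blast
  qed
  moreover have "\<not> f dvd 1" using small[OF one_neq_zero] e tdeg_le_1[of 0, where 'k='k] unfolding tdeg_le_iff by linarith
  ultimately obtain g h where gh: "f = g * h" "\<not> g dvd 1" "\<not> h dvd 1"
    using f0 unfolding Factorial_Ring.irreducible_def by metis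
  have "g \<noteq> 0" "h \<noteq> 0" using gh(1) f0 by auto
  then have "tdeg g \<noteq> 0" "tdeg h \<noteq> 0" using unit gh(2,3) by blast+
  then show ?thesis using that[OF gh(1)] by simp
qed

text \<open>The product rule at a zero of \<open>g\<close>: the derivatives of \<open>g * h\<close>
  are those of \<open>g\<close> times the nonzero value of \<open>h\<close>.\<close>

lemma sing_at_factor:
  assumes "sing_at (g * h) y" "ev2 h y \<noteq> 0"
  shows "sing_at g y"
proof -
  have g: "ev2 g y = 0" using assms by (simp add: sing_at_def)
  moreover have "ev2 h y * dx g y = 0" "ev2 h y * dy g y = 0"
    using assms(1) g by (simp_all add: sing_at_def)
  ultimately show ?thesis using assms(2) by (simp add: sing_at_def)
qed

section \<open>Splitting a curve into lines\<close>

text \<open>Centred at its singular point a conic is a binary quadratic form, and that splits over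
  an algebraically closed field. The three equations are solved for \<open>k00\<close>,
  \<open>k01\<close> and \<open>k10\<close>, so nothing is divided by 2 and characteristic 2 is
  covered.\<close>

lemma singular_conic_splits:
  fixes f :: "'k::alg_closed_field poly poly"
  assumes f: "tdeg_le 2 f" and sing: "sing_at f p"
  obtains l1 l2 where "f = l1 * l2" "tdeg_le 1 l1" "tdeg_le 1 l2"
proof -
  define k where "k i j = coeff (coeff f i) j" for i j
  define k00 k01 k02 k10 k11 k20 where ks: "k00 = k 0 0" "k01 = k 0 1" "k02 = k 0 2" "k10 = k 1 0" "k11 = k 1 1" "k20 = k 2 0"
  define a b where "a = fst p" and "b = snd p"
  have f_eq: "f = [:[:k00, k01, k02:], [:k10, k11:], [:k20:]:]"
    by (rule poly_eqI, rule poly_eqI)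
       (use tdeg_leD[OF f] in \<open>auto simp: ks k_def coeff_pCons numeral_2_eq_2 split: nat.splits\<close>)
  have "ev2 f p = 0" "dx f p = 0" "dy f p = 0" using sing by (auto simp: sing_at_def)
  then have eqs: "k00 + k01 * a + k02 * a^2 + b * (k10 + k11 * a) + b^2 * k20 = 0"
    "k01 + 2 * k02 * a + b * k11 = 0" "k10 + k11 * a + 2 * b * k20 = 0"
    by (subst (asm) f_eq, simp add: ev2_def dx_def dy_def a_def[symmetric] b_def[symmetric]
       pderiv_pCons power2_eq_square algebra_simps)+
  have c01: "k01 = - (2 * k02 * a + b * k11)" using eqs(2) by (simp add: eq_neg_iff_add_eq_0 algebra_simps)
  have c10: "k10 = - (k11 * a + 2 * b * k20)" using eqs(3) by (simp add: eq_neg_iff_add_eq_0 algebra_simps)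
  have "k00 = - (k01 * a + k02 * a^2 + b * (k10 + k11 * a) + b^2 * k20)"
    using eqs(1) by (simp add: eq_neg_iff_add_eq_0 algebra_simps)
  then have c00: "k00 = k02 * a^2 + k11 * a * b + k20 * b^2"
    unfolding c01 c10 by (simp add: algebra_simps power2_eq_square)
  \<comment> \<open>Now \<open>f\<close> is k02 X^2 + k11 X Y + k20 Y^2 with X = x - a and Y = y -
    b. For \<open>k02 = 0\<close> it has the factor Y, otherwise X - r Y for a root
    \<open>r\<close>.\<close>
  show ?thesis
  proof (cases "k02 = 0")
    case True
    have "f = lin (- b) 0 1 * lin (- k11 * a - k20 * b) (k11) (k20)"
      by (subst f_eq) (simp add: lin_def c00 c01 c10 True power2_eq_square algebra_simps)
    then show ?thesis using that tdeg_le_linear by blast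
  next
    case False
    have "degree [:k20, k11, k02:] > 0" using False by simp
    then obtain r where "poly [:k20, k11, k02:] r = 0" using alg_closed_imp_poly_has_root by blast
    then have k20: "k20 = - (k02 * r + k11) * r" by (simp add: eq_neg_iff_add_eq_0 algebra_simps)
    have "f = lin (- a + r * b) 1 (- r) * lin (- k02 * a - (k02 * r + k11) * b) (k02) (k02 * r + k11)"
      by (subst f_eq) (simp add: lin_def c00 c01 c10 k20 power2_eq_square algebra_simps)
    then show ?thesis using that tdeg_le_linear by blast
  qed
qed

text \<open>Induction on the degree, each factor keeping those points of \<open>Y\<close> at which
  it is itself singular. Let f = u v and let w be a nonzero test curve for u. Then w v is a test
  curve for f and misses some point of \<open>Y\<close>; there v is nonzero, so the point is
  singular on u, and w is nonzero. The guard \<open>2 \<le> tdeg f\<close> protects truncated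
  subtraction: without it a linear factor would have to possess a singular point.\<close>

lemma splits_into_lines:
  fixes f :: "'k::alg_closed_field poly poly"
  assumes "f \<noteq> 0" "finite Y" "\<And>y. y \<in> Y \<Longrightarrow> sing_at f y"
    and "\<And>g. 2 \<le> tdeg f \<Longrightarrow> g \<noteq> 0 \<Longrightarrow> tdeg_le (tdeg f - 2) g \<Longrightarrow> \<exists>y\<in>Y. ev2 g y \<noteq> 0"
  shows "\<exists>ls c. f = [:[:c:]:] * prod_list ls \<and> length ls = tdeg f \<and> (\<forall>l\<in>set ls. tdeg_le 1 l)"
  using assms
proof (induction "tdeg f" arbitrary: f Y rule: less_induct)
  case less
  note f0 = less.prems(1) and fin = less.prems(2) and sing = less.prems(3) and no = less.prems(4)
  consider "tdeg f = 0" | "tdeg f = 1" | "tdeg f = 2" | "tdeg f \<ge> 3" by linarith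
  then show ?case
  proof cases
    case 1
    then obtain c where "f = [:[:c:]:]" using tdeg_0_iff by blast
    then have "f = [:[:c:]:] * prod_list []" by simp
    then show ?thesis using 1 by (intro exI[of _ "[]"] exI[of _ c]) simp
  next
    case 2
    then have "tdeg_le 1 f" using tdeg_le_tdeg[of f] by simp
    then show ?thesis using 2 by (intro exI[of _ "[f]"] exI[of _ 1]) simp
  next
    case 3
    \<comment> \<open>In degree two the test curves are the constants, so the hypothesis says that
      \<open>Y\<close> is nonempty.\<close>
    have "\<exists>y\<in>Y. ev2 1 y \<noteq> 0" using no[of 1] 3 by simp
    then obtain y where "y \<in> Y" by blast
    then have "sing_at f y" "tdeg_le 2 f" using sing 3 tdeg_le_tdeg[of f] by auto
    then obtain l1 l2 where l: "f = l1 * l2" "tdeg_le 1 l1" "tdeg_le 1 l2" using singular_conic_splits by blast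
    then show ?thesis using 3 by (intro exI[of _ "[l1, l2]"] exI[of _ 1]) simp
  next
    case 4
    have no': "\<exists>y\<in>Y. ev2 g y \<noteq> 0" if "g \<noteq> 0" "tdeg_le (tdeg f - 2) g" for g
      using no[OF _ that] 4 by simp
    obtain g h where gh: "f = g * h" "tdeg g > 0" "tdeg h > 0"
      by (rule reducible_of_singular[OF 4 fin sing no'])
    have nz: "g \<noteq> 0" "h \<noteq> 0" using gh f0 by auto
    have deg: "tdeg f = tdeg g + tdeg h" using tdeg_mult[OF nz] gh(1) by simp
    have factor: "\<exists>ls c. u = [:[:c:]:] * prod_list ls \<and> length ls = tdeg u \<and> (\<forall>l\<in>set ls. tdeg_le 1 l)"
      if u: "f = u * v" "u \<noteq> 0" "v \<noteq> 0" "tdeg u < tdeg f" "tdeg f = tdeg u + tdeg v" for u v :: "'k poly poly"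
    proof (rule less.hyps[OF u(4,2), of "{y \<in> Y. sing_at u y}"])
      show "finite {y \<in> Y. sing_at u y}" using fin by simp
      fix w :: "'k poly poly" assume w: "2 \<le> tdeg u" "w \<noteq> 0" "tdeg_le (tdeg u - 2) w"
      have "tdeg_le (tdeg u - 2 + tdeg v) (w * v)" using tdeg_le_mult[OF w(3) tdeg_le_tdeg] .
      then have "tdeg_le (tdeg f - 2) (w * v)" using w(1) u(5) by simp
      moreover have "w * v \<noteq> 0" using w(2) u(3) by simp
      ultimately obtain y where y: "y \<in> Y" "ev2 (w * v) y \<noteq> 0" using no[of "w * v"] 4 by auto
      then have "ev2 v y \<noteq> 0" "ev2 w y \<noteq> 0" by auto
      moreover have "sing_at u y" using sing_at_factor[of u v y] sing[OF y(1)] u(1) \<open>ev2 v y \<noteq> 0\<close> by simp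
      ultimately show "\<exists>y\<in>{y \<in> Y. sing_at u y}. ev2 w y \<noteq> 0" using y(1) by blast
    qed auto
    have "tdeg g < tdeg f" "tdeg h < tdeg f" using deg gh by auto
    then obtain ls1 c1 ls2 c2 where
      1: "g = [:[:c1:]:] * prod_list ls1" "length ls1 = tdeg g" "\<forall>l\<in>set ls1. tdeg_le 1 l" and
      2: "h = [:[:c2:]:] * prod_list ls2" "length ls2 = tdeg h" "\<forall>l\<in>set ls2. tdeg_le 1 l"
      using factor[of g h] factor[of h g] gh(1) nz deg by (auto simp: mult.commute add.commute)
    have "f = [:[:c1 * c2:]:] * prod_list (ls1 @ ls2)"
      unfolding gh(1) 1(1) 2(1) by (simp add: algebra_simps)
    then show ?thesis using 1 2 deg by (intro exI[of _ "ls1 @ ls2"] exI[of _ "c1 * c2"]) auto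
  qed
qed

lemma tdeg_le_prod:
  "finite U \<Longrightarrow> (\<And>x. x \<in> U \<Longrightarrow> tdeg_le 1 (f x)) \<Longrightarrow> tdeg_le (card U) (\<Prod>x\<in>U. f x)"
proof (induction U rule: finite_induct)
  case (insert x U)
  have "tdeg_le (1 + card U) (f x * (\<Prod>x\<in>U. f x))" by (intro tdeg_le_mult insert) (use insert in auto)
  then show ?case using insert by simp
qed simp

text \<open>The zero set of \<open>l\<close> is the line through \<open>p\<close> and
  \<open>q\<close>, and a linear polynomial vanishing at two points of a line vanishes on
  it.\<close>

lemma common_line_zeros:
  fixes l l' :: "'k::field poly poly"
  assumes l: "tdeg_le 1 l" "l \<noteq> 0" and l': "tdeg_le 1 l'" and "p \<noteq> q"
    and van: "ev2 l p = 0" "ev2 l q = 0" "ev2 l' p = 0" "ev2 l' q = 0" "ev2 l z = 0"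
  shows "ev2 l' z = 0"
proof -
  obtain \<alpha> \<beta> \<gamma> where l_eq: "l = lin \<alpha> \<beta> \<gamma>" using linear_form[OF l(1)] .
  obtain \<alpha>' \<beta>' \<gamma>' where l'_eq: "l' = lin \<alpha>' \<beta>' \<gamma>'" using linear_form[OF l'] .
  obtain p1 p2 where p: "p = (p1, p2)" by (cases p)
  obtain q1 q2 where q: "q = (q1, q2)" by (cases q)
  obtain z1 z2 where z: "z = (z1, z2)" by (cases z)
  note pqz = p q z
  define d1 d2 w1 w2 where "d1 = q1 - p1" and "d2 = q2 - p2" and "w1 = z1 - p1" and "w2 = z2 - p2"
  have e: "\<alpha> + \<beta> * p1 + \<gamma> * p2 = 0" "\<alpha> + \<beta> * q1 + \<gamma> * q2 = 0" "\<alpha> + \<beta> * z1 + \<gamma> * z2 = 0"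
    "\<alpha>' + \<beta>' * p1 + \<gamma>' * p2 = 0" "\<alpha>' + \<beta>' * q1 + \<gamma>' * q2 = 0"
    using van by (simp_all add: l_eq l'_eq pqz)
  have "\<beta> * d1 + \<gamma> * d2 = (\<alpha> + \<beta> * q1 + \<gamma> * q2) - (\<alpha> + \<beta> * p1 + \<gamma> * p2)"
    by (simp add: d1_def d2_def algebra_simps)
  then have e1: "\<beta> * d1 + \<gamma> * d2 = 0" using e by simp
  have "\<beta> * w1 + \<gamma> * w2 = (\<alpha> + \<beta> * z1 + \<gamma> * z2) - (\<alpha> + \<beta> * p1 + \<gamma> * p2)"
    by (simp add: w1_def w2_def algebra_simps)
  then have e2: "\<beta> * w1 + \<gamma> * w2 = 0" using e by simp
  have "\<beta>' * d1 + \<gamma>' * d2 = (\<alpha>' + \<beta>' * q1 + \<gamma>' * q2) - (\<alpha>' + \<beta>' * p1 + \<gamma>' * p2)"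
    by (simp add: d1_def d2_def algebra_simps)
  then have e3: "\<beta>' * d1 + \<gamma>' * d2 = 0" using e by simp
  have nz: "\<beta> \<noteq> 0 \<or> \<gamma> \<noteq> 0"
  proof (rule ccontr)
    assume "\<not> ?thesis"
    then have "l = 0" using e(1) l_eq by (simp add: lin_def)
    with l(2) show False by simp
  qed
  \<comment> \<open>The nonzero covector (\<beta>, \<gamma>) kills both q - p and z - p, so these
    two are parallel.\<close>
  have "\<beta> * (d1 * w2 - d2 * w1) = (\<beta> * d1 + \<gamma> * d2) * w2 - (\<beta> * w1 + \<gamma> * w2) * d2"
    "\<gamma> * (d1 * w2 - d2 * w1) = (\<beta> * w1 + \<gamma> * w2) * d1 - (\<beta> * d1 + \<gamma> * d2) * w1"
    by (simp_all add: algebra_simps)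
  then have det: "d1 * w2 = d2 * w1" using nz e1 e2 by auto
  have "d1 * (\<beta>' * w1 + \<gamma>' * w2) = (\<beta>' * d1 + \<gamma>' * d2) * w1 + \<gamma>' * (d1 * w2 - d2 * w1)"
    "d2 * (\<beta>' * w1 + \<gamma>' * w2) = (\<beta>' * d1 + \<gamma>' * d2) * w2 - \<beta>' * (d1 * w2 - d2 * w1)"
    by (simp_all add: algebra_simps)
  moreover have "d1 \<noteq> 0 \<or> d2 \<noteq> 0" using \<open>p \<noteq> q\<close> by (auto simp: pqz d1_def d2_def)
  ultimately have "\<beta>' * w1 + \<gamma>' * w2 = 0" using e3 det by auto
  moreover have "\<alpha>' + \<beta>' * z1 + \<gamma>' * z2 = (\<alpha>' + \<beta>' * p1 + \<gamma>' * p2) + (\<beta>' * w1 + \<gamma>' * w2)"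
    by (simp add: w1_def w2_def algebra_simps)
  ultimately show ?thesis using e(4) by (simp add: l'_eq pqz)
qed

text \<open>The product of all lines except \<open>L i\<close> and \<open>L j\<close> has degree
  \<open>d - 2\<close>, hence is nonzero at some \<open>y\<close> in \<open>Y\<close>. A singular
  point of the product lies on at least two of the lines, so \<open>y\<close> lies on
  \<open>L i\<close> and \<open>L j\<close> and on no other. Triple points are then excluded because
  two of the three lines would coincide.\<close>

theorem star_arrangement:
  fixes f :: "'k::alg_closed_field poly poly"
  assumes d: "d \<ge> 3" and f0: "f \<noteq> 0" and f: "tdeg_le d f" and fin: "finite Y"
    and sing: "\<And>y. y \<in> Y \<Longrightarrow> sing_at f y"
    and no: "\<And>g. g \<noteq> 0 \<Longrightarrow> tdeg_le (d - 2) g \<Longrightarrow> \<exists>y\<in>Y. ev2 g y \<noteq> 0"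
  obtains L c where "\<forall>i<d. tdeg_le 1 (L i)" "f = [:[:c:]:] * (\<Prod>i<d. L i)"
    "\<forall>i j. i < j \<longrightarrow> j < d \<longrightarrow> (\<exists>y\<in>Y. {k. k < d \<and> ev2 (L k) y = 0} = {i, j})"
    "\<forall>y\<in>Y. \<exists>i j. i < j \<and> j < d \<and> {k. k < d \<and> ev2 (L k) y = 0} = {i, j}"
proof -
  have td: "tdeg f \<le> d" using f tdeg_le_iff by blast
  have no': "\<exists>y\<in>Y. ev2 g y \<noteq> 0" if "g \<noteq> 0" "tdeg_le (tdeg f - 2) g" for g
    by (rule no[OF that(1)]) (use that(2) td in \<open>auto intro: tdeg_le_mono\<close>)
  have "\<exists>ls c. f = [:[:c:]:] * prod_list ls \<and> length ls = tdeg f \<and> (\<forall>l\<in>set ls. tdeg_le 1 l)"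
    by (rule splits_into_lines[OF f0 fin]) (rule sing, assumption, rule no', assumption+)
  then obtain ls c where ls: "f = [:[:c:]:] * prod_list ls" "length ls = tdeg f" "\<forall>l\<in>set ls. tdeg_le 1 l"
    by - (elim exE conjE, rule that, assumption+)
  \<comment> \<open>In the affine chart \<open>f\<close> may have degree below \<open>d\<close>, so
    the factors are padded with the constant 1. By \<open>pair\<close> every factor has a zero,
    hence no padding actually occurs.\<close>
  define L where "L i = (if i < length ls then ls ! i else 1)" for i
  have L1: "tdeg_le 1 (L i)" for i using ls(3) by (auto simp: L_def)
  have "(\<Prod>i<d. L i) = (\<Prod>i<length ls. L i)"
    by (rule prod.mono_neutral_right) (use ls(2) td in \<open>auto simp: L_def\<close>)
  also have "\<dots> = (\<Prod>i<length ls. ls ! i)" by (rule prod.cong) (auto simp: L_def)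
  also have "\<dots> = prod_list ls" by (simp add: prod.list_conv_set_nth atLeast0LessThan)
  finally have f_eq: "f = [:[:c:]:] * (\<Prod>i<d. L i)" using ls(1) by simp
  have L0: "L i \<noteq> 0" if "i < d" for i
  proof
    assume "L i = 0"
    then have "(\<Prod>i<d. L i) = 0" using that by (intro prod_zero) auto
    with f_eq f0 show False by simp
  qed
  have c0: "c \<noteq> 0" using f_eq f0 by auto
  define S where "S y = {k. k < d \<and> ev2 (L k) y = 0}" for y
  have S_ne: "S y \<noteq> {}" if "y \<in> Y" for y
  proof -
    have "ev2 f y = 0" using sing[OF that] by (simp add: sing_at_def)
    then have "(\<Prod>i<d. ev2 (L i) y) = 0" unfolding f_eq using c0 by simp
    then show ?thesis by (auto simp: S_def)
  qed
  \<comment> \<open>If only \<open>L i\<close> vanished at \<open>y\<close>, cancelling the other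
    factors would make \<open>L i\<close> singular at \<open>y\<close>, and a singular linear
    polynomial is zero.\<close>
  have S_2: "\<exists>j\<in>S y. j \<noteq> i" if y: "y \<in> Y" and i: "i \<in> S y" for y i
  proof (rule ccontr)
    assume n: "\<not> ?thesis"
    define h where "h = [:[:c:]:] * (\<Prod>k\<in>{..<d} - {i}. L k)"
    have i': "i < d" "ev2 (L i) y = 0" using i by (auto simp: S_def)
    have "f = L i * h" unfolding f_eq h_def using i' by (subst prod.remove[of _ i]) auto
    moreover have "ev2 h y \<noteq> 0" using n c0 by (auto simp: h_def S_def)
    ultimately have s: "sing_at (L i) y" using sing_at_factor[of "L i" h y] sing[OF y] by simp
    obtain \<alpha> \<beta> \<gamma> where "L i = lin \<alpha> \<beta> \<gamma>" using linear_form[OF L1] .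
    moreover from this s have "\<beta> = 0" "\<gamma> = 0" "\<alpha> = 0" by (auto simp: sing_at_def)
    ultimately have "L i = 0" by (simp add: lin_def)
    with L0 i' show False by blast
  qed
  have pair: "\<exists>y\<in>Y. S y = {i, j}" if ij: "i < d" "j < d" "i \<noteq> j" for i j
  proof -
    define g where "g = (\<Prod>k\<in>{..<d} - {i, j}. L k)"
    have "card ({..<d} - {i, j}) = d - 2" using ij by (subst card_Diff_subset) auto
    then have "tdeg_le (d - 2) g" using tdeg_le_prod[of "{..<d} - {i, j}" L] L1 by (simp add: g_def)
    moreover have "g \<noteq> 0" using L0 by (auto simp: g_def)
    ultimately have "\<exists>y\<in>Y. ev2 g y \<noteq> 0" using no[of g] by simp
    then obtain y where y: "y \<in> Y" "ev2 g y \<noteq> 0" by (rule bexE)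
    have sub: "k \<in> {i, j}" if k: "k \<in> S y" for k
    proof (rule ccontr)
      assume "k \<notin> {i, j}"
      then have "ev2 g y = 0" unfolding g_def ev2_simps using k
        by (intro prod_zero) (auto simp: S_def)
      with y(2) show False ..
    qed
    have "S y = {i, j}"
    proof
      show "S y \<subseteq> {i, j}" using sub by blast
      obtain k where k: "k \<in> S y" using S_ne[OF y(1)] by blast
      obtain m where m: "m \<in> S y" "m \<noteq> k" using S_2[OF y(1) k] by blast
      show "{i, j} \<subseteq> S y" using sub[OF k] sub[OF m(1)] k m by auto
    qed
    with y(1) show ?thesis by (rule bexI[rotated])
  qed
  have only: "\<exists>i j. i < j \<and> j < d \<and> S y = {i, j}" if y: "y \<in> Y" for y
  proof -
    obtain i where i: "i \<in> S y" using S_ne[OF y] by blast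
    obtain j where j: "j \<in> S y" "j \<noteq> i" using S_2[OF y i] by blast
    have lt: "i < d" "j < d" using i j by (auto simp: S_def)
    \<comment> \<open>With a third line \<open>L k\<close> through \<open>y\<close>, the points
      \<open>y\<close> and \<open>y1\<close> both lie on \<open>L i\<close> and \<open>L j\<close>.
      So \<open>L j\<close> vanishes on all of \<open>L i\<close>, in particular at the point
      \<open>y2\<close> that lies on \<open>L i\<close> and \<open>L k\<close> alone.\<close>
    have "k \<in> {i, j}" if k: "k \<in> S y" for k
    proof (rule ccontr)
      assume kij: "k \<notin> {i, j}"
      have "k < d" using k by (simp add: S_def)
      obtain y1 where y1: "S y1 = {i, j}" using pair[OF lt] j by blast
      obtain y2 where y2: "S y2 = {i, k}" using pair[of i k] lt \<open>k < d\<close> kij by blast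
      have "y \<noteq> y1" using y1 k kij by blast
      have mem: "ev2 (L m) u = 0" if "m \<in> S u" for m u using that by (simp add: S_def)
      have "ev2 (L j) y2 = 0"
      proof (rule common_line_zeros[OF L1 L0[OF lt(1)] L1 \<open>y \<noteq> y1\<close>])
        show "ev2 (L i) y = 0" "ev2 (L j) y = 0" using i j mem by auto
        show "ev2 (L i) y1 = 0" "ev2 (L j) y1 = 0" "ev2 (L i) y2 = 0" using y1 y2 mem by auto
      qed
      then have "j \<in> S y2" using lt by (simp add: S_def)
      with y2 j kij show False by auto
    qed
    then have "S y = {i, j}" using i j by blast
    moreover have "S y = {j, i}" using calculation by blast
    ultimately show ?thesis using j(2) lt by (metis linorder_neq_iff)
  qed
  show ?thesis
  proof (rule that[of L c])
    show "\<forall>i<d. tdeg_le 1 (L i)" using L1 by simp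
    show "f = [:[:c:]:] * (\<Prod>i<d. L i)" by (fact f_eq)
    show "\<forall>i j. i < j \<longrightarrow> j < d \<longrightarrow> (\<exists>y\<in>Y. {k. k < d \<and> ev2 (L k) y = 0} = {i, j})"
      using pair by (simp add: S_def)
    show "\<forall>y\<in>Y. \<exists>i j. i < j \<and> j < d \<and> {k. k < d \<and> ev2 (L k) y = 0} = {i, j}"
      using only by (simp add: S_def)
  qed
qed

section \<open>Forms in four variables and their restrictions\<close>

text \<open>Over a finite field, one plus the product of all x - a has no root.\<close>

lemma infinite_alg_closed: "infinite (UNIV :: 'k::alg_closed_field set)"
proof
  assume fin: "finite (UNIV :: 'k set)"
  define p where "p = (\<Prod>a\<in>(UNIV :: 'k set). [:- a, 1:]) + 1"
  have val: "poly p x = 1" for x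
    using fin by (auto simp: p_def poly_prod intro!: prod_zero bexI[of _ x])
  have "degree (\<Prod>a\<in>(UNIV :: 'k set). [:- a, 1:]) = card (UNIV :: 'k set)"
    by (subst degree_prod_eq_sum_degree) auto
  moreover have "card (UNIV :: 'k set) > 0" using fin by (simp add: finite_UNIV_card_ge_0)
  ultimately have "degree p > 0" unfolding p_def by (subst degree_add_eq_left) auto
  then obtain x where "poly p x = 0" using alg_closed_imp_poly_has_root by blast
  with val show False by simp
qed

lemma poly_0_if_vanishing:
  fixes p :: "'k::alg_closed_field poly"
  assumes "\<And>x. poly p x = 0"
  shows "p = 0"
proof (rule ccontr)
  assume "p \<noteq> 0"
  then have "finite {x. poly p x = 0}" by (rule poly_roots_finite)
  with assms infinite_alg_closed[where 'k='k] show False by simp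
qed

lemma sum_single_lookup: "(\<Sum>m\<in>Poly_Mapping.keys f. Poly_Mapping.single m (Poly_Mapping.lookup f m)) = f"
proof (rule poly_mapping_eqI)
  fix k
  have "(\<Sum>m\<in>Poly_Mapping.keys f. Poly_Mapping.lookup (Poly_Mapping.single m (Poly_Mapping.lookup f m)) k)
      = (\<Sum>m\<in>Poly_Mapping.keys f. if m = k then Poly_Mapping.lookup f k else 0)"
    by (intro sum.cong) (auto simp: lookup_single when_def)
  also have "\<dots> = Poly_Mapping.lookup f k" by (simp add: in_keys_iff)
  finally show "Poly_Mapping.lookup (\<Sum>m\<in>Poly_Mapping.keys f. Poly_Mapping.single m (Poly_Mapping.lookup f m)) k
     = Poly_Mapping.lookup f k" by (simp add: lookup_sum)
qed

section \<open>Substitution homomorphisms and restriction to lines and planes\<close>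

definition mon :: "(4 \<Rightarrow> 'r::comm_ring_1) \<Rightarrow> (4 \<Rightarrow>\<^sub>0 nat) \<Rightarrow> 'r" where
  "mon c m = (\<Prod>i\<in>UNIV. c i ^ Poly_Mapping.lookup m i)"

text \<open>The general substitution homomorphism: \<phi> acts on the coefficients and
  \<open>c\<close> gives the images of the variables. Evaluation, restriction to a line or a plane,
  composition with a projection and the Kronecker substitution are all instances, and
  \<open>psub_hom\<close> relates them to each other.\<close>

definition psub :: "('k::field \<Rightarrow> 'r::comm_ring_1) \<Rightarrow> (4 \<Rightarrow> 'r) \<Rightarrow> 'k poly4 \<Rightarrow> 'r" where
  "psub \<phi> c f = (\<Sum>m\<in>Poly_Mapping.keys f. \<phi> (Poly_Mapping.lookup f m) * mon c m)"

lemma mon_0 [simp]: "mon c 0 = 1"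
  by (simp add: mon_def)

lemma mon_add: "mon c (m + n) = mon c m * mon c n"
  by (simp add: mon_def lookup_add power_add prod.distrib)

context comm_ring_hom
begin

lemma hom_mon: "hom (mon c m) = mon (\<lambda>i. hom (c i)) m"
  by (simp add: mon_def hom_distribs)

end

context
  fixes \<phi> :: "'k::field \<Rightarrow> 'r::comm_ring_1"
  assumes hom: "comm_ring_hom \<phi>"
begin

interpretation comm_ring_hom \<phi> by (fact hom)

lemma psub_superset:
  assumes "finite A" "Poly_Mapping.keys f \<subseteq> A"
  shows "psub \<phi> c f = (\<Sum>m\<in>A. \<phi> (Poly_Mapping.lookup f m) * mon c m)"
  unfolding psub_def using assms by (intro sum.mono_neutral_left) (auto simp: in_keys_iff)

lemma psub_add: "psub \<phi> c (f + g) = psub \<phi> c f + psub \<phi> c g"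
proof -
  let ?A = "Poly_Mapping.keys f \<union> Poly_Mapping.keys g"
  have "psub \<phi> c (f + g) = (\<Sum>m\<in>?A. \<phi> (Poly_Mapping.lookup (f + g) m) * mon c m)"
    by (rule psub_superset) (use Poly_Mapping.keys_add[of f g] in auto)
  also have "\<dots> = (\<Sum>m\<in>?A. \<phi> (Poly_Mapping.lookup f m) * mon c m) + (\<Sum>m\<in>?A. \<phi> (Poly_Mapping.lookup g m) * mon c m)"
    by (simp add: lookup_add hom_distribs distrib_right sum.distrib)
  also have "\<dots> = psub \<phi> c f + psub \<phi> c g"
    using psub_superset[of ?A f] psub_superset[of ?A g] by simp
  finally show ?thesis .
qed

lemma psub_0: "psub \<phi> c 0 = 0"
  by (simp add: psub_def)

lemma psub_single: "psub \<phi> c (Poly_Mapping.single m a) = \<phi> a * mon c m"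
  by (cases "a = 0") (auto simp: psub_def)

lemma psub_sum: "psub \<phi> c (\<Sum>x\<in>A. h x) = (\<Sum>x\<in>A. psub \<phi> c (h x))"
  by (induction A rule: infinite_finite_induct) (auto simp: psub_0 psub_add)

lemma psub_mult: "psub \<phi> c (f * g) = psub \<phi> c f * psub \<phi> c g"
proof -
  let ?s = "\<lambda>f m. Poly_Mapping.single m (Poly_Mapping.lookup f m) :: 'k poly4"
  have "f * g = (\<Sum>m\<in>Poly_Mapping.keys f. ?s f m) * (\<Sum>m\<in>Poly_Mapping.keys g. ?s g m)"
    by (simp add: sum_single_lookup)
  also have "\<dots> = (\<Sum>m\<in>Poly_Mapping.keys f. \<Sum>n\<in>Poly_Mapping.keys g. ?s f m * ?s g n)"
    by (simp add: sum_product)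
  finally have "psub \<phi> c (f * g) = (\<Sum>m\<in>Poly_Mapping.keys f. \<Sum>n\<in>Poly_Mapping.keys g.
      (\<phi> (Poly_Mapping.lookup f m) * mon c m) * (\<phi> (Poly_Mapping.lookup g n) * mon c n))"
    by (simp add: psub_sum mult_single psub_single mon_add hom_distribs mult_ac)
  then show ?thesis by (simp add: psub_def sum_product)
qed

lemma comm_ring_hom_psub: "comm_ring_hom (psub \<phi> c)"
proof
  show "psub \<phi> c 1 = 1" using psub_single[of c 0 1] by simp
qed (auto simp: psub_0 psub_add psub_mult)

end

lemma psub_hom:
  assumes "comm_ring_hom \<psi>"
  shows "\<psi> (psub \<phi> c f) = psub (\<lambda>x. \<psi> (\<phi> x)) (\<lambda>i. \<psi> (c i)) f"
proof -
  interpret comm_ring_hom \<psi> by fact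
  show ?thesis by (simp add: psub_def hom_distribs hom_mon)
qed

lemma comm_ring_hom_id: "comm_ring_hom (\<lambda>x :: 'a::comm_ring_1. x)"
  by standard auto

lemma comm_ring_hom_const: "comm_ring_hom (\<lambda>a :: 'a::comm_ring_1. [:a:])"
  by standard (auto simp: one_pCons[symmetric] mult_ac)

lemma comm_ring_hom_const2: "comm_ring_hom (\<lambda>a :: 'a::comm_ring_1. [:[:a:]:])"
  by standard auto

lemma comm_ring_hom_poly: "comm_ring_hom (\<lambda>p. poly p (a :: 'a::comm_ring_1))"
  by standard auto

lemma comm_ring_hom_pcompose: "comm_ring_hom (\<lambda>p. pcompose p (q :: 'a::comm_ring_1 poly))"
  by standard (auto simp: pcompose_add pcompose_mult)

lemma comm_ring_hom_ev2: "comm_ring_hom (\<lambda>f. ev2 f p)"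
  by standard auto

lemma eval4_psub: "eval4 f v = psub (\<lambda>x. x) (\<lambda>i. v $ i) f"
  by (simp add: eval4_def psub_def mon_def)

interpretation eval4: comm_ring_hom "\<lambda>f. eval4 f v" for v :: "'k::field ^ 4"
  unfolding eval4_psub by (rule comm_ring_hom_psub[OF comm_ring_hom_id])

definition lineres :: "('k::field ^ 4) \<Rightarrow> 'k ^ 4 \<Rightarrow> 'k poly4 \<Rightarrow> 'k poly" where
  "lineres p v = psub (\<lambda>a. [:a:]) (\<lambda>i. [:p $ i, v $ i:])"

interpretation lineres: comm_ring_hom "lineres p v" for p v :: "'k::field ^ 4"
  unfolding lineres_def by (rule comm_ring_hom_psub[OF comm_ring_hom_const])

definition planeres :: "('k::field ^ 4) \<Rightarrow> 'k ^ 4 \<Rightarrow> 'k ^ 4 \<Rightarrow> 'k poly4 \<Rightarrow> 'k poly poly" where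
  "planeres u v w = psub (\<lambda>a. [:[:a:]:]) (\<lambda>i. lin (u $ i) (v $ i) (w $ i))"

interpretation planeres: comm_ring_hom "planeres u v w" for u v w :: "'k::field ^ 4"
  unfolding planeres_def by (rule comm_ring_hom_psub[OF comm_ring_hom_const2])

lemma poly_lineres: "poly (lineres p v f) t = eval4 f (p + t *s v)"
  unfolding lineres_def eval4_psub by (subst psub_hom[OF comm_ring_hom_poly])
    (auto intro!: arg_cong[where f = "\<lambda>c. psub (\<lambda>x. x) c f"])

lemma ev2_planeres: "ev2 (planeres u v w f) ab = eval4 f (u + fst ab *s v + snd ab *s w)"
  unfolding planeres_def eval4_psub by (subst psub_hom[OF comm_ring_hom_ev2])
    (auto simp: mult.commute intro!: arg_cong[where f = "\<lambda>c. psub (\<lambda>x. x) c f"])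

lemma poly_planeres: "poly (planeres u v w f) [:b:] = lineres (u + b *s w) v f"
  unfolding planeres_def lineres_def
  by (subst psub_hom[OF comm_ring_hom_poly]) (simp add: lin_def mult.commute)

lemma map_poly_poly_pCons:
  "map_poly (\<lambda>c. poly c a) (pCons c p) = pCons (poly c a) (map_poly (\<lambda>c. poly c a) p)"
  by (rule poly_eqI) (simp add: coeff_map_poly coeff_pCons split: nat.split)

text \<open>Counterpart of \<open>poly_planeres\<close> with the first coordinate fixed instead of
  the second. Together they identify both partial derivatives of a plane section with derivatives
  along lines.\<close>

lemma map_poly_planeres: "map_poly (\<lambda>c. poly c a) (planeres u v w f) = lineres (u + a *s v) w f"
proof -
  interpret comm_ring_hom "\<lambda>c. poly c a" by (rule comm_ring_hom_poly)
  interpret m: map_poly_comm_ring_hom "\<lambda>c. poly c a" ..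
  have hm: "comm_ring_hom (map_poly (\<lambda>c. poly c a))" ..
  show ?thesis
    unfolding planeres_def lineres_def by (subst psub_hom[OF hm]) (simp add: lin_def map_poly_poly_pCons mult.commute)
qed

lemma lineres_shift: "lineres (p + a *s v) v f = pcompose (lineres p v f) [:a, 1:]"
  unfolding lineres_def
  by (subst psub_hom[OF comm_ring_hom_pcompose]) (simp add: pcompose_pCons mult.commute)

text \<open>Vanishing to order at least two at \<open>p\<close>: the value and all directional
  derivatives are zero. Phrased on restrictions to lines, it passes directly to plane sections and
  to the counting of double roots.\<close>

definition dbl :: "'k::field poly4 \<Rightarrow> 'k ^ 4 \<Rightarrow> bool" where
  "dbl f p \<longleftrightarrow> (\<forall>v. poly (lineres p v f) 0 = 0 \<and> poly (pderiv (lineres p v f)) 0 = 0)"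

lemma dbl_lineres:
  assumes "dbl f (p + a *s v)"
  shows "poly (lineres p v f) a = 0" "poly (pderiv (lineres p v f)) a = 0"
proof -
  have "poly (pcompose (lineres p v f) [:a, 1:]) 0 = 0" "poly (pderiv (pcompose (lineres p v f) [:a, 1:])) 0 = 0"
    using assms unfolding dbl_def lineres_shift[symmetric] by blast+
  then show "poly (lineres p v f) a = 0" "poly (pderiv (lineres p v f)) a = 0"
    by (simp_all add: poly_pcompose pderiv_pcompose pderiv_pCons)
qed

lemma poly_poly_const: "poly (poly P [:b:]) a = poly (map_poly (\<lambda>c. poly c a) P) b"
  by (induction P) (auto simp: map_poly_pCons)

lemma map_poly_pderiv_hom:
  assumes "comm_ring_hom (\<psi> :: 'a::idom \<Rightarrow> 'b::idom)"
  shows "map_poly \<psi> (pderiv P) = pderiv (map_poly \<psi> P)"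
proof -
  interpret comm_ring_hom \<psi> by fact
  show ?thesis by (rule poly_eqI) (simp add: coeff_map_poly coeff_pderiv hom_distribs)
qed

lemma sing_at_planeres:
  assumes "dbl f (u + fst ab *s v + snd ab *s w)"
  shows "sing_at (planeres u v w f) ab"
proof -
  obtain a b where ab: "ab = (a, b)" by (cases ab)
  have d1: "dbl f ((u + b *s w) + a *s v)" and d2: "dbl f ((u + a *s v) + b *s w)"
    using assms by (simp_all add: ab add_ac)
  have "ev2 (planeres u v w f) ab = 0"
    using dbl_lineres(1)[OF d1] by (simp add: ab ev2_def poly_planeres)
  moreover have "dx (planeres u v w f) ab = 0"
    using dbl_lineres(2)[OF d1] by (simp add: ab dx_def poly_planeres)
  moreover have "dy (planeres u v w f) ab = 0"
    using dbl_lineres(2)[OF d2]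
    by (simp add: ab dy_def ev2_def poly_poly_const map_poly_pderiv_hom[OF comm_ring_hom_poly] map_poly_planeres)
  ultimately show ?thesis by (simp add: sing_at_def)
qed

abbreviation mdeg :: "(4 \<Rightarrow>\<^sub>0 nat) \<Rightarrow> nat" where
  "mdeg m \<equiv> (\<Sum>i\<in>UNIV. Poly_Mapping.lookup m i)"

section \<open>Forms and homogeneous components\<close>

lemma form_0 [simp]: "form_of_degree t 0"
  by (simp add: form_of_degree_def)

lemma form_1 [simp]: "form_of_degree 0 1"
  by (simp add: form_of_degree_def)

lemma form_const: "form_of_degree 0 (Poly_Mapping.single 0 a)"
  by (cases "a = 0") (auto simp: form_of_degree_def)

lemma form_add: "form_of_degree t f \<Longrightarrow> form_of_degree t g \<Longrightarrow> form_of_degree t (f + g)"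
  unfolding form_of_degree_def using Poly_Mapping.keys_add[of f g] by blast

lemma form_sum: "(\<And>x. x \<in> A \<Longrightarrow> form_of_degree t (h x)) \<Longrightarrow> form_of_degree t (\<Sum>x\<in>A. h x)"
  by (induction A rule: infinite_finite_induct) (auto intro: form_add)

lemma form_mult:
  assumes "form_of_degree s f" "form_of_degree t g"
  shows "form_of_degree (s + t) (f * g)"
  unfolding form_of_degree_def
proof
  fix m assume "m \<in> Poly_Mapping.keys (f * g)"
  then obtain a b where "a \<in> Poly_Mapping.keys f" "b \<in> Poly_Mapping.keys g" "m = a + b"
    using Poly_Mapping.keys_mult[of f g] by blast
  with assms show "mdeg m = s + t"
    by (simp add: form_of_degree_def lookup_add sum.distrib)
qed

lemma form_prod:
  "finite A \<Longrightarrow> (\<And>x. x \<in> A \<Longrightarrow> form_of_degree 1 (h x)) \<Longrightarrow> form_of_degree (card A) (\<Prod>x\<in>A. h x)"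
proof (induction A rule: finite_induct)
  case (insert x A)
  then have "form_of_degree (1 + card A) (h x * (\<Prod>x\<in>A. h x))" by (intro form_mult) auto
  then show ?case using insert by simp
qed simp

lemma form_power: "form_of_degree 1 f \<Longrightarrow> form_of_degree n (f ^ n)"
proof (induction n)
  case (Suc n)
  from form_mult[OF Suc.prems Suc.IH[OF Suc.prems]] show ?case by simp
qed simp

lemma mon_scale: "mon (($) (c *s v)) m = c ^ mdeg m * mon (($) v) m"
  by (simp add: mon_def power_mult_distrib prod.distrib power_sum)

lemma eval4_scale:
  assumes "form_of_degree t f"
  shows "eval4 f (c *s v) = c ^ t * eval4 f v"
  unfolding eval4_psub psub_def sum_distrib_left using assms
  by (intro sum.cong) (auto simp: mon_scale form_of_degree_def)

definition hcomp :: "nat \<Rightarrow> 'k::field poly4 \<Rightarrow> 'k poly4" where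
  "hcomp t f = (\<Sum>m\<in>{m \<in> Poly_Mapping.keys f. mdeg m = t}. Poly_Mapping.single m (Poly_Mapping.lookup f m))"

lemma form_hcomp: "form_of_degree t (hcomp t f)"
  unfolding hcomp_def
  by (rule form_sum) (auto simp: form_of_degree_def split: if_splits)

lemma sum_hcomp: "\<exists>N. f = (\<Sum>t\<le>N. hcomp t f)"
proof -
  define N where "N = (\<Sum>m\<in>Poly_Mapping.keys f. mdeg m)"
  have N: "mdeg m \<le> N" if "m \<in> Poly_Mapping.keys f" for m
    unfolding N_def by (rule member_le_sum[OF that]) auto
  have "(\<Sum>t\<le>N. hcomp t f) = (\<Sum>m\<in>Poly_Mapping.keys f. Poly_Mapping.single m (Poly_Mapping.lookup f m))"
    unfolding hcomp_def by (rule sum.group) (use N in auto)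
  then show ?thesis by (intro exI[of _ N]) (simp add: sum_single_lookup)
qed

text \<open>Along the multiples of \<open>v\<close> both sides are polynomials in the scalar, and
  over an infinite field their coefficients agree. With \<open>g = 0\<close> this shows that the
  components of a polynomial vanishing on a cone vanish there too.\<close>

lemma eval4_hcomp:
  fixes f :: "'k::alg_closed_field poly4"
  assumes "\<And>c. eval4 f (c *s v) = c ^ t * g"
  shows "eval4 (hcomp s f) v = (if s = t then g else 0)"
proof -
  obtain N where N: "f = (\<Sum>t\<le>N. hcomp t f)" using sum_hcomp by blast
  \<comment> \<open>A bound that exceeds \<open>s\<close> and \<open>t\<close> too, so that the
    coefficient at \<open>s\<close> can be read off; the components beyond \<open>N\<close> are
    zero.\<close>
  define M where "M = max N (max s t)"
  have zero: "hcomp i f = 0" if "i > N" for i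
  proof -
    have "{m \<in> Poly_Mapping.keys f. mdeg m = i} = {}"
    proof (rule ccontr)
      assume "\<not> ?thesis"
      then obtain m where m: "m \<in> Poly_Mapping.keys f" "mdeg m = i" by blast
      then have "m \<in> Poly_Mapping.keys (\<Sum>t\<le>N. hcomp t f)" using N by simp
      then have "(\<Sum>t\<le>N. Poly_Mapping.lookup (hcomp t f) m) \<noteq> 0" by (simp add: in_keys_iff lookup_sum)
      then obtain t where "t \<le> N" "Poly_Mapping.lookup (hcomp t f) m \<noteq> 0"
        by (metis (no_types, lifting) atMost_iff sum.neutral)
      with form_hcomp[of t f] m that show False by (auto simp: form_of_degree_def in_keys_iff)
    qed
    then show ?thesis unfolding hcomp_def by (simp only: sum.empty)
  qed
  have fM: "f = (\<Sum>i\<le>M. hcomp i f)"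
    by (subst N, rule sum.mono_neutral_left) (auto simp: M_def zero)
  define p where "p = (\<Sum>i\<le>M. monom (eval4 (hcomp i f) v) i) - monom g t"
  have "p = 0"
  proof (rule poly_0_if_vanishing)
    fix c
    have "eval4 f (c *s v) = (\<Sum>i\<le>M. c ^ i * eval4 (hcomp i f) v)"
      by (subst fM) (simp add: eval4.hom_sum eval4_scale[OF form_hcomp])
    then show "poly p c = 0" using assms[of c] by (simp add: p_def poly_sum poly_monom mult.commute)
  qed
  then have "coeff p s = 0" by simp
  moreover have sM: "s \<le> M" by (simp add: M_def)
  have "coeff p s = eval4 (hcomp s f) v - (if s = t then g else 0)"
    using sM by (auto simp: p_def coeff_sum)
  ultimately show ?thesis by simp
qed

lemma base_repr_inj:
  fixes B :: nat
  assumes "a < B" "a' < B" "a + B * b = a' + B * b'"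
  shows "a = a' \<and> b = b'"
proof -
  have "(a + B * b) mod B = (a' + B * b') mod B" "(a + B * b) div B = (a' + B * b') div B"
    using assms(3) by simp_all
  then show ?thesis using assms(1,2) by simp
qed

text \<open>Kronecker substitution \<open>x\<^sub>i \<mapsto> t\<^bsup>B^i\<^esup>\<close>, with \<open>B\<close> larger than all exponents of \<open>f\<close>.\<close>
lemma zero_if_eval4_zero:
  fixes f :: "'k::alg_closed_field poly4"
  assumes "\<And>v. eval4 f v = 0"
  shows "f = 0"
proof (rule poly_mapping_eqI)
  fix m0
  define B where "B = Suc (\<Sum>m\<in>Poly_Mapping.keys f. mdeg m)"
  have B: "Poly_Mapping.lookup m i < B" if "m \<in> Poly_Mapping.keys f" for m i
  proof -
    have "Poly_Mapping.lookup m i \<le> mdeg m" by (rule member_le_sum) auto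
    also have "\<dots> \<le> (\<Sum>m\<in>Poly_Mapping.keys f. mdeg m)" by (rule member_le_sum[OF that]) auto
    finally show ?thesis by (simp add: B_def)
  qed
  define e :: "4 \<Rightarrow> nat" where "e i = (if i = 1 then 1 else if i = 2 then B else if i = 3 then B * B else B * B * B)" for i
  define wt where "wt m = (\<Sum>i\<in>UNIV. e i * Poly_Mapping.lookup m i)" for m
  have wt: "wt m = Poly_Mapping.lookup m 1 + B * (Poly_Mapping.lookup m 2 + B * (Poly_Mapping.lookup m 3 + B * Poly_Mapping.lookup m 4))" for m
    by (simp add: wt_def sum_4 e_def algebra_simps)
  have inj: "m = m'" if m: "m \<in> Poly_Mapping.keys f" and m': "m' \<in> Poly_Mapping.keys f" and eq: "wt m = wt m'" for m m'
  proof -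
    note 1 = base_repr_inj[OF B[OF m] B[OF m'] eq[unfolded wt]]
    note 2 = base_repr_inj[OF B[OF m] B[OF m'] conjunct2[OF 1]]
    note 3 = base_repr_inj[OF B[OF m] B[OF m'] conjunct2[OF 2]]
    have "\<forall>i::4. Poly_Mapping.lookup m i = Poly_Mapping.lookup m' i"
      unfolding forall_4 using 1 2 3 by blast
    then show ?thesis by (intro poly_mapping_eqI) blast
  qed
  define p where "p = psub (\<lambda>a. [:a:]) (\<lambda>i. monom 1 (e i)) f"
  have "p = 0"
  proof (rule poly_0_if_vanishing)
    fix t
    have "poly p t = eval4 f (\<chi> i. t ^ e i)"
      unfolding p_def eval4_psub by (subst psub_hom[OF comm_ring_hom_poly])
        (auto simp: poly_monom intro!: arg_cong[where f = "\<lambda>c. psub (\<lambda>x. x) c f"])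
    then show "poly p t = 0" using assms by simp
  qed
  have mon: "mon (\<lambda>i. monom 1 (e i)) m = monom (1 :: 'k) (wt m)" for m
  proof -
    have "(\<Prod>i\<in>A. monom (1 :: 'k) (e i) ^ Poly_Mapping.lookup m i) = monom 1 (\<Sum>i\<in>A. e i * Poly_Mapping.lookup m i)" if "finite A" for A
      using that by (induction A rule: finite_induct) (auto simp: monom_power mult_monom)
    then show ?thesis by (simp add: mon_def wt_def)
  qed
  have "coeff p (wt m0) = (\<Sum>m\<in>Poly_Mapping.keys f. if wt m = wt m0 then Poly_Mapping.lookup f m else 0)"
    unfolding p_def psub_def coeff_sum mon by (intro sum.cong) auto
  then have sum0: "(\<Sum>m\<in>Poly_Mapping.keys f. if wt m = wt m0 then Poly_Mapping.lookup f m else 0) = 0"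
    using \<open>p = 0\<close> by simp
  show "Poly_Mapping.lookup f m0 = Poly_Mapping.lookup 0 m0"
  proof (cases "m0 \<in> Poly_Mapping.keys f")
    case True
    have "(\<Sum>m\<in>Poly_Mapping.keys f. if wt m = wt m0 then Poly_Mapping.lookup f m else 0)
      = (\<Sum>m\<in>Poly_Mapping.keys f. if m = m0 then Poly_Mapping.lookup f m else 0)"
      by (intro sum.cong) (auto dest: inj[OF _ True])
    also have "\<dots> = Poly_Mapping.lookup f m0" using True by simp
    finally show ?thesis using sum0 by simp
  qed (simp add: in_keys_iff)
qed

section \<open>Linear forms and degrees of restrictions\<close>

definition dot4 :: "'k::field ^ 4 \<Rightarrow> 'k ^ 4 \<Rightarrow> 'k" where
  "dot4 h v = (\<Sum>i\<in>UNIV. h $ i * v $ i)"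

lemma dot4_simps [simp]:
  "dot4 (h + h') v = dot4 h v + dot4 h' v" "dot4 h (v + v') = dot4 h v + dot4 h v'"
  "dot4 (h - h') v = dot4 h v - dot4 h' v" "dot4 h (v - v') = dot4 h v - dot4 h v'"
  "dot4 (c *s h) v = c * dot4 h v" "dot4 h (c *s v) = c * dot4 h v" "dot4 0 v = 0" "dot4 h 0 = 0"
  by (simp_all add: dot4_def algebra_simps sum.distrib sum_subtractf sum_distrib_left)

definition lform :: "'k::field ^ 4 \<Rightarrow> 'k poly4" where
  "lform h = (\<Sum>i\<in>UNIV. Poly_Mapping.single (Poly_Mapping.single i 1) (h $ i))"

lemma form_lform: "form_of_degree 1 (lform h)"
  unfolding lform_def
proof (rule form_sum)
  fix i :: 4
  show "form_of_degree 1 (Poly_Mapping.single (Poly_Mapping.single i 1) (h $ i))"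
    by (cases "h $ i = 0") (auto simp: form_of_degree_def lookup_single when_def)
qed

lemma mon_single: "mon c (Poly_Mapping.single i 1) = c i"
proof -
  have "mon c (Poly_Mapping.single i 1) = (\<Prod>j\<in>UNIV. if j = i then c i else 1)"
    unfolding mon_def by (intro prod.cong) (auto simp: lookup_single when_def)
  then show ?thesis by simp
qed

lemma psub_lform:
  assumes "comm_ring_hom \<phi>"
  shows "psub \<phi> c (lform h) = (\<Sum>i\<in>UNIV. \<phi> (h $ i) * c i)"
  unfolding lform_def psub_sum[OF assms] psub_single[OF assms] mon_single ..

lemma eval4_lform [simp]: "eval4 (lform h) v = dot4 h v"
  unfolding eval4_psub psub_lform[OF comm_ring_hom_id] dot4_def ..

lemma linear_form_lform:
  assumes "form_of_degree 1 (f :: 'k::alg_closed_field poly4)"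
  obtains h where "f = lform h"
proof
  define h :: "'k ^ 4" where "h = (\<chi> i. eval4 f (axis i 1))"
  have "eval4 f v = dot4 h v" for v
  proof -
    \<comment> \<open>The monomials of degree one are the four variables, so the coefficients are
      the values at the coordinate vectors.\<close>
    have one: "\<exists>i. m = Poly_Mapping.single i 1" if "m \<in> Poly_Mapping.keys f" for m
    proof -
      have s: "mdeg m = 1" using assms that by (auto simp: form_of_degree_def)
      then obtain i where i: "i \<in> UNIV" "Poly_Mapping.lookup m i \<noteq> 0" by (metis sum.neutral zero_neq_one)
      have "mdeg m = Poly_Mapping.lookup m i + (\<Sum>j\<in>UNIV - {i}. Poly_Mapping.lookup m j)"
        by (subst sum.remove[of _ i]) auto
      with s i have "Poly_Mapping.lookup m i = 1" "(\<Sum>j\<in>UNIV - {i}. Poly_Mapping.lookup m j) = 0" by linarith+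
      then have "m = Poly_Mapping.single i 1"
        by (intro poly_mapping_eqI) (auto simp: lookup_single when_def)
      then show ?thesis ..
    qed
    have mon: "mon (\<lambda>i. v $ i) m = (\<Sum>i\<in>UNIV. v $ i * mon (\<lambda>j. (axis i 1 :: 'k ^ 4) $ j) m)" if m: "m \<in> Poly_Mapping.keys f" for m
    proof -
      obtain k where k: "m = Poly_Mapping.single k 1" using one[OF m] ..
      have "(\<Sum>i\<in>UNIV. v $ i * mon (\<lambda>j. (axis i 1 :: 'k ^ 4) $ j) m) = (\<Sum>i\<in>UNIV. if i = k then v $ k else 0)"
        unfolding k mon_single by (intro sum.cong) (auto simp: axis_def)
      then show ?thesis by (simp only: k mon_single) simp
    qed
    have "eval4 f v = (\<Sum>m\<in>Poly_Mapping.keys f. Poly_Mapping.lookup f m * (\<Sum>i\<in>UNIV. v $ i * mon (\<lambda>j. (axis i 1 :: 'k ^ 4) $ j) m))"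
      unfolding eval4_psub psub_def using mon by (intro sum.cong) simp_all
    also have "\<dots> = (\<Sum>m\<in>Poly_Mapping.keys f. (\<Sum>i\<in>UNIV. v $ i * (Poly_Mapping.lookup f m * mon (\<lambda>j. (axis i 1 :: 'k ^ 4) $ j) m)))"
      by (simp add: sum_distrib_left mult_ac)
    also have "\<dots> = (\<Sum>i\<in>UNIV. v $ i * eval4 f (axis i 1))"
      by (subst sum.swap) (simp add: eval4_psub psub_def sum_distrib_left)
    finally show ?thesis by (simp add: dot4_def h_def mult.commute)
  qed
  then have "f - lform h = 0" by (intro zero_if_eval4_zero) (simp add: eval4.hom_minus)
  then show "f = lform h" by simp
qed

lemma degree_lineres:
  assumes "form_of_degree t f"
  shows "degree (lineres p v f) \<le> t"
  unfolding lineres_def psub_def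
proof (rule degree_sum_le)
  fix m assume "m \<in> Poly_Mapping.keys f"
  then have m: "mdeg m = t" using assms by (simp add: form_of_degree_def)
  have "degree (mon (\<lambda>i. [:p $ i, v $ i:]) m) \<le> (\<Sum>i\<in>UNIV. degree ([:p $ i, v $ i:] ^ Poly_Mapping.lookup m i))"
    unfolding mon_def by (rule degree_prod_sum_le[unfolded comp_def]) simp
  also have "\<dots> \<le> mdeg m"
  proof (rule sum_mono)
    fix i :: 4
    have "degree ([:p $ i, v $ i:] ^ Poly_Mapping.lookup m i) \<le> degree [:p $ i, v $ i:] * Poly_Mapping.lookup m i"
      by (rule degree_power_le)
    also have "\<dots> \<le> 1 * Poly_Mapping.lookup m i" by (intro mult_right_mono) auto
    finally show "degree ([:p $ i, v $ i:] ^ Poly_Mapping.lookup m i) \<le> Poly_Mapping.lookup m i" by simp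
  qed
  finally show "degree ([:Poly_Mapping.lookup f m:] * mon (\<lambda>i. [:p $ i, v $ i:]) m) \<le> t"
    using m by (simp add: degree_smult_le order_trans)
qed simp

lemma tdeg_le_power: "tdeg_le s f \<Longrightarrow> tdeg_le (s * n) (f ^ n)"
proof (induction n)
  case (Suc n)
  from tdeg_le_mult[OF Suc.prems Suc.IH[OF Suc.prems]] show ?case by simp
qed simp

lemma tdeg_le_planeres:
  assumes "form_of_degree t f"
  shows "tdeg_le t (planeres u v w f)"
  unfolding planeres_def psub_def
proof (rule tdeg_le_sum)
  fix m assume "m \<in> Poly_Mapping.keys f"
  then have m: "mdeg m = t" using assms by (simp add: form_of_degree_def)
  have "tdeg_le (\<Sum>i\<in>A. Poly_Mapping.lookup m i) (\<Prod>i\<in>A. lin (u $ i) (v $ i) (w $ i) ^ Poly_Mapping.lookup m i)" if "finite A" for A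
    using that
  proof (induction A rule: finite_induct)
    case (insert x A)
    have "tdeg_le (Poly_Mapping.lookup m x) (lin (u $ x) (v $ x) (w $ x) ^ Poly_Mapping.lookup m x)"
      using tdeg_le_power[OF tdeg_le_linear, of "Poly_Mapping.lookup m x"] by simp
    from tdeg_le_mult[OF this insert.IH] insert show ?case by simp
  qed simp
  from this[of UNIV] have "tdeg_le t (mon (\<lambda>i. lin (u $ i) (v $ i) (w $ i)) m)" by (simp add: mon_def m)
  from tdeg_le_mult[OF tdeg_le_const this, of 0]
  show "tdeg_le t ([:[:Poly_Mapping.lookup f m:]:] * mon (\<lambda>i. lin (u $ i) (v $ i) (w $ i)) m)" by simp
qed

section \<open>Symbolic squares of ideals of lines\<close>

lemma type_ring_simps [simp]:
  "carrier (ring_of_type_algebra :: 'a::comm_ring_1 ring) = UNIV"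
  "x \<otimes>\<^bsub>ring_of_type_algebra\<^esub> y = (x * y :: 'a)"
  "x \<oplus>\<^bsub>ring_of_type_algebra\<^esub> y = (x + y :: 'a)"
  "\<one>\<^bsub>ring_of_type_algebra\<^esub> = (1 :: 'a)"
  "\<zero>\<^bsub>ring_of_type_algebra\<^esub> = (0 :: 'a)"
  by (simp_all add: ring_of_type_algebra_def)

lemma type_ring_uminus [simp]: "\<ominus>\<^bsub>ring_of_type_algebra\<^esub> x = - (x :: 'a::comm_ring_1)"
proof -
  interpret cring "ring_of_type_algebra :: 'a ring" by (rule cring_from_type_algebra)
  show ?thesis by (rule minus_equality) auto
qed

lemma type_ring_minus [simp]: "x \<ominus>\<^bsub>ring_of_type_algebra\<^esub> y = (x - y :: 'a::comm_ring_1)"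
  by (simp add: a_minus_def)

text \<open>Turns the carrier-based notion of ideal into plain closure conditions; negatives come
  from multiplication by -1.\<close>

lemma ideal_type_iff:
  fixes U :: "'a::comm_ring_1 set"
  shows "ideal U ring_of_type_algebra \<longleftrightarrow> 0 \<in> U \<and> (\<forall>a\<in>U. \<forall>b\<in>U. a + b \<in> U) \<and> (\<forall>a\<in>U. \<forall>r. r * a \<in> U)"
    (is "?L \<longleftrightarrow> ?R")
proof
  assume L: ?L
  note sub = ideal.axioms(1)[OF L]
  show ?R
    using additive_subgroup.zero_closed[OF sub] additive_subgroup.a_closed[OF sub] ideal.I_l_closed[OF L] by auto
next
  assume R: ?R
  interpret cring "ring_of_type_algebra :: 'a ring" by (rule cring_from_type_algebra)
  have neg: "- a \<in> U" if "a \<in> U" for a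
    using R that by (metis mult_minus1)
  show ?L
  proof (rule idealI)
    show "subgroup U (add_monoid ring_of_type_algebra)"
    proof
      fix x assume "x \<in> U"
      then have "\<ominus>\<^bsub>ring_of_type_algebra\<^esub> x \<in> U" using neg by simp
      then show "inv\<^bsub>add_monoid ring_of_type_algebra\<^esub> x \<in> U" by (simp add: a_inv_def)
    qed (use R in auto)
  qed (use R in \<open>auto simp: mult.commute intro: ring_axioms\<close>)
qed

lemma ideal_type_sum:
  fixes U :: "'a::comm_ring_1 set"
  assumes "ideal U ring_of_type_algebra" "\<And>x. x \<in> A \<Longrightarrow> h x \<in> U"
  shows "(\<Sum>x\<in>A. h x) \<in> U"
  using assms(2) by (induction A rule: infinite_finite_induct) (use assms(1) in \<open>auto simp: ideal_type_iff\<close>)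

definition van :: "('k::field ^ 4) set \<Rightarrow> 'k poly4 set" where
  "van V = {f. \<forall>v\<in>V. eval4 f v = 0}"

lemma ideal_van: "ideal (van V) coord_ring"
  by (simp add: ideal_type_iff van_def eval4.hom_add eval4.hom_mult)

text \<open>The generators are forms, but on a cone every homogeneous component of a vanishing
  polynomial vanishes as well. So the generated ideal consists of all polynomials vanishing on the
  cone.\<close>

lemma vanishing_ideal_eq_van:
  fixes Z :: "('k::alg_closed_field ^ 4) set set"
  assumes cone: "\<And>p c v. p \<in> Z \<Longrightarrow> v \<in> p \<Longrightarrow> c *s v \<in> p"
  shows "vanishing_ideal Z = van (\<Union>Z)"
proof -
  interpret cring "coord_ring :: 'k poly4 ring" by (rule cring_from_type_algebra)
  let ?S = "{f :: 'k poly4. (\<exists>t. form_of_degree t f) \<and> (\<forall>p\<in>Z. \<forall>v\<in>p. eval4 f v = 0)}"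
  have "genideal coord_ring ?S \<subseteq> van (\<Union>Z)"
    by (rule genideal_minimal[OF ideal_van]) (auto simp: van_def)
  moreover have "f \<in> genideal coord_ring ?S" if f: "f \<in> van (\<Union>Z)" for f
  proof -
    obtain N where N: "f = (\<Sum>t\<le>N. hcomp t f)" using sum_hcomp by blast
    have "hcomp t f \<in> genideal coord_ring ?S" for t
    proof -
      have "eval4 (hcomp t f) v = 0" if pv: "p \<in> Z" "v \<in> p" for p v
      proof -
        have "eval4 f (c *s v) = c ^ 0 * 0" for c
          using cone[OF pv, of c] pv(1) f by (auto simp: van_def)
        from eval4_hcomp[OF this, of t] show ?thesis by simp
      qed
      then have "hcomp t f \<in> ?S" using form_hcomp[of t f] by blast
      moreover have "?S \<subseteq> genideal coord_ring ?S" by (rule genideal_self) simp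
      ultimately show ?thesis by (rule subsetD[rotated])
    qed
    moreover have "ideal (genideal coord_ring ?S) coord_ring" by (rule genideal_ideal) simp
    ultimately have "(\<Sum>t\<le>N. hcomp t f) \<in> genideal coord_ring ?S" by (intro ideal_type_sum)
    with N show ?thesis by simp
  qed
  ultimately show ?thesis unfolding vanishing_ideal_def by blast
qed

lemma hcomp_van:
  fixes f :: "'k::alg_closed_field poly4"
  assumes "\<And>c v. v \<in> W \<Longrightarrow> c *s v \<in> W" "f \<in> van W"
  shows "hcomp t f \<in> van W"
  unfolding van_def
proof (intro CollectI ballI)
  fix v assume "v \<in> W"
  then have "eval4 f (c *s v) = c ^ 0 * 0" for c using assms by (auto simp: van_def)
  from eval4_hcomp[OF this, of t] show "eval4 (hcomp t f) v = 0" by simp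
qed

section \<open>Generic points\<close>

text \<open>A weak form of polynomiality that suffices for general position: only the restriction to
  each line must be a polynomial in the parameter. It applies equally to functions of a point and of
  a functional \<open>h\<close>.\<close>

definition linepoly :: "('k::field ^ 4 \<Rightarrow> 'k) \<Rightarrow> bool" where
  "linepoly F \<longleftrightarrow> (\<forall>p v. \<exists>q. \<forall>t. F (p + t *s v) = poly q t)"

lemma linepoly_const [intro]: "linepoly (\<lambda>_. c)"
  unfolding linepoly_def by (intro allI exI[of _ "[:c:]"]) simp

lemma linepoly_nth [intro]: "linepoly (\<lambda>v :: 'k::field ^ 4. v $ i)"
  unfolding linepoly_def
proof (intro allI)
  fix p v :: "'k::field ^ 4"
  show "\<exists>q. \<forall>t. (p + t *s v) $ i = poly q t" by (intro exI[of _ "[:p $ i, v $ i:]"]) simp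
qed

lemma linepoly_add [intro]: "linepoly F \<Longrightarrow> linepoly G \<Longrightarrow> linepoly (\<lambda>v. F v + G v)"
  unfolding linepoly_def by (metis poly_add)

lemma linepoly_diff [intro]: "linepoly F \<Longrightarrow> linepoly G \<Longrightarrow> linepoly (\<lambda>v. F v - G v)"
  unfolding linepoly_def by (metis poly_diff)

lemma linepoly_mult [intro]: "linepoly F \<Longrightarrow> linepoly G \<Longrightarrow> linepoly (\<lambda>v. F v * G v)"
  unfolding linepoly_def by (metis poly_mult)

lemma linepoly_sum [intro]: "(\<And>x. x \<in> A \<Longrightarrow> linepoly (h x)) \<Longrightarrow> linepoly (\<lambda>v. \<Sum>x\<in>A. h x v)"
  by (induction A rule: infinite_finite_induct) auto

lemma linepoly_prod [intro]: "(\<And>x. x \<in> A \<Longrightarrow> linepoly (h x)) \<Longrightarrow> linepoly (\<lambda>v. \<Prod>x\<in>A. h x v)"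
  by (induction A rule: infinite_finite_induct) auto

lemma linepoly_power [intro]: "linepoly F \<Longrightarrow> linepoly (\<lambda>v. F v ^ n)"
  by (induction n) auto

lemma linepoly_eval4:
  fixes A :: "'k::field ^ 4 \<Rightarrow> 'k ^ 4"
  assumes "\<And>i. linepoly (\<lambda>v. A v $ i)"
  shows "linepoly (\<lambda>v. eval4 f (A v))"
  unfolding eval4_def
  by (intro linepoly_sum linepoly_mult linepoly_const linepoly_prod linepoly_power assms)

lemma linepoly_dot4 [intro]: "linepoly (\<lambda>v. dot4 v a)" "linepoly (\<lambda>v. dot4 a v)"
  unfolding dot4_def by (intro linepoly_sum linepoly_mult linepoly_nth linepoly_const)+

definition line_closed :: "('k::field ^ 4) set \<Rightarrow> bool" where
  "line_closed V \<longleftrightarrow> (\<forall>u\<in>V. \<forall>v\<in>V. \<forall>t. u + t *s (v - u) \<in> V)"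

lemma line_closed_subspace: "vec.subspace V \<Longrightarrow> line_closed V"
  unfolding line_closed_def by (intro ballI allI vec.subspace_add vec.subspace_scale vec.subspace_diff)

text \<open>A point that is good for all earlier conditions is joined by a line to a point that is
  good for the new one. Along this line each condition excludes finitely many parameters of an
  infinite field.\<close>

lemma generic_point:
  fixes F :: "'i \<Rightarrow> 'k::alg_closed_field ^ 4 \<Rightarrow> 'k"
  assumes "finite J" "line_closed V" "V \<noteq> {}"
    and "\<And>i. i \<in> J \<Longrightarrow> linepoly (F i)" "\<And>i. i \<in> J \<Longrightarrow> \<exists>v\<in>V. F i v \<noteq> 0"
  shows "\<exists>v\<in>V. \<forall>i\<in>J. F i v \<noteq> 0"
  using assms(1,4,5)
proof (induction J rule: finite_induct)
  case empty
  then show ?case using \<open>V \<noteq> {}\<close> by auto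
next
  case (insert j J)
  then obtain u where u: "u \<in> V" "\<forall>i\<in>J. F i u \<noteq> 0" by auto
  obtain v where v: "v \<in> V" "F j v \<noteq> 0" using insert.prems by auto
  have "\<exists>q. \<forall>t. F i (u + t *s (v - u)) = poly q t" if "i \<in> insert j J" for i
    using insert.prems(1)[OF that] unfolding linepoly_def by blast
  then obtain q where q: "\<And>i t. i \<in> insert j J \<Longrightarrow> F i (u + t *s (v - u)) = poly (q i) t" by metis
  have nz: "q i \<noteq> 0" if "i \<in> insert j J" for i
  proof (cases "i = j")
    case True
    then have "poly (q i) 1 \<noteq> 0" using q[of i 1] v by simp
    then show ?thesis by auto
  next
    case False
    with that have "i \<in> J" by simp
    then have "F i u \<noteq> 0" using u(2) by blast
    then have "poly (q i) 0 \<noteq> 0" unfolding q[OF that, of 0, symmetric] by simp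
    then show ?thesis by auto
  qed
  have roots: "finite {t. poly (q i) t = 0}" if "i \<in> insert j J" for i
    using nz[OF that] by (rule poly_roots_finite)
  have "finite (\<Union>i\<in>insert j J. {t. poly (q i) t = 0})"
    by (intro finite_UN_I roots) (use insert.hyps(1) in auto)
  from ex_new_if_finite[OF infinite_alg_closed this]
  obtain t where t: "t \<notin> (\<Union>i\<in>insert j J. {t. poly (q i) t = 0})" by (rule exE)
  show ?case
  proof (intro bexI ballI)
    show "u + t *s (v - u) \<in> V" using assms(2) u v by (simp add: line_closed_def)
    show "F i (u + t *s (v - u)) \<noteq> 0" if "i \<in> insert j J" for i using q[OF that] t that by auto
  qed
qed

text \<open>Irreducibility of \<open>V\<close>: if neither factor vanished on \<open>V\<close>, some
  point of \<open>V\<close> would be a zero of neither.\<close>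

lemma van_prime:
  fixes f g :: "'k::alg_closed_field poly4"
  assumes "line_closed V" "f * g \<in> van V"
  shows "f \<in> van V \<or> g \<in> van V"
proof (rule ccontr)
  assume n: "\<not> ?thesis"
  then obtain u v where uv: "u \<in> V" "eval4 f u \<noteq> 0" "v \<in> V" "eval4 g v \<noteq> 0" by (auto simp: van_def)
  have "\<exists>x\<in>V. \<forall>b\<in>(UNIV :: bool set). eval4 (if b then f else g) x \<noteq> 0"
  proof (rule generic_point)
    show "V \<noteq> {}" using uv by auto
    show "linepoly (eval4 (if b then f else g))" for b by (rule linepoly_eval4[of "\<lambda>v. v"]) (rule linepoly_nth)
    show "\<exists>x\<in>V. eval4 (if b then f else g) x \<noteq> 0" for b using uv by auto
  qed (use assms in auto)
  then obtain x where x: "x \<in> V" "\<forall>b\<in>(UNIV :: bool set). eval4 (if b then f else g) x \<noteq> 0" by (rule bexE)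
  have "eval4 f x \<noteq> 0" using x(2)[rule_format, of True] by simp
  moreover have "eval4 g x \<noteq> 0" using x(2)[rule_format, of False] by simp
  moreover have "eval4 f x * eval4 g x = 0" using assms(2) x(1) by (simp add: van_def eval4.hom_mult)
  ultimately show False by simp
qed

lemma primeideal_van:
  fixes V :: "('k::alg_closed_field ^ 4) set"
  assumes "line_closed V" "V \<noteq> {}"
  shows "primeideal (van V) coord_ring"
proof (rule primeidealI)
  show "ideal (van V) coord_ring" by (rule ideal_van)
  show "cring (coord_ring :: 'k poly4 ring)" by (rule cring_from_type_algebra)
  have "1 \<notin> van V" using assms(2) by (auto simp: van_def)
  then show "carrier coord_ring \<noteq> van V" by auto
  show "a \<in> van V \<or> b \<in> van V" if "a \<otimes>\<^bsub>coord_ring\<^esub> b \<in> van V" for a b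
    using van_prime[OF assms(1)] that by simp
qed

lemma prod_van_notin:
  fixes f :: "'i \<Rightarrow> 'k::alg_closed_field poly4"
  assumes "line_closed V" "V \<noteq> {}" "finite A" "\<And>x. x \<in> A \<Longrightarrow> f x \<notin> van V"
  shows "(\<Prod>x\<in>A. f x) \<notin> van V"
  using assms(3,4)
proof (induction A rule: finite_induct)
  case empty
  then show ?case using assms(2) by (auto simp: van_def)
next
  case (insert x A)
  then show ?case using van_prime[OF assms(1), of "f x" "\<Prod>x\<in>A. f x"] by auto
qed

lemma prod_van_in:
  assumes "finite A" "x \<in> A" "f x \<in> van V"
  shows "(\<Prod>x\<in>A. f x) \<in> van V"
  using assms by (auto simp: van_def eval4.hom_prod intro!: prod_zero)

section \<open>Associated primes and symbolic square of a configuration\<close>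

text \<open>The members of \<open>\<V>\<close> are the cones over the lines. By \<open>sep\<close>
  their prime ideals are pairwise incomparable, so that they are exactly the associated primes of
  \<open>I\<close>.\<close>

locale line_family =
  fixes \<V> :: "('k::alg_closed_field ^ 4) set set"
  assumes fin: "finite \<V>"
    and closed: "\<And>V. V \<in> \<V> \<Longrightarrow> line_closed V" and ne: "\<And>V. V \<in> \<V> \<Longrightarrow> V \<noteq> {}"
    and sep: "\<And>U V. U \<in> \<V> \<Longrightarrow> V \<in> \<V> \<Longrightarrow> U \<noteq> V \<Longrightarrow> \<exists>f. f \<in> van U \<and> f \<notin> van V"
begin

abbreviation I :: "'k poly4 set" where "I \<equiv> van (\<Union>\<V>)"

lemma I_iff: "f \<in> I \<longleftrightarrow> (\<forall>V\<in>\<V>. f \<in> van V)"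
  by (auto simp: van_def)

text \<open>\<open>van V\<close> is the annihilator, modulo \<open>I\<close>, of a product that
  vanishes on all other members but not on \<open>V\<close>.\<close>

lemma van_associated:
  assumes V: "V \<in> \<V>"
  shows "van V \<in> associated_primes coord_ring I"
proof -
  have "\<forall>U\<in>\<V> - {V}. \<exists>f. f \<in> van U \<and> f \<notin> van V" using sep V by blast
  then obtain s where s: "\<And>U. U \<in> \<V> - {V} \<Longrightarrow> s U \<in> van U \<and> s U \<notin> van V" by metis
  define u where "u = (\<Prod>U\<in>\<V> - {V}. s U)"
  have u1: "u \<notin> van V" unfolding u_def using closed ne V fin s by (intro prod_van_notin) auto
  have u2: "u \<in> van U" if "U \<in> \<V> - {V}" for U
    unfolding u_def using fin s that by (intro prod_van_in[of _ U]) auto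
  have "van V = {g \<in> carrier coord_ring. g \<otimes>\<^bsub>coord_ring\<^esub> u \<in> I}"
  proof (intro equalityI subsetI CollectI conjI)
    fix g assume g: "g \<in> van V"
    have "g * u \<in> van U" if "U \<in> \<V>" for U
      using u2[of U] g that by (cases "U = V") (auto simp: van_def eval4.hom_mult)
    then show "g \<otimes>\<^bsub>coord_ring\<^esub> u \<in> I" by (simp add: I_iff)
  next
    fix g assume "g \<in> {g \<in> carrier coord_ring. g \<otimes>\<^bsub>coord_ring\<^esub> u \<in> I}"
    then have "g * u \<in> van V" using V by (simp add: I_iff)
    then show "g \<in> van V" using van_prime[OF closed[OF V]] u1 by blast
  qed simp
  moreover have "primeideal (van V) coord_ring" using primeideal_van[OF closed[OF V] ne[OF V]] .
  ultimately show ?thesis unfolding associated_primes_def by auto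
qed

text \<open>The annihilator of \<open>f\<close> modulo \<open>I\<close> is the intersection of the
  \<open>van V\<close> over those \<open>V\<close> on which \<open>f\<close> does not vanish
  identically. A prime that is a finite intersection of ideals is one of them.\<close>

lemma associated_van:
  assumes "P \<in> associated_primes coord_ring I"
  shows "\<exists>V\<in>\<V>. P = van V"
proof -
  obtain f where P: "primeideal P coord_ring" "P = {g. g * f \<in> I}"
    using assms by (auto simp: associated_primes_def)
  interpret primeideal P "coord_ring :: 'k poly4 ring" by (fact P(1))
  have one: "1 \<notin> P" using one_imp_carrier I_notcarr by auto
  define A where "A = {V \<in> \<V>. f \<notin> van V}"
  have fA: "finite A" using fin by (simp add: A_def)
  have mem: "g \<in> P \<longleftrightarrow> (\<forall>V\<in>A. g \<in> van V)" for g
  proof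
    assume "g \<in> P"
    then have gf: "g * f \<in> van V" if "V \<in> \<V>" for V using that by (simp add: P(2) I_iff)
    show "\<forall>V\<in>A. g \<in> van V"
    proof
      fix V assume "V \<in> A"
      then show "g \<in> van V" using van_prime[OF closed gf] by (auto simp: A_def)
    qed
  next
    assume *: "\<forall>V\<in>A. g \<in> van V"
    have "g * f \<in> van V" if "V \<in> \<V>" for V
      using * that by (cases "V \<in> A") (auto simp: A_def van_def eval4.hom_mult)
    then show "g \<in> P" by (simp add: P(2) I_iff)
  qed
  show ?thesis
  proof (rule ccontr)
    assume n: "\<not> ?thesis"
    have "\<exists>g. g \<in> van V \<and> g \<notin> P" if V: "V \<in> A" for V
    proof -
      have "P \<subseteq> van V" using mem V by blast
      moreover have "P \<noteq> van V" using n V by (auto simp: A_def)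
      ultimately show ?thesis by blast
    qed
    then obtain g where g: "\<And>V. V \<in> A \<Longrightarrow> g V \<in> van V \<and> g V \<notin> P" by metis
    have "(\<Prod>V\<in>B. g V) \<notin> P" if "finite B" "B \<subseteq> A" for B
      using that
    proof (induction B rule: finite_induct)
      case (insert V B)
      then have "(\<Prod>V\<in>B. g V) \<notin> P" "g V \<notin> P" using g by auto
      then show ?case using I_prime[of "g V" "\<Prod>V\<in>B. g V"] insert.hyps by auto
    qed (use one in simp)
    then have "(\<Prod>V\<in>A. g V) \<notin> P" using fA by blast
    moreover have "(\<Prod>V\<in>A. g V) \<in> P" unfolding mem using prod_van_in[OF fA] g by blast
    ultimately show False by blast
  qed
qed

abbreviation I2 :: "'k poly4 set" where
  "I2 \<equiv> I [^]\<^bsub>ideals_set coord_ring\<^esub> (2::nat)"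

lemma I2_eq: "I2 = ideal_prod coord_ring I I"
proof -
  interpret cring "coord_ring :: 'k poly4 ring" by (rule cring_from_type_algebra)
  interpret M: comm_monoid "ideals_set (coord_ring :: 'k poly4 ring)" by (rule ideals_set_is_comm_monoid)
  have "I \<in> carrier (ideals_set coord_ring)" by (simp add: ideals_set_def ideal_van)
  then have "I2 = I \<otimes>\<^bsub>ideals_set coord_ring\<^esub> I"
    by (simp add: numeral_2_eq_2)
  then show ?thesis by (simp add: ideals_set_def)
qed

lemma I2_mult: "f \<in> I \<Longrightarrow> g \<in> I \<Longrightarrow> f * g \<in> I2"
  unfolding I2_eq using ideal_prod.prod[of f I g I coord_ring] by simp

lemma dbl_mult:
  assumes "eval4 f p = 0" "eval4 g p = 0"
  shows "dbl (f * g) p"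
proof -
  have "poly (lineres p v f) 0 = 0" "poly (lineres p v g) 0 = 0" for v
    using assms by (simp_all add: poly_lineres)
  then show ?thesis by (simp add: dbl_def lineres.hom_mult pderiv_mult)
qed

lemma dbl_add: "dbl f p \<Longrightarrow> dbl g p \<Longrightarrow> dbl (f + g) p"
  by (simp add: dbl_def lineres.hom_add pderiv_add)

lemma dbl_I2:
  assumes "f \<in> I2" "V \<in> \<V>" "p \<in> V"
  shows "dbl f p"
  using assms(1) unfolding I2_eq
proof (induction rule: ideal_prod.induct)
  case (prod i j)
  then show ?case using assms(2,3) dbl_mult[of i p j] by (auto simp: van_def)
next
  case (sum s1 s2)
  then show ?case using dbl_add by simp
qed

text \<open>Clearing denominators: the ring is a domain, and \<open>s\<close> outside a prime is
  nonzero because the prime contains 0.\<close>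

lemma symbolic_iff:
  "f \<in> symbolic_power I 2 \<longleftrightarrow> (\<forall>V\<in>\<V>. \<exists>s. s \<notin> van V \<and> f * s \<in> I2)"
proof -
  have "Fract f 1 \<in> localized_ideal I2 P \<longleftrightarrow> (\<exists>s. s \<notin> P \<and> f * s \<in> I2)" if z: "0 \<in> P" for P
  proof
    assume "Fract f 1 \<in> localized_ideal I2 P"
    then obtain a s where as: "Fract f 1 = Fract a s" "a \<in> I2" "s \<notin> P" unfolding localized_ideal_def by blast
    have "s \<noteq> 0" using as(3) z by auto
    then have "f * s = a" using as(1) by (simp add: eq_fract)
    with as show "\<exists>s. s \<notin> P \<and> f * s \<in> I2" by blast
  next
    assume "\<exists>s. s \<notin> P \<and> f * s \<in> I2"
    then obtain s where s: "s \<notin> P" "f * s \<in> I2" by blast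
    have "s \<noteq> 0" using s(1) z by auto
    then have "Fract f 1 = Fract (f * s) s" by (simp add: eq_fract)
    with s show "Fract f 1 \<in> localized_ideal I2 P" unfolding localized_ideal_def by blast
  qed
  moreover have "0 \<in> van V" for V :: "('k ^ 4) set" by (simp add: van_def)
  ultimately have "Fract f 1 \<in> localized_ideal I2 (van V) \<longleftrightarrow> (\<exists>s. s \<notin> van V \<and> f * s \<in> I2)" for V by blast
  moreover have "associated_primes coord_ring I = van ` \<V>" using van_associated associated_van by blast
  ultimately show ?thesis unfolding symbolic_power_def by simp
qed

lemma dy_planeres: "dy (planeres u v w f) (a, b) = poly (pderiv (lineres (u + a *s v) w f)) b"
  by (simp add: dy_def ev2_def poly_poly_const map_poly_pderiv_hom[OF comm_ring_hom_poly] map_poly_planeres)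

text \<open>Expand \<open>f\<close> and \<open>f * s\<close> to first order transversally to a line in \<open>V\<close> through \<open>p\<close> on which \<open>s\<close>
  does not vanish identically.\<close>
lemma dbl_symbolic:
  assumes f: "f \<in> symbolic_power I 2" and V: "V \<in> \<V>" and p: "p \<in> V"
  shows "dbl f p"
proof -
  obtain s where s: "s \<notin> van V" "f * s \<in> I2" using f V symbolic_iff by blast
  then obtain p' where p': "p' \<in> V" "eval4 s p' \<noteq> 0" by (auto simp: van_def)
  show ?thesis unfolding dbl_def
  proof (intro allI)
    fix w
    define P where "P = planeres p (p' - p) w f"
    define Q where "Q = planeres p (p' - p) w s"
    have PQ: "P * Q = planeres p (p' - p) w (f * s)" by (simp add: P_def Q_def planeres.hom_mult)
    have "p + a *s (p' - p) \<in> V" for a using closed[OF V] p p'(1) by (simp add: line_closed_def)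
    then have sing: "sing_at (P * Q) (a, 0)" for a
      unfolding PQ by (intro sing_at_planeres) (simp add: dbl_I2[OF s(2) V])
    have "poly P 0 * poly Q 0 = 0"
    proof (rule poly_0_if_vanishing)
      show "poly (poly P 0 * poly Q 0) a = 0" for a using sing[of a] by (simp add: sing_at_def ev2_def)
    qed
    moreover have "poly (poly Q 0) 1 = eval4 s p'"
      using ev2_planeres[of p "p' - p" w s "(1, 0)"] by (simp add: Q_def ev2_def)
    then have Q0: "poly Q 0 \<noteq> 0" using p'(2) by auto
    ultimately have P0: "poly P 0 = 0" by simp
    have "poly (pderiv P) 0 * poly Q 0 = 0"
    proof (rule poly_0_if_vanishing)
      fix a
      have "dy (P * Q) (a, 0) = 0" using sing[of a] by (simp add: sing_at_def)
      then show "poly (poly (pderiv P) 0 * poly Q 0) a = 0"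
        using P0 by (auto simp: dy_def ev2_def pderiv_mult)
    qed
    with Q0 have P1: "poly (pderiv P) 0 = 0" by simp
    have "poly (lineres p w f) 0 = ev2 P (0, 0)" by (simp add: P_def ev2_planeres poly_lineres)
    moreover have "poly (pderiv (lineres p w f)) 0 = dy P (0, 0)" by (simp add: P_def dy_planeres)
    ultimately show "poly (lineres p w f) 0 = 0 \<and> poly (pderiv (lineres p w f)) 0 = 0"
      using P0 P1 by (simp add: ev2_def dy_def)
  qed
qed

end

section \<open>Regular pairs modulo an ideal\<close>

context
  fixes J :: "'a::comm_ring_1 set"
  assumes J: "ideal J ring_of_type_algebra"
begin

lemma J_closed:
  shows "0 \<in> J" "\<And>a b. a \<in> J \<Longrightarrow> b \<in> J \<Longrightarrow> a + b \<in> J" "\<And>a r. a \<in> J \<Longrightarrow> r * a \<in> J"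
    "\<And>a r. a \<in> J \<Longrightarrow> a * r \<in> J" "\<And>a. a \<in> J \<Longrightarrow> - a \<in> J" "\<And>a b. a \<in> J \<Longrightarrow> b \<in> J \<Longrightarrow> a - b \<in> J"
proof -
  have *: "0 \<in> J" "\<forall>a\<in>J. \<forall>b\<in>J. a + b \<in> J" "\<forall>a\<in>J. \<forall>r. r * a \<in> J"
    using J by (auto simp: ideal_type_iff)
  show "0 \<in> J" "\<And>a b. a \<in> J \<Longrightarrow> b \<in> J \<Longrightarrow> a + b \<in> J" "\<And>a r. a \<in> J \<Longrightarrow> r * a \<in> J"
    using * by blast+
  then show "\<And>a r. a \<in> J \<Longrightarrow> a * r \<in> J" by (simp add: mult.commute)
  have neg: "- a \<in> J" if "a \<in> J" for a
    using *(3) that by (metis mult_minus1)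
  then show "\<And>a. a \<in> J \<Longrightarrow> - a \<in> J" .
  show "a - b \<in> J" if "a \<in> J" "b \<in> J" for a b
    using *(2) neg[OF that(2)] that(1) by (metis diff_conv_add_uminus)
qed

text \<open>The ideal J + (x), that is, the preimage of the principal ideal generated by the class
  of \<open>x\<close> modulo \<open>J\<close>. It allows calculation with representatives instead of
  cosets.\<close>

definition plus_gen :: "'a \<Rightarrow> 'a set" where
  "plus_gen x = {f. \<exists>b. f - b * x \<in> J}"

lemma coset_eq_iff: "J +>\<^bsub>ring_of_type_algebra\<^esub> a = J +>\<^bsub>ring_of_type_algebra\<^esub> b \<longleftrightarrow> a - b \<in> J"
proof -
  interpret cring "ring_of_type_algebra :: 'a ring" by (rule cring_from_type_algebra)
  show ?thesis using quotient_eq_iff_same_a_r_cos[OF J, of a b] by auto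
qed

lemma quot_mult: "(J +>\<^bsub>ring_of_type_algebra\<^esub> a) \<otimes>\<^bsub>ring_of_type_algebra Quot J\<^esub> (J +>\<^bsub>ring_of_type_algebra\<^esub> b)
    = J +>\<^bsub>ring_of_type_algebra\<^esub> (a * b)"
  using ideal.rcoset_mult_add[OF J, of a b] by (simp add: FactRing_def)

lemma quot_carrier: "carrier (ring_of_type_algebra Quot J) = range (\<lambda>a. J +>\<^bsub>ring_of_type_algebra\<^esub> a)"
  by (auto simp: FactRing_def A_RCOSETS_def')

lemma quot_zero: "\<zero>\<^bsub>ring_of_type_algebra Quot J\<^esub> = J +>\<^bsub>ring_of_type_algebra\<^esub> 0"
proof -
  interpret cring "ring_of_type_algebra :: 'a ring" by (rule cring_from_type_algebra)
  have "J +>\<^bsub>ring_of_type_algebra\<^esub> 0 = J"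
    using a_rcos_zero[OF J, of 0] J_closed(1) by simp
  then show ?thesis by (simp add: FactRing_def)
qed

lemma quot_cring: "cring (ring_of_type_algebra Quot J)"
  using ideal.quotient_is_cring[OF J] cring_from_type_algebra by blast

lemma quot_primeideal:
  assumes P: "primeideal P ring_of_type_algebra" "J \<subseteq> P"
  shows "primeideal ((\<lambda>a. J +>\<^bsub>ring_of_type_algebra\<^esub> a) ` P) (ring_of_type_algebra Quot J)"
proof (rule primeidealI)
  interpret cring "ring_of_type_algebra :: 'a ring" by (rule cring_from_type_algebra)
  interpret P: primeideal P "ring_of_type_algebra :: 'a ring" by (fact P(1))
  note Pid = P.is_ideal
  have Pcl: "a + b \<in> P" if "a \<in> P" "b \<in> P" for a b using Pid that by (auto simp: ideal_type_iff)
  have mem: "a \<in> P" if a: "J +>\<^bsub>ring_of_type_algebra\<^esub> a \<in> (\<lambda>a. J +>\<^bsub>ring_of_type_algebra\<^esub> a) ` P" for a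
  proof -
    obtain b where b: "b \<in> P" "J +>\<^bsub>ring_of_type_algebra\<^esub> a = J +>\<^bsub>ring_of_type_algebra\<^esub> b" by (rule imageE[OF a])
    have "a - b \<in> J" using b(2) unfolding coset_eq_iff .
    then have "a - b \<in> P" using P(2) by blast
    from Pcl[OF this b(1)] show ?thesis by simp
  qed
  show "ideal ((\<lambda>a. J +>\<^bsub>ring_of_type_algebra\<^esub> a) ` P) (ring_of_type_algebra Quot J)"
    by (rule ring_ideal_imp_quot_ideal[OF J Pid])
  show "cring (ring_of_type_algebra Quot J)" by (rule quot_cring)
  show "carrier (ring_of_type_algebra Quot J) \<noteq> (\<lambda>a. J +>\<^bsub>ring_of_type_algebra\<^esub> a) ` P"
  proof
    assume "carrier (ring_of_type_algebra Quot J) = (\<lambda>a. J +>\<^bsub>ring_of_type_algebra\<^esub> a) ` P"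
    then have "1 \<in> P" using mem[of 1] by (auto simp: quot_carrier)
    then show False using P.one_imp_carrier P.I_notcarr by simp
  qed
  fix a b
  assume "a \<in> carrier (ring_of_type_algebra Quot J)" "b \<in> carrier (ring_of_type_algebra Quot J)"
    and ab: "a \<otimes>\<^bsub>ring_of_type_algebra Quot J\<^esub> b \<in> (\<lambda>a. J +>\<^bsub>ring_of_type_algebra\<^esub> a) ` P"
  then obtain x y where xy: "a = J +>\<^bsub>ring_of_type_algebra\<^esub> x" "b = J +>\<^bsub>ring_of_type_algebra\<^esub> y" by (auto simp: quot_carrier)
  have "x * y \<in> P" using ab mem unfolding xy quot_mult by blast
  then have "x \<in> P \<or> y \<in> P" using P.I_prime[of x y] by simp
  then show "a \<in> (\<lambda>a. J +>\<^bsub>ring_of_type_algebra\<^esub> a) ` P \<or> b \<in> (\<lambda>a. J +>\<^bsub>ring_of_type_algebra\<^esub> a) ` P" using xy by blast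
qed

lemma quot_psubset:
  assumes "ideal P ring_of_type_algebra" "J \<subseteq> P" "P \<subset> Q"
  shows "(\<lambda>a. J +>\<^bsub>ring_of_type_algebra\<^esub> a) ` P \<subset> (\<lambda>a. J +>\<^bsub>ring_of_type_algebra\<^esub> a) ` Q"
proof -
  obtain x where x: "x \<in> Q" "x \<notin> P" using assms(3) by blast
  have "J +>\<^bsub>ring_of_type_algebra\<^esub> x \<notin> (\<lambda>a. J +>\<^bsub>ring_of_type_algebra\<^esub> a) ` P"
  proof
    assume "J +>\<^bsub>ring_of_type_algebra\<^esub> x \<in> (\<lambda>a. J +>\<^bsub>ring_of_type_algebra\<^esub> a) ` P"
    then obtain b where b: "J +>\<^bsub>ring_of_type_algebra\<^esub> x = J +>\<^bsub>ring_of_type_algebra\<^esub> b" "b \<in> P" by (rule imageE)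
    have "x - b \<in> J" using b(1) unfolding coset_eq_iff .
    with b(2) have "(x - b) + b \<in> P" using assms(1,2) unfolding ideal_type_iff by blast
    with x(2) show False by simp
  qed
  with x(1) assms(3) show ?thesis by blast
qed

text \<open>Only the first two entries of the sequence are unfolded: the ideal of the empty list is
  zero, that is \<open>J\<close> upstairs, and the ideal of the first entry pulls back to
  \<open>plus_gen x1\<close>.\<close>

lemma quot_regular_pair:
  assumes reg: "regular_sequence (ring_of_type_algebra Quot J) xs" and len: "2 \<le> length xs"
    and x: "xs ! 0 = J +>\<^bsub>ring_of_type_algebra\<^esub> x1" "xs ! 1 = J +>\<^bsub>ring_of_type_algebra\<^esub> x2"
  shows "\<And>a. a * x1 \<in> J \<Longrightarrow> a \<in> J" "\<And>a. a * x2 \<in> plus_gen x1 \<Longrightarrow> a \<in> plus_gen x1"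
proof -
  interpret Q: cring "ring_of_type_algebra Quot J" by (rule quot_cring)
  have r: "a \<in> genideal (ring_of_type_algebra Quot J) (set (take i xs))"
    if "i < length xs" "a \<in> carrier (ring_of_type_algebra Quot J)"
      "a \<otimes>\<^bsub>ring_of_type_algebra Quot J\<^esub> (xs ! i) \<in> genideal (ring_of_type_algebra Quot J) (set (take i xs))" for a i
    using reg that unfolding regular_sequence_def by blast
  have carr: "J +>\<^bsub>ring_of_type_algebra\<^esub> a \<in> carrier (ring_of_type_algebra Quot J)" for a by (auto simp: quot_carrier)
  have g0: "genideal (ring_of_type_algebra Quot J) {} = {\<zero>\<^bsub>ring_of_type_algebra Quot J\<^esub>}"
  proof
    show "genideal (ring_of_type_algebra Quot J) {} \<subseteq> {\<zero>\<^bsub>ring_of_type_algebra Quot J\<^esub>}"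
      by (rule Q.genideal_minimal[OF Q.zeroideal]) simp
    have "ideal (genideal (ring_of_type_algebra Quot J) {}) (ring_of_type_algebra Quot J)" by (rule Q.genideal_ideal) simp
    then show "{\<zero>\<^bsub>ring_of_type_algebra Quot J\<^esub>} \<subseteq> genideal (ring_of_type_algebra Quot J) {}"
      by (simp add: additive_subgroup.zero_closed ideal.axioms(1))
  qed
  have l: "0 < length xs" "1 < length xs" using len by auto
  have mem0: "J +>\<^bsub>ring_of_type_algebra\<^esub> a = J +>\<^bsub>ring_of_type_algebra\<^esub> 0 \<longleftrightarrow> a \<in> J" for a
    unfolding coset_eq_iff by simp
  show "a \<in> J" if "a * x1 \<in> J" for a
  proof -
    have "(J +>\<^bsub>ring_of_type_algebra\<^esub> a) \<otimes>\<^bsub>ring_of_type_algebra Quot J\<^esub> (xs ! 0) \<in> genideal (ring_of_type_algebra Quot J) (set (take 0 xs))"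
      using that mem0 by (simp add: x quot_mult g0 quot_zero)
    from r[OF l(1) carr this] have "J +>\<^bsub>ring_of_type_algebra\<^esub> a = J +>\<^bsub>ring_of_type_algebra\<^esub> 0"
      by (simp add: g0 quot_zero)
    then show ?thesis unfolding mem0 .
  qed
  have t1: "set (take 1 xs) = {J +>\<^bsub>ring_of_type_algebra\<^esub> x1}" using len x by (cases xs) auto
  have g1: "genideal (ring_of_type_algebra Quot J) {J +>\<^bsub>ring_of_type_algebra\<^esub> x1} = range (\<lambda>b. J +>\<^bsub>ring_of_type_algebra\<^esub> (b * x1))"
    unfolding Q.cgenideal_eq_genideal[OF carr, symmetric] cgenideal_def quot_carrier
      Setcompr_eq_image image_image quot_mult ..
  have mem1: "J +>\<^bsub>ring_of_type_algebra\<^esub> a \<in> range (\<lambda>b. J +>\<^bsub>ring_of_type_algebra\<^esub> (b * x1)) \<longleftrightarrow> a \<in> plus_gen x1" for a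
    unfolding plus_gen_def image_iff coset_eq_iff by simp
  show "a \<in> plus_gen x1" if "a * x2 \<in> plus_gen x1" for a
  proof -
    have "(J +>\<^bsub>ring_of_type_algebra\<^esub> a) \<otimes>\<^bsub>ring_of_type_algebra Quot J\<^esub> (xs ! 1) \<in> genideal (ring_of_type_algebra Quot J) (set (take 1 xs))"
      using that unfolding t1 g1 x quot_mult mem1 .
    from r[OF l(2) carr this] have "J +>\<^bsub>ring_of_type_algebra\<^esub> a \<in> range (\<lambda>b. J +>\<^bsub>ring_of_type_algebra\<^esub> (b * x1))"
      unfolding t1 g1 .
    then show ?thesis unfolding mem1 .
  qed
qed

context
  fixes x1 x2 :: 'a
  assumes reg1: "\<And>a. a * x1 \<in> J \<Longrightarrow> a \<in> J" and reg2: "\<And>a. a * x2 \<in> plus_gen x1 \<Longrightarrow> a \<in> plus_gen x1"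
begin

lemma reg1_power: "a * x1 ^ n \<in> J \<Longrightarrow> a \<in> J"
proof (induction n arbitrary: a)
  case (Suc n)
  have "(a * x1 ^ n) * x1 \<in> J" using Suc.prems by (simp add: mult_ac)
  then show ?case using reg1 Suc.IH by blast
qed simp

text \<open>Induction on \<open>n\<close>: regularity modulo \<open>x1\<close> writes
  \<open>a\<close> as \<open>b * x1\<close> modulo \<open>J\<close>, and cancelling one factor
  \<open>x1\<close> leaves the same question for \<open>b\<close> and the next smaller
  power.\<close>

lemma reg2_power1: "a * x2 \<in> plus_gen (x1 ^ n) \<Longrightarrow> a \<in> plus_gen (x1 ^ n)"
proof (induction n arbitrary: a)
  case 0
  have "a - a * x1 ^ 0 \<in> J" using J_closed(1) by simp
  then show ?case unfolding plus_gen_def by blast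
next
  case (Suc n)
  obtain v where v: "a * x2 - v * x1 ^ Suc n \<in> J" using Suc.prems unfolding plus_gen_def by blast
  then have "a * x2 - (v * x1 ^ n) * x1 \<in> J" by (simp add: mult_ac)
  then have "a * x2 \<in> plus_gen x1" unfolding plus_gen_def by blast
  then have "a \<in> plus_gen x1" by (rule reg2)
  then obtain b where b: "a - b * x1 \<in> J" unfolding plus_gen_def by blast
  have "(a * x2 - v * x1 ^ Suc n) - (a - b * x1) * x2 \<in> J" by (rule J_closed(6)[OF v J_closed(4)[OF b]])
  also have "(a * x2 - v * x1 ^ Suc n) - (a - b * x1) * x2 = (b * x2 - v * x1 ^ n) * x1" by (simp add: algebra_simps)
  finally have "b * x2 - v * x1 ^ n \<in> J" by (rule reg1)
  then have "b * x2 \<in> plus_gen (x1 ^ n)" unfolding plus_gen_def by blast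
  then have "b \<in> plus_gen (x1 ^ n)" by (rule Suc.IH)
  then obtain c where c: "b - c * x1 ^ n \<in> J" unfolding plus_gen_def by blast
  have "(a - b * x1) + (b - c * x1 ^ n) * x1 \<in> J" by (rule J_closed(2)[OF b J_closed(4)[OF c]])
  also have "(a - b * x1) + (b - c * x1 ^ n) * x1 = a - c * x1 ^ Suc n" by (simp add: algebra_simps)
  finally show ?case unfolding plus_gen_def by blast
qed

lemma reg2_power: "a * x2 ^ m \<in> plus_gen (x1 ^ n) \<Longrightarrow> a \<in> plus_gen (x1 ^ n)"
proof (induction m arbitrary: a)
  case (Suc m)
  have "(a * x2 ^ m) * x2 \<in> plus_gen (x1 ^ n)" using Suc.prems by (simp add: mult_ac)
  then have "a * x2 ^ m \<in> plus_gen (x1 ^ n)" by (rule reg2_power1)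
  then show ?case by (rule Suc.IH)
qed simp

text \<open>The usual exchange argument: the socle modulo a nonzerodivisor does not depend on the
  nonzerodivisor.\<close>
lemma exchange_regular:
  assumes h: "\<And>a. a * h \<in> J \<Longrightarrow> a \<in> J"
    and g: "x1 ^ n * g \<in> plus_gen h" "x2 ^ m * g \<in> plus_gen h"
  shows "g \<in> plus_gen h"
proof -
  obtain g1 where g1: "x1 ^ n * g - g1 * h \<in> J" using g(1) unfolding plus_gen_def by blast
  obtain g2 where g2: "x2 ^ m * g - g2 * h \<in> J" using g(2) unfolding plus_gen_def by blast
  \<comment> \<open>Cross-multiplication eliminates \<open>g\<close>, and cancelling
    \<open>h\<close> leaves g1 x2^m = g2 x1^n modulo \<open>J\<close>. Regularity of
    \<open>x2\<close> modulo powers of \<open>x1\<close> then makes \<open>g1\<close> a multiple of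
    x1^n, and x1^n can be cancelled in its turn.\<close>
  have "x1 ^ n * (x2 ^ m * g - g2 * h) - x2 ^ m * (x1 ^ n * g - g1 * h) \<in> J" by (rule J_closed(6)[OF J_closed(3)[OF g2] J_closed(3)[OF g1]])
  also have "x1 ^ n * (x2 ^ m * g - g2 * h) - x2 ^ m * (x1 ^ n * g - g1 * h) = (g1 * x2 ^ m - g2 * x1 ^ n) * h"
    by (simp add: algebra_simps)
  finally have "g1 * x2 ^ m - g2 * x1 ^ n \<in> J" by (rule h)
  then have "g1 * x2 ^ m \<in> plus_gen (x1 ^ n)" unfolding plus_gen_def by blast
  then have "g1 \<in> plus_gen (x1 ^ n)" by (rule reg2_power)
  then obtain v where v: "g1 - v * x1 ^ n \<in> J" unfolding plus_gen_def by blast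
  have "(x1 ^ n * g - g1 * h) + h * (g1 - v * x1 ^ n) \<in> J" by (rule J_closed(2)[OF g1 J_closed(3)[OF v]])
  also have "(x1 ^ n * g - g1 * h) + h * (g1 - v * x1 ^ n) = (g - v * h) * x1 ^ n" by (simp add: algebra_simps)
  finally have "g - v * h \<in> J" by (rule reg1_power)
  then show ?thesis unfolding plus_gen_def by blast
qed

end

end

section \<open>Plane sections of arithmetically Cohen-Macaulay lines\<close>

lemma dvd_diff_prod:
  fixes f g :: "'i \<Rightarrow> 'a::comm_ring_1"
  assumes "\<And>x. x \<in> A \<Longrightarrow> h dvd f x - g x"
  shows "h dvd (\<Prod>x\<in>A. f x) - (\<Prod>x\<in>A. g x)"
  using assms
proof (induction A rule: infinite_finite_induct)
  case (insert x A)
  have "(\<Prod>x\<in>insert x A. f x) - (\<Prod>x\<in>insert x A. g x) =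
    (f x - g x) * (\<Prod>x\<in>A. f x) + g x * ((\<Prod>x\<in>A. f x) - (\<Prod>x\<in>A. g x))"
    using insert.hyps by (simp add: algebra_simps)
  then show ?case using insert by (simp add: dvd_add dvd_mult dvd_mult2)
qed auto

lemma dvd_diff_power:
  fixes a b :: "'a::comm_ring_1"
  assumes "h dvd a - b"
  shows "h dvd a ^ n - b ^ n"
  using dvd_diff_prod[of "{..<n}" h "\<lambda>_. a" "\<lambda>_. b"] assms by simp

text \<open>Substitution respects congruence modulo \<open>h\<close>, by telescoping
  products.\<close>

lemma psub_cong_dvd:
  fixes c d :: "4 \<Rightarrow> 'r::comm_ring_1"
  assumes "\<And>i. h dvd c i - d i"
  shows "h dvd psub \<phi> c f - psub \<phi> d f"
proof -
  have "h dvd mon c m - mon d m" for m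
    unfolding mon_def by (intro dvd_diff_prod dvd_diff_power assms)
  then have "h dvd (\<Sum>m\<in>Poly_Mapping.keys f. \<phi> (Poly_Mapping.lookup f m) * (mon c m - mon d m))"
    by (intro dvd_sum) (simp add: dvd_mult)
  then show ?thesis by (simp add: psub_def sum_subtractf right_diff_distrib)
qed

abbreviation cst :: "'k::field \<Rightarrow> 'k poly4" where
  "cst c \<equiv> Poly_Mapping.single 0 c"

lemma eval4_cst [simp]: "eval4 (cst c) v = c"
  unfolding eval4_psub psub_single[OF comm_ring_hom_id] by simp

text \<open>Compose \<open>f\<close> with the projection \<open>v \<mapsto> e(v) p + h(v) q\<close> onto the span of \<open>p\<close> and \<open>q\<close>.\<close>
lemma form_vanishing_at_point:
  fixes f :: "'k::alg_closed_field poly4"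
  assumes f: "form_of_degree t f" "eval4 f p = 0"
    and V: "\<And>v. v \<in> V \<Longrightarrow> v = dot4 e v *s p + dot4 h v *s q"
  obtains g where "f - lform h * g \<in> van V"
proof -
  define F where "F = psub cst (\<lambda>i. cst (p $ i) * lform e + cst (q $ i) * lform h) f"
  \<comment> \<open>Modulo \<open>lform h\<close> the composite is f(e(v) p), which equals e(v)^t
    f(p) and hence vanishes.\<close>
  have "lform h dvd F - psub cst (\<lambda>i. cst (p $ i) * lform e) f"
    unfolding F_def by (rule psub_cong_dvd) simp
  moreover have "psub cst (\<lambda>i. cst (p $ i) * lform e) f = 0"
  proof (rule zero_if_eval4_zero)
    fix v
    have "eval4 (psub cst (\<lambda>i. cst (p $ i) * lform e) f) v = eval4 f (dot4 e v *s p)"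
      by (subst psub_hom[OF eval4.comm_ring_hom_axioms])
         (auto simp: eval4_psub[of f] eval4.hom_mult mult.commute intro!: arg_cong[where f = "\<lambda>c. psub (\<lambda>x. x) c f"])
    then show "eval4 (psub cst (\<lambda>i. cst (p $ i) * lform e) f) v = 0"
      using f by (simp add: eval4_scale)
  qed
  ultimately obtain g where g: "F = lform h * g" by (auto elim: dvdE)
  have "eval4 F v = eval4 f v" if "v \<in> V" for v
  proof -
    have "eval4 F v = eval4 f (dot4 e v *s p + dot4 h v *s q)"
      unfolding F_def
      by (subst psub_hom[OF eval4.comm_ring_hom_axioms])
         (auto simp: eval4_psub[of f] eval4.hom_mult eval4.hom_add mult.commute intro!: arg_cong[where f = "\<lambda>c. psub (\<lambda>x. x) c f"])
    then show ?thesis using V[OF that] by simp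
  qed
  then have "f - lform h * g \<in> van V" by (simp add: van_def eval4.hom_minus g[symmetric])
  with that show ?thesis by blast
qed

text \<open>In every binomial term either \<open>x\<close> has exponent at least \<open>M\<close> or
  \<open>y\<close> has exponent at least \<open>N\<close>.\<close>

lemma power_add_in_ideal:
  fixes x y :: "'a::comm_ring_1"
  assumes K: "ideal K ring_of_type_algebra" and x: "x ^ M \<in> K" and y: "y ^ N \<in> K"
  shows "(x + y) ^ (M + N) \<in> K"
  unfolding binomial_ring
proof (rule ideal_type_sum[OF K])
  fix k assume "k \<in> {..M + N}"
  show "of_nat (M + N choose k) * x ^ k * y ^ (M + N - k) \<in> K"
  proof (cases "M \<le> k")
    case True
    then have "x ^ k = x ^ (k - M) * x ^ M" by (simp add: power_add[symmetric])
    then have "of_nat (M + N choose k) * x ^ k * y ^ (M + N - k) =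
        (of_nat (M + N choose k) * x ^ (k - M) * y ^ (M + N - k)) * x ^ M" by (simp add: mult_ac)
    then show ?thesis using J_closed(3)[OF K x] by simp
  next
    case False
    then have "M + N - k = (M - k) + N" by simp
    then have "y ^ (M + N - k) = y ^ (M - k) * y ^ N" by (simp add: power_add)
    then have "of_nat (M + N choose k) * x ^ k * y ^ (M + N - k) =
        (of_nat (M + N choose k) * x ^ k * y ^ (M - k)) * y ^ N" by (simp add: mult_ac)
    then show ?thesis using J_closed(3)[OF K y] by simp
  qed
qed

lemma lookup_0_eval4: "Poly_Mapping.lookup f 0 = eval4 f 0"
proof -
  have mon: "mon (($) (0 :: 'a ^ 4)) m = (if m = 0 then 1 else 0)" for m
  proof (cases "m = 0")
    case False
    then obtain i where i: "Poly_Mapping.lookup m i \<noteq> 0" by (metis lookup_zero poly_mapping_eqI)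
    then have "(0 :: 'a ^ 4) $ i ^ Poly_Mapping.lookup m i = 0" by simp
    then have "mon (($) (0 :: 'a ^ 4)) m = 0" unfolding mon_def by (intro prod_zero) (auto intro: bexI[of _ i])
    then show ?thesis using False by simp
  qed simp
  have "eval4 f 0 = (\<Sum>m\<in>Poly_Mapping.keys f. if m = 0 then Poly_Mapping.lookup f 0 else 0)"
    unfolding eval4_psub psub_def mon by (intro sum.cong) auto
  also have "\<dots> = Poly_Mapping.lookup f 0" by (simp add: in_keys_iff)
  finally show ?thesis by simp
qed

text \<open>The radical of \<open>K\<close> is an ideal containing the four variables, hence every
  polynomial without constant term.\<close>

lemma power_in_ideal:
  fixes x :: "'k::field poly4"
  assumes K: "ideal K coord_ring" and lin: "\<And>e. \<exists>N. lform e ^ N \<in> K" and x: "eval4 x 0 = 0"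
  shows "\<exists>N. x ^ N \<in> K"
proof -
  define R where "R = {x :: 'k poly4. \<exists>N. x ^ N \<in> K}"
  have add: "a + b \<in> R" if "a \<in> R" "b \<in> R" for a b
    using that power_add_in_ideal[OF K] unfolding R_def by blast
  have mult: "r * a \<in> R" if a: "a \<in> R" for a r
  proof -
    obtain N where "a ^ N \<in> K" using a unfolding R_def by blast
    then have "(r * a) ^ N \<in> K" unfolding power_mult_distrib by (rule J_closed(3)[OF K])
    then show ?thesis unfolding R_def by blast
  qed
  have "0 ^ 1 \<in> K" using J_closed(1)[OF K] by simp
  then have "0 \<in> R" unfolding R_def by blast
  with add mult have R: "ideal R coord_ring" unfolding ideal_type_iff by blast
  have single: "Poly_Mapping.single m c \<in> R" if m: "m \<noteq> 0" for m and c :: 'k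
  proof -
    obtain i where i: "Poly_Mapping.lookup m i \<noteq> 0" using m by (metis lookup_zero poly_mapping_eqI)
    define n where "n = m - Poly_Mapping.single i 1"
    have "m = n + Poly_Mapping.single i 1"
      by (rule poly_mapping_eqI) (use i in \<open>auto simp: n_def lookup_add lookup_minus lookup_single when_def\<close>)
    then have "Poly_Mapping.single m c = Poly_Mapping.single n c * Poly_Mapping.single (Poly_Mapping.single i 1) (1 :: 'k)"
      by (simp add: mult_single)
    moreover have "lform (axis i (1 :: 'k)) = Poly_Mapping.single (Poly_Mapping.single i 1) 1"
    proof -
      have "lform (axis i (1 :: 'k)) = (\<Sum>j\<in>UNIV. if j = i then Poly_Mapping.single (Poly_Mapping.single i 1) 1 else 0)"
        unfolding lform_def by (intro sum.cong) (auto simp: axis_def)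
      then show ?thesis by simp
    qed
    moreover have "lform (axis i (1 :: 'k)) \<in> R" using lin unfolding R_def by blast
    ultimately show ?thesis using mult by simp
  qed
  have "(\<Sum>m\<in>Poly_Mapping.keys x. Poly_Mapping.single m (Poly_Mapping.lookup x m)) \<in> R"
  proof (rule ideal_type_sum[OF R])
    fix m assume "m \<in> Poly_Mapping.keys x"
    then have "m \<noteq> 0" using x lookup_0_eval4[of x] by (auto simp: in_keys_iff)
    then show "Poly_Mapping.single m (Poly_Mapping.lookup x m) \<in> R" by (rule single)
  qed
  then show ?thesis unfolding sum_single_lookup R_def by blast
qed

section \<open>Depth at the irrelevant maximal ideal\<close>

text \<open>Modulo polynomials vanishing at the origin every element is a constant, so a strictly
  larger ideal contains a nonzero constant, a unit.\<close>

lemma quot_maximalideal: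
  fixes J :: "'k::alg_closed_field poly4 set"
  assumes J: "ideal J coord_ring" "J \<subseteq> van {0}"
  shows "maximalideal ((\<lambda>a. J +>\<^bsub>coord_ring\<^esub> a) ` van {0}) (coord_ring Quot J)"
proof -
  interpret cring "coord_ring :: 'k poly4 ring" by (rule cring_from_type_algebra)
  have "line_closed {0 :: 'k ^ 4}" by (simp add: line_closed_def)
  then have "primeideal (van {0}) (coord_ring :: 'k poly4 ring)" by (rule primeideal_van) simp
  from quot_primeideal[OF J(1) this J(2)]
  interpret P: primeideal "(\<lambda>a. J +>\<^bsub>coord_ring\<^esub> a) ` van {0}" "coord_ring Quot J" .
  show ?thesis
  proof (rule maximalidealI)
    show "ideal ((\<lambda>a. J +>\<^bsub>coord_ring\<^esub> a) ` van {0}) (coord_ring Quot J)" by (rule P.is_ideal)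
    show "carrier (coord_ring Quot J) \<noteq> (\<lambda>a. J +>\<^bsub>coord_ring\<^esub> a) ` van {0}" by (rule P.I_notcarr)
    fix K assume K: "ideal K (coord_ring Quot J)" "(\<lambda>a. J +>\<^bsub>coord_ring\<^esub> a) ` van {0} \<subseteq> K" "K \<subseteq> carrier (coord_ring Quot J)"
    have K': "ideal (\<Union>K) coord_ring" by (rule quot_ideal_imp_ring_ideal[OF J(1) K(1)])
    have mem: "a \<in> \<Union>K \<longleftrightarrow> J +>\<^bsub>coord_ring\<^esub> a \<in> K" for a
      using canonical_proj_vimage_mem_iff[OF J(1) K(3), of a] by simp
    show "K = (\<lambda>a. J +>\<^bsub>coord_ring\<^esub> a) ` van {0} \<or> K = carrier (coord_ring Quot J)"
    proof (rule disjCI)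
      assume "K \<noteq> carrier (coord_ring Quot J)"
      show "K = (\<lambda>a. J +>\<^bsub>coord_ring\<^esub> a) ` van {0}"
      proof (rule ccontr)
        assume "K \<noteq> (\<lambda>a. J +>\<^bsub>coord_ring\<^esub> a) ` van {0}"
        then obtain y where y: "y \<in> K" "y \<notin> (\<lambda>a. J +>\<^bsub>coord_ring\<^esub> a) ` van {0}" using K(2) by blast
        then obtain x where x: "y = J +>\<^bsub>coord_ring\<^esub> x" using K(3) unfolding quot_carrier[OF J(1)] by blast
        define c where "c = eval4 x 0"
        have "c \<noteq> 0" using y(2) x by (auto simp: c_def van_def)
        have "x - cst c \<in> van {0}" by (simp add: van_def c_def eval4.hom_minus)
        then have "x - cst c \<in> \<Union>K" using K(2) mem by blast
        moreover have "x \<in> \<Union>K" using mem x y(1) by blast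
        ultimately have "x - (x - cst c) \<in> \<Union>K" using J_closed(6)[OF K'] by blast
        then have "cst c \<in> \<Union>K" by simp
        then have u: "r * cst (inverse c) * cst c \<in> \<Union>K" for r using J_closed(3)[OF K'] by blast
        have "cst (inverse c) * cst c = 1" using \<open>c \<noteq> 0\<close> by (simp add: mult_single)
        then have "r \<in> \<Union>K" for r using u[of r] by (simp add: mult.assoc)
        then have "carrier (coord_ring Quot J) \<subseteq> K" using mem unfolding quot_carrier[OF J(1)] by blast
        with K(3) \<open>K \<noteq> carrier (coord_ring Quot J)\<close> show False by blast
      qed
    qed
  qed
qed

text \<open>The chain from \<open>P0\<close> through \<open>P1\<close> to the irrelevant ideal shows
  that its image has height at least two. The Cohen-Macaulay condition at this maximal ideal turns
  the height into depth, hence into a regular sequence with at least two entries.\<close>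

lemma CM_regular_pair:
  fixes J :: "'k::alg_closed_field poly4 set"
  assumes J: "ideal J coord_ring" and cm: "cohen_macaulay (coord_ring Quot J)"
    and P: "primeideal P0 coord_ring" "primeideal P1 coord_ring" "J \<subseteq> P0" "P0 \<subset> P1" "P1 \<subset> van {0}"
  obtains x1 x2 where "eval4 x1 0 = 0" "eval4 x2 0 = 0"
    "\<forall>a. a * x1 \<in> J \<longrightarrow> a \<in> J" "\<forall>a. a * x2 \<in> plus_gen J x1 \<longrightarrow> a \<in> plus_gen J x1"
proof -
  let ?R = "coord_ring Quot J"
  let ?\<pi> = "\<lambda>a. J +>\<^bsub>coord_ring\<^esub> a"
  let ?M = "?\<pi> ` van {0}"
  have Jm: "J \<subseteq> P1" "J \<subseteq> van {0}" using P by auto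
  have max: "maximalideal ?M ?R" by (rule quot_maximalideal[OF J Jm(2)])
  have "line_closed {0 :: 'k ^ 4}" by (simp add: line_closed_def)
  then have m: "primeideal (van {0}) (coord_ring :: 'k poly4 ring)" by (rule primeideal_van) simp
  define p where "p = (\<lambda>i::nat. if i = 0 then ?\<pi> ` P0 else if i = 1 then ?\<pi> ` P1 else ?M)"
  have pr: "primeideal (p i) ?R" for i
    using quot_primeideal[OF J P(1) P(3)] quot_primeideal[OF J P(2) Jm(1)] quot_primeideal[OF J m Jm(2)]
    by (simp add: p_def)
  have s0: "?\<pi> ` P0 \<subset> ?\<pi> ` P1" by (rule quot_psubset[OF J primeideal.axioms(1)[OF P(1)] P(3,4)])
  have s1: "?\<pi> ` P1 \<subset> ?M" by (rule quot_psubset[OF J primeideal.axioms(1)[OF P(2)] Jm(1) P(5)])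
  have strict: "p i \<subset> p (Suc i)" if i: "i < 2" for i
  proof -
    consider "i = 0" | "i = 1" using i by linarith
    then show ?thesis
    proof cases
      case 1
      then show ?thesis using s0 by (simp add: p_def)
    next
      case 2
      then show ?thesis using s1 by (simp add: p_def)
    qed
  qed
  have "enat 2 \<le> prime_height ?R ?M"
    unfolding prime_height_def
  proof (rule SUP_upper, rule CollectI, intro exI conjI allI impI)
    show "p 2 = ?M" by (simp add: p_def)
  qed (use pr strict in auto)
  also have "prime_height ?R ?M = ideal_depth ?R ?M"
    using cm max unfolding cohen_macaulay_def by simp
  finally have depth: "enat 2 \<le> ideal_depth ?R ?M" .
  \<comment> \<open>The depth is a supremum; if all regular sequences had length at most one, so
    would be the supremum.\<close>
  have "\<exists>xs. set xs \<subseteq> ?M \<and> regular_sequence ?R xs \<and> 2 \<le> length xs"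
  proof (rule ccontr)
    assume n: "\<not> ?thesis"
    have "ideal_depth ?R ?M \<le> enat 1"
      unfolding ideal_depth_def
    proof (rule SUP_least)
      fix xs assume "xs \<in> {xs. set xs \<subseteq> ?M \<and> regular_sequence ?R xs}"
      then have "\<not> 2 \<le> length xs" using n by blast
      then show "enat (length xs) \<le> enat 1" by simp
    qed
    with depth have "enat 2 \<le> enat 1" by (rule order_trans)
    then show False by simp
  qed
  then obtain xs where xs: "set xs \<subseteq> ?M" "regular_sequence ?R xs" "2 \<le> length xs" by blast
  have l: "0 < length xs" "1 < length xs" using xs(3) by auto
  obtain x1 where x1: "xs ! 0 = ?\<pi> x1" "x1 \<in> van {0}" by (rule imageE[OF subsetD[OF xs(1) nth_mem[OF l(1)]]])
  obtain x2 where x2: "xs ! 1 = ?\<pi> x2" "x2 \<in> van {0}" by (rule imageE[OF subsetD[OF xs(1) nth_mem[OF l(2)]]])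
  note x = x1 x2
  show ?thesis
  proof (rule that[of x1 x2])
    show "eval4 x1 0 = 0" "eval4 x2 0 = 0" using x(2,4) by (simp_all add: van_def)
    show "\<forall>a. a * x1 \<in> J \<longrightarrow> a \<in> J" by (intro allI impI) (rule quot_regular_pair(1)[OF J xs(2,3) x(1,3)])
    show "\<forall>a. a * x2 \<in> plus_gen J x1 \<longrightarrow> a \<in> plus_gen J x1" by (intro allI impI) (rule quot_regular_pair(2)[OF J xs(2,3) x(1,3)])
  qed
qed

section \<open>Lifting curves from a plane section\<close>

text \<open>The plane is the kernel of \<open>h\<close>. In \<open>V\<close> the vector
  \<open>p V\<close> spans the section point, \<open>q V\<close> completes it to a basis, and
  \<open>e V\<close> and \<open>h\<close> are the dual coordinates. By \<open>lsep\<close> there are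
  linear forms through one line that avoid the section point of another.\<close>

locale line_section = line_family \<V> for \<V> :: "('k::alg_closed_field ^ 4) set set" +
  fixes h :: "'k ^ 4" and p q e :: "('k ^ 4) set \<Rightarrow> 'k ^ 4"
  assumes ne\<V>: "\<V> \<noteq> {}"
    and cone: "\<And>V c v. V \<in> \<V> \<Longrightarrow> v \<in> V \<Longrightarrow> c *s v \<in> V"
    and pq: "\<And>V. V \<in> \<V> \<Longrightarrow> p V \<in> V" "\<And>V. V \<in> \<V> \<Longrightarrow> q V \<in> V"
      "\<And>V. V \<in> \<V> \<Longrightarrow> dot4 h (p V) = 0" "\<And>V. V \<in> \<V> \<Longrightarrow> dot4 h (q V) = 1" "\<And>V. V \<in> \<V> \<Longrightarrow> p V \<noteq> 0"
    and coords: "\<And>V v. V \<in> \<V> \<Longrightarrow> v \<in> V \<Longrightarrow> v = dot4 (e V) v *s p V + dot4 h v *s q V"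
    and lsep: "\<And>U V. U \<in> \<V> \<Longrightarrow> V \<in> \<V> \<Longrightarrow> U \<noteq> V \<Longrightarrow> \<exists>l. (\<forall>u\<in>U. dot4 l u = 0) \<and> dot4 l (p V) \<noteq> 0"
begin

lemma e_p: "V \<in> \<V> \<Longrightarrow> dot4 (e V) (p V) = 1"
  using coords[OF _ pq(1), of V] pq(3,5)[of V] 
  by (metis add.right_neutral scalar_mult_eq_scaleR vec.scale_cancel_right vec.scale_one vec.scale_zero_left)

text \<open>No line lies in the plane, so \<open>lform h\<close> avoids every associated prime of
  \<open>I\<close>.\<close>

lemma h_regular: "a * lform h \<in> I \<Longrightarrow> a \<in> I"
  unfolding I_iff
proof
  fix V assume V: "V \<in> \<V>" and a: "\<forall>V\<in>\<V>. a * lform h \<in> van V"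
  have "lform h \<notin> van V" using pq(2,4)[OF V] by (auto simp: van_def intro!: bexI[of _ "q V"])
  with a V show "a \<in> van V" using van_prime[OF closed[OF V], of a "lform h"] by blast
qed

text \<open>\<open>u\<close> is the sum of the products \<open>s V\<close>, where \<open>s V\<close>
  vanishes on all lines other than \<open>V\<close> but not at \<open>p V\<close>. If
  \<open>G\<close> vanishes at the section points, it equals \<open>lform h * g V\<close> on each
  \<open>V\<close>; weighting these congruences with \<open>s V\<close> and adding puts
  \<open>u * G\<close> into I + (h).\<close>

lemma point_separator:
  obtains u where "form_of_degree (card \<V> - 1) u" "\<forall>V\<in>\<V>. eval4 u (p V) \<noteq> 0"
    "\<forall>G t. form_of_degree t G \<longrightarrow> (\<forall>V\<in>\<V>. eval4 G (p V) = 0) \<longrightarrow> u * G \<in> plus_gen I (lform h)"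
proof -
  have "\<forall>V\<in>\<V>. \<forall>U\<in>\<V>. \<exists>l. U \<noteq> V \<longrightarrow> (\<forall>u\<in>U. dot4 l u = 0) \<and> dot4 l (p V) \<noteq> 0" using lsep by blast
  then obtain l where l: "\<And>U V. V \<in> \<V> \<Longrightarrow> U \<in> \<V> \<Longrightarrow> U \<noteq> V \<Longrightarrow> (\<forall>u\<in>U. dot4 (l V U) u = 0) \<and> dot4 (l V U) (p V) \<noteq> 0"
    by metis
  define s where "s V = (\<Prod>U\<in>\<V> - {V}. lform (l V U))" for V
  have s_form: "form_of_degree (card \<V> - 1) (s V)" if "V \<in> \<V>" for V
  proof -
    have "form_of_degree (card (\<V> - {V})) (s V)" unfolding s_def
      by (rule form_prod) (simp_all add: fin form_lform[simplified])
    then show ?thesis using fin that by simp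
  qed
  have s_van: "s V \<in> van U" if "V \<in> \<V>" "U \<in> \<V>" "U \<noteq> V" for U V
    unfolding s_def by (rule prod_van_in[of _ U]) (use fin that l in \<open>auto simp: van_def\<close>)
  have s_p: "eval4 (s V) (p V) \<noteq> 0" if "V \<in> \<V>" for V
    unfolding s_def eval4.hom_prod using fin l that by simp
  define u where "u = (\<Sum>V\<in>\<V>. s V)"
  have "eval4 u (p V) = eval4 (s V) (p V)" if V: "V \<in> \<V>" for V
  proof -
    have "eval4 u (p V) = (\<Sum>U\<in>\<V>. if U = V then eval4 (s V) (p V) else 0)"
      unfolding u_def eval4.hom_sum using s_van V pq(1)[OF V] by (intro sum.cong) (auto simp: van_def)
    then show ?thesis using V fin by simp
  qed
  moreover have "u * G \<in> plus_gen I (lform h)"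
    if G: "form_of_degree t G" "\<And>V. V \<in> \<V> \<Longrightarrow> eval4 G (p V) = 0" for G t
  proof -
    have "\<exists>g. G - lform h * g \<in> van V" if V: "V \<in> \<V>" for V
    proof (rule form_vanishing_at_point[OF G(1) G(2)[OF V]])
      show "v = dot4 (e V) v *s p V + dot4 h v *s q V" if "v \<in> V" for v by (rule coords[OF V that])
    qed blast
    then obtain g where g: "\<And>V. V \<in> \<V> \<Longrightarrow> G - lform h * g V \<in> van V" by metis
    have "(\<Sum>V\<in>\<V>. s V * (G - lform h * g V)) \<in> I"
    proof (rule ideal_type_sum[OF ideal_van], unfold I_iff, intro ballI)
      fix V U assume VU: "V \<in> \<V>" "U \<in> \<V>"
      show "s V * (G - lform h * g V) \<in> van U"
        using s_van[OF VU] g[OF VU(1)] by (cases "U = V") (auto simp: van_def eval4.hom_mult)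
    qed
    moreover have "(\<Sum>V\<in>\<V>. s V * (G - lform h * g V)) = u * G - (\<Sum>V\<in>\<V>. s V * g V) * lform h"
      by (simp add: u_def right_diff_distrib sum_subtractf sum_distrib_right sum_distrib_left mult_ac)
    ultimately show ?thesis unfolding plus_gen_def[OF ideal_van] by auto
  qed
  moreover have "form_of_degree (card \<V> - 1) u" unfolding u_def by (rule form_sum) (rule s_form)
  ultimately show ?thesis using that[of u] s_p by auto
qed

text \<open>Let K = I + (h, u). It contains a power of every linear form and multiplies
  \<open>G\<close> into I + (h). With depth two, \<open>exchange_regular\<close> puts
  \<open>G\<close> itself into I + (h). Then the component of degree \<open>t\<close> of
  \<open>G - g * lform h\<close> is a form in \<open>I\<close>, hence zero, and on the plane it has
  the same values as \<open>G\<close>.\<close>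

theorem CM_section:
  assumes cm: "cohen_macaulay (coord_ring Quot I)"
    and G: "form_of_degree t G" "\<And>V. V \<in> \<V> \<Longrightarrow> eval4 G (p V) = 0"
    and no: "\<And>f. f \<in> I \<Longrightarrow> form_of_degree t f \<Longrightarrow> f = 0"
    and v: "dot4 h v = 0"
  shows "eval4 G v = 0"
proof -
  obtain V where V: "V \<in> \<V>" using ne\<V> by blast
  define W where "W = vec.span {p V}"
  have W_eq: "W = range (\<lambda>c. c *s p V)" unfolding W_def by (rule vec.span_singleton)
  have W: "line_closed W" "W \<noteq> {}"
    unfolding W_def using line_closed_subspace[OF vec.subspace_span] vec.span_zero by blast+
  \<comment> \<open>The chain for the height: the ideals of the cone \<open>V\<close>, of the cone
    \<open>W\<close> over its section point, and of the vertex.\<close>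
  have c1: "van V \<subset> van W"
  proof
    show "van V \<subseteq> van W" using cone[OF V pq(1)[OF V]] by (auto simp: van_def W_eq)
    have "lform h \<in> van W" "lform h \<notin> van V"
      using pq[OF V] by (auto simp: van_def W_eq intro!: bexI[of _ "q V"])
    then show "van V \<noteq> van W" by blast
  qed
  have c2: "van W \<subset> van {0}"
  proof
    have "0 \<in> W" unfolding W_eq by (rule image_eqI[of _ _ 0]) auto
    then show "van W \<subseteq> van {0}" by (auto simp: van_def)
    have "p V \<in> W" unfolding W_eq by (rule image_eqI[of _ _ 1]) auto
    then have "lform (e V) \<in> van {0}" "lform (e V) \<notin> van W"
      using e_p[OF V] by (auto simp: van_def intro!: bexI[of _ "p V"])
    then show "van W \<noteq> van {0}" by blast
  qed
  have IV: "I \<subseteq> van V" using V by (auto simp: van_def)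
  obtain x1 x2 where x: "eval4 x1 0 = 0" "eval4 x2 0 = 0"
    "\<forall>a. a * x1 \<in> I \<longrightarrow> a \<in> I" "\<forall>a. a * x2 \<in> plus_gen I x1 \<longrightarrow> a \<in> plus_gen I x1"
    by (rule CM_regular_pair[OF ideal_van cm primeideal_van[OF closed[OF V] ne[OF V]] primeideal_van[OF W] IV c1 c2])
  obtain u where u: "form_of_degree (card \<V> - 1) u" "\<forall>V\<in>\<V>. eval4 u (p V) \<noteq> 0"
    "\<forall>G t. form_of_degree t G \<longrightarrow> (\<forall>V\<in>\<V>. eval4 G (p V) = 0) \<longrightarrow> u * G \<in> plus_gen I (lform h)"
    by (rule point_separator)
  define K where "K = {f. \<exists>a. f - a * u \<in> plus_gen I (lform h)}"
  have plus: "f \<in> plus_gen I (lform h) \<longleftrightarrow> (\<exists>b. f - b * lform h \<in> I)" for f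
    by (simp add: plus_gen_def[OF ideal_van])
  have Kmem: "f \<in> K \<longleftrightarrow> (\<exists>a b. f - a * u - b * lform h \<in> I)" for f
    by (simp add: K_def plus)
  note Icl = J_closed[OF ideal_van[of "\<Union>\<V>"]]
  have K: "ideal K coord_ring"
    unfolding ideal_type_iff
  proof (intro conjI ballI allI)
    show "0 \<in> K" unfolding Kmem using Icl(1) by (intro exI[of _ 0]) simp
    fix f assume "f \<in> K"
    then obtain a b where ab: "f - a * u - b * lform h \<in> I" unfolding Kmem by blast
    {
      fix g assume "g \<in> K"
      then obtain c d where cd: "g - c * u - d * lform h \<in> I" unfolding Kmem by blast
      have "(f - a * u - b * lform h) + (g - c * u - d * lform h) \<in> I" by (rule Icl(2)[OF ab cd])
      also have "(f - a * u - b * lform h) + (g - c * u - d * lform h) = (f + g) - (a + c) * u - (b + d) * lform h"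
        by (simp add: algebra_simps)
      finally show "f + g \<in> K" unfolding Kmem by blast
    next
      fix r
      have "r * (f - a * u - b * lform h) \<in> I" by (rule Icl(3)[OF ab])
      also have "r * (f - a * u - b * lform h) = (r * f) - (r * a) * u - (r * b) * lform h"
        by (simp add: algebra_simps)
      finally show "r * f \<in> K" unfolding Kmem by blast
    }
  qed
  define D where "D = card \<V> - 1"
  \<comment> \<open>\<open>D\<close> is the degree of \<open>u\<close>, so a^D - c_V u is a form,
    and c_V is chosen to make it vanish at \<open>p V\<close>. On \<open>V\<close> it is thus a
    multiple of \<open>lform h\<close>. The product of the corrected factors over all
    \<open>V\<close> lies in \<open>I\<close>, and modulo \<open>u\<close> and
    \<open>lform h\<close> it is a power of \<open>lform a\<close>.\<close>
  have lin: "\<exists>N. lform a ^ N \<in> K" for a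
  proof -
    define c where "c V = dot4 a (p V) ^ D / eval4 u (p V)" for V
    have f1: "form_of_degree D (lform a ^ D - cst (c V) * u)" for V
    proof -
      have "form_of_degree (0 + D) (cst (- c V) * u)"
        by (rule form_mult[OF form_const]) (use u(1) in \<open>simp only: D_def\<close>)
      from form_add[OF form_power[OF form_lform] this[simplified], of a]
      have "form_of_degree D (lform a ^ D + cst (- c V) * u)" .
      moreover have "cst (- c V) * u = - (cst (c V) * u)" by (simp add: single_uminus)
      ultimately show ?thesis by simp
    qed
    have f2: "eval4 (lform a ^ D - cst (c V) * u) (p V) = 0" if "V \<in> \<V>" for V
      using bspec[OF u(2) that] by (simp add: eval4.hom_minus eval4.hom_mult eval4.hom_power c_def)
    have "\<exists>g. (lform a ^ D - cst (c V) * u) - lform h * g \<in> van V" if V: "V \<in> \<V>" for V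
    proof (rule form_vanishing_at_point[OF f1 f2[OF V]])
      show "v = dot4 (e V) v *s p V + dot4 h v *s q V" if "v \<in> V" for v by (rule coords[OF V that])
    qed blast
    then obtain g where g: "\<And>V. V \<in> \<V> \<Longrightarrow> (lform a ^ D - cst (c V) * u) - lform h * g V \<in> van V" by metis
    define A B C where "A = (\<Prod>V\<in>\<V>. lform a ^ D)" and "B = (\<Prod>V\<in>\<V>. lform a ^ D - cst (c V) * u)"
      and "C = (\<Prod>V\<in>\<V>. (lform a ^ D - cst (c V) * u) - lform h * g V)"
    have "u dvd A - B" unfolding A_def B_def by (rule dvd_diff_prod) simp
    then obtain a' where a': "A - B = u * a'" by (rule dvdE)
    have "lform h dvd B - C" unfolding B_def C_def by (rule dvd_diff_prod) simp
    then obtain b' where b': "B - C = lform h * b'" by (rule dvdE)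
    have "C \<in> van V" if "V \<in> \<V>" for V unfolding C_def by (rule prod_van_in[OF fin that]) (rule g[OF that])
    then have "C \<in> I" unfolding I_iff by blast
    moreover have "C = A - a' * u - b' * lform h" using a' b' by (simp add: algebra_simps)
    ultimately have "A \<in> K" unfolding Kmem by blast
    moreover have "A = lform a ^ (D * card \<V>)" by (simp add: A_def power_mult)
    ultimately show ?thesis by auto
  qed
  have uG: "u * G \<in> plus_gen I (lform h)" using u(3) G by blast
  have KG: "f * G \<in> plus_gen I (lform h)" if "f \<in> K" for f
  proof -
    obtain a b where ab: "f - a * u - b * lform h \<in> I" using \<open>f \<in> K\<close> unfolding Kmem by blast
    obtain d where d: "u * G - d * lform h \<in> I" using uG unfolding plus by blast
    have "(f - a * u - b * lform h) * G + a * (u * G - d * lform h) \<in> I"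
      by (rule Icl(2)[OF Icl(4)[OF ab] Icl(3)[OF d]])
    also have "(f - a * u - b * lform h) * G + a * (u * G - d * lform h) = f * G - (b * G + a * d) * lform h"
      by (simp add: algebra_simps)
    finally show ?thesis unfolding plus by blast
  qed
  obtain n where n: "x1 ^ n \<in> K" using power_in_ideal[OF K lin x(1)] by blast
  obtain m where m: "x2 ^ m \<in> K" using power_in_ideal[OF K lin x(2)] by blast
  have "G \<in> plus_gen I (lform h)"
    by (rule exchange_regular[OF ideal_van x(3)[rule_format] x(4)[rule_format] h_regular KG[OF n] KG[OF m]])
  then obtain g where g: "G - g * lform h \<in> I" unfolding plus by blast
  define f where "f = G - g * lform h"
  have "hcomp t f \<in> I"
    by (rule hcomp_van) (use g cone in \<open>auto simp: f_def\<close>)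
  then have "hcomp t f = 0" using form_hcomp by (rule no)
  moreover have "eval4 f (c *s v) = c ^ t * eval4 G v" for c
    using v by (simp add: f_def eval4.hom_minus eval4.hom_mult eval4_scale[OF G(1)])
  then have "eval4 (hcomp t f) v = (if t = t then eval4 G v else 0)" by (rule eval4_hcomp)
  ultimately show ?thesis by simp
qed

end

section \<open>Coplanar lines and pseudostars\<close>

lemma subspace_ker: "vec.subspace {v. dot4 h v = 0}"
  by (rule vec.subspaceI) (simp_all only: mem_Collect_eq dot4_simps add_0 mult_zero_right)

lemma separating_functional:
  fixes x :: "'k::field ^ 4"
  assumes U: "vec.subspace U" and x: "x \<notin> U"
  obtains h where "\<forall>u\<in>U. dot4 h u = 0" "dot4 h x = 1"
proof -
  obtain B where B: "B \<subseteq> U" "vec.independent B" "U \<subseteq> vec.span B"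
    by (rule vec.basis_exists[of U])
  have "vec.span B \<subseteq> U" by (rule vec.span_minimal[OF B(1) U])
  then have xB: "x \<notin> vec.span B" using x by blast
  then have xB': "x \<notin> B" using vec.span_base by blast
  have ind: "vec.independent (insert x B)" by (rule vec.independent_insertI[OF xB B(2)])
  \<comment> \<open>The functional is the first coordinate of a linear endomorphism that kills a
    basis of \<open>U\<close> and sends \<open>x\<close> to the first coordinate vector.\<close>
  let ?g0 = "\<lambda>y. if y = x then axis (1 :: 4) 1 else (0 :: 'k ^ 4)"
  have "\<exists>g. Vector_Spaces.linear (*s) (*s) g \<and> (\<forall>y\<in>insert x B. g y = ?g0 y)"
    by (rule vec.linear_independent_extend[OF ind])
  then obtain g where "Vector_Spaces.linear (*s) (*s) g \<and> (\<forall>y\<in>insert x B. g y = ?g0 y)" by (rule exE)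
  note g = conjunct1[OF this] conjunct2[OF this]
  define h :: "'k ^ 4" where "h = (\<chi> i. g (axis i 1) $ 1)"
  have h: "dot4 h v = g v $ 1" for v
  proof -
    have "g v $ 1 = (\<Sum>i\<in>UNIV. v $ i * (g (axis i 1) $ 1))" by (rule Cartesian_Space.linear_componentwise[OF g(1)])
    then show ?thesis by (simp add: dot4_def h_def mult.commute)
  qed
  have "B \<subseteq> {v. dot4 h v = 0}" using g(2) xB' by (auto simp: h)
  then have "vec.span B \<subseteq> {v. dot4 h v = 0}" by (rule vec.span_minimal[OF _ subspace_ker])
  then have "\<forall>u\<in>U. dot4 h u = 0" using B(3) by blast
  moreover have "dot4 h x = 1" using g(2) by (simp add: h)
  ultimately show ?thesis by (rule that)
qed

lemma dim_UNIV4: "vec.dim (UNIV :: ('k::field ^ 4) set) = 4"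
  using vec.dim_UNIV card_cart_basis[where 'a = 'k and 'i = 4] by simp

lemma dim_le4: "vec.dim (S :: ('k::field ^ 4) set) \<le> 4"
proof -
  have "vec.dim S \<le> vec.dim (UNIV :: ('k ^ 4) set)" by (rule vec.dim_subset) simp
  then show ?thesis unfolding dim_UNIV4 .
qed

lemma dim_ker:
  assumes "dot4 h x \<noteq> 0"
  shows "vec.dim {v. dot4 h v = 0} = 3"
proof -
  let ?K = "{v. dot4 h v = 0}"
  have sp: "vec.span ?K = ?K" by (simp add: subspace_ker vec.span_eq_iff)
  have "v \<in> vec.span (insert x ?K)" for v
  proof -
    have "dot4 h (v - (dot4 h v / dot4 h x) *s x) = 0" using assms by simp
    then have "v - (dot4 h v / dot4 h x) *s x \<in> vec.span ?K" unfolding sp by blast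
    then show ?thesis unfolding vec.span_breakdown_eq by blast
  qed
  then have "vec.span (insert x ?K) = UNIV" by blast
  then have "vec.dim (vec.span (insert x ?K)) = 4" using dim_UNIV4 by (simp only:)
  then have "vec.dim (insert x ?K) = 4" unfolding vec.dim_span .
  moreover have "x \<notin> vec.span ?K" using assms by (simp add: sp)
  ultimately show ?thesis by (simp add: vec.dim_insert split: if_splits)
qed

lemma plane_ker:
  fixes W :: "('k::field ^ 4) set"
  assumes W: "vec.subspace W" "vec.dim W = 3"
  obtains h x where "W = {v. dot4 h v = 0}" "dot4 h x = 1"
proof -
  have "W \<noteq> UNIV"
  proof
    assume "W = UNIV"
    then have "vec.dim W = 4" using dim_UNIV4[where 'k='k] by (simp only:)
    with W(2) show False by simp
  qed
  then obtain x where x: "x \<notin> W" by blast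
  obtain h where h: "\<forall>u\<in>W. dot4 h u = 0" "dot4 h x = 1" by (rule separating_functional[OF W(1) x])
  have "W = {v. dot4 h v = 0}"
    by (rule vec.subspace_dim_equal[OF W(1) subspace_ker]) (use h W(2) dim_ker[of h x] in auto)
  then show ?thesis using h(2) by (rule that)
qed

lemma dim_plane_Int:
  fixes U W :: "('k::field ^ 4) set"
  assumes U: "vec.subspace U" "vec.dim U = 3" and W: "vec.subspace W" "vec.dim W = 3" and "U \<noteq> W"
  shows "vec.dim (U \<inter> W) = 2"
proof -
  have "vec.dim {x + y |x y. x \<in> U \<and> y \<in> W} + vec.dim (U \<inter> W) = 6"
    using vec.dim_sums_Int[OF U(1) W(1)] U(2) W(2) by simp
  moreover have "vec.dim {x + y |x y. x \<in> U \<and> y \<in> W} \<le> 4"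
    by (rule dim_le4)
  moreover have "vec.dim (U \<inter> W) < 3"
  proof (rule ccontr)
    assume n: "\<not> ?thesis"
    have s: "vec.subspace (U \<inter> W)" using U(1) W(1) by (rule vec.subspace_inter)
    have "U \<inter> W = U" by (rule vec.subspace_dim_equal[OF s U(1)]) (use n U(2) in auto)
    moreover have "U \<inter> W = W" by (rule vec.subspace_dim_equal[OF s W(1)]) (use n W(2) in auto)
    ultimately show False using \<open>U \<noteq> W\<close> by simp
  qed
  ultimately show ?thesis by linarith
qed

lemma in_span_singleton: "x \<in> vec.span {a} \<longleftrightarrow> (\<exists>k. x = k *s a)"
  by (auto simp: vec.span_singleton)

lemma in_span_pair: "x \<in> vec.span {a, b} \<longleftrightarrow> (\<exists>k m. x = k *s a + m *s b)"
  unfolding vec.span_breakdown_eq[of x a] in_span_singleton by (simp add: algebra_simps)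

lemma span_pair_eq:
  fixes V :: "('k::field ^ 4) set"
  assumes V: "vec.subspace V" "vec.dim V = 2" and a: "a \<in> V" "a \<noteq> 0" and b: "b \<in> V" "b \<notin> vec.span {a}"
  shows "V = vec.span {b, a}"
proof -
  have "vec.independent {a}" using a(2) vec.dependent_single[of a] by simp
  then have ind: "vec.independent {b, a}" by (rule vec.independent_insertI[OF b(2)])
  have "a \<noteq> b" using b(2) vec.span_base[of b "{b}"] by auto
  then have "card {b, a} = vec.dim V" using V(2) by auto
  then have "V \<subseteq> vec.span {b, a}" using vec.card_eq_dim[of "{b, a}" V] a b ind by auto
  moreover have "vec.span {b, a} \<subseteq> V" by (rule vec.span_minimal) (use a b V in auto)
  ultimately show ?thesis by blast
qed

lemma plane_basis:
  fixes V :: "('k::field ^ 4) set"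
  assumes V: "vec.subspace V" "vec.dim V = 2"
  obtains a b where "a \<in> V" "b \<in> V" "a \<noteq> 0" "b \<noteq> 0" "b \<notin> vec.span {a}" "a \<notin> vec.span {b}"
proof -
  obtain B where B: "B \<subseteq> V" "vec.independent B" "V \<subseteq> vec.span B" "card B = 2"
    by (rule vec.basis_exists[of V]) (simp only: V(2))
  obtain a b where ab: "B = {a, b}" "a \<noteq> b" using B(4) by (meson card_2_iff)
  have "vec.independent {a, b}" "vec.independent {b, a}" using B(2) ab(1) by (simp_all add: insert_commute)
  then have "a \<notin> vec.span {b}" "b \<notin> vec.span {a}" using ab(2) by (simp_all add: vec.independent_insert)
  moreover have "a \<noteq> 0" using calculation(1) vec.span_zero[of "{b}"] by auto
  moreover have "b \<noteq> 0" using calculation(2) vec.span_zero[of "{a}"] by auto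
  moreover have "a \<in> V" "b \<in> V" using B(1) ab(1) by auto
  ultimately show ?thesis using that[of a b] by simp
qed

lemma nonzero_if_dim:
  assumes "vec.dim V \<noteq> 0"
  obtains v where "v \<in> V" "v \<noteq> (0 :: 'k::field ^ 4)"
  using assms unfolding vec.dim_eq_0 by blast

text \<open>A subspace is recovered from its projective points. The zero space has none, so its
  union would be empty and would miss the vector 0.\<close>

lemma Union_linear_locus:
  fixes V :: "('k::field ^ 4) set"
  assumes "vec.subspace V" "vec.dim V \<noteq> 0"
  shows "\<Union>(linear_locus V) = V"
proof
  show "\<Union>(linear_locus V) \<subseteq> V" by (auto simp: linear_locus_def)
  have *: "v \<in> \<Union>(linear_locus V)" if v: "v \<in> V" "v \<noteq> 0" for v
  proof
    show "v \<in> vec.span {v}" by (rule vec.span_base) simp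
    have "vec.span {v} \<subseteq> V" by (rule vec.span_minimal) (use v assms in auto)
    moreover have "vec.dim (vec.span {v}) = 1" using v(2) by simp
    ultimately show "vec.span {v} \<in> linear_locus V" by (simp add: linear_locus_def vec.subspace_span)
  qed
  obtain v0 where v0: "v0 \<in> V" "v0 \<noteq> 0" using nonzero_if_dim[OF assms(2)] by blast
  obtain p where p: "p \<in> linear_locus V" "v0 \<in> p" using *[OF v0] by blast
  have "0 \<in> p" using p(1) by (auto simp: linear_locus_def vec.subspace_0)
  then have "0 \<in> \<Union>(linear_locus V)" using p(1) by blast
  with * show "V \<subseteq> \<Union>(linear_locus V)" by blast
qed

lemma linear_locus_mono_iff:
  fixes U V :: "('k::field ^ 4) set"
  assumes "vec.subspace U" "vec.dim U \<noteq> 0"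
  shows "linear_locus U \<subseteq> linear_locus V \<longleftrightarrow> U \<subseteq> V"
proof
  assume "linear_locus U \<subseteq> linear_locus V"
  then have "\<Union>(linear_locus U) \<subseteq> \<Union>(linear_locus V)" by blast
  moreover have "\<Union>(linear_locus V) \<subseteq> V" by (auto simp: linear_locus_def)
  ultimately show "U \<subseteq> V" unfolding Union_linear_locus[OF assms] by blast
qed (auto simp: linear_locus_def)

lemma linear_locus_Int: "linear_locus U \<inter> linear_locus V = linear_locus (U \<inter> V)"
  by (auto simp: linear_locus_def)

definition line_spaces :: "('k::field ^ 4) set set \<Rightarrow> bool" where
  "line_spaces \<V> \<longleftrightarrow> finite \<V> \<and> (\<forall>V\<in>\<V>. vec.subspace V \<and> vec.dim V = 2)"

lemma line_spacesD:
  assumes "line_spaces \<V>"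
  shows "finite \<V>" "V \<in> \<V> \<Longrightarrow> vec.subspace V" "V \<in> \<V> \<Longrightarrow> vec.dim V = 2" "V \<in> \<V> \<Longrightarrow> 0 \<in> V"
  using assms vec.subspace_0 unfolding line_spaces_def by blast+

lemma line_family_line_spaces:
  fixes \<V> :: "('k::alg_closed_field ^ 4) set set"
  assumes \<V>: "line_spaces \<V>"
  shows "line_family \<V>"
proof
  note D = line_spacesD[OF \<V>]
  show "finite \<V>" by (rule D(1))
  show "line_closed V" if "V \<in> \<V>" for V using D(2)[OF that] by (rule line_closed_subspace)
  show "V \<noteq> {}" if "V \<in> \<V>" for V using D(4)[OF that] by blast
  fix U V assume UV: "U \<in> \<V>" "V \<in> \<V>" "U \<noteq> V"
  have "\<not> V \<subseteq> U"
    using vec.subspace_dim_equal[OF D(2)[OF UV(2)] D(2)[OF UV(1)]] D(3)[OF UV(1)] D(3)[OF UV(2)] UV(3) by auto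
  then obtain x where x: "x \<in> V" "x \<notin> U" by blast
  obtain h where h: "\<forall>u\<in>U. dot4 h u = 0" "dot4 h x = 1" by (rule separating_functional[OF D(2)[OF UV(1)] x(2)])
  have "lform h \<in> van U" "lform h \<notin> van V" using h x by (auto simp: van_def intro!: bexI[of _ x])
  then show "\<exists>f. f \<in> van U \<and> f \<notin> van V" by blast
qed

lemma vanishing_ideal_lines:
  fixes \<V> :: "('k::alg_closed_field ^ 4) set set"
  assumes "line_spaces \<V>"
  shows "vanishing_ideal (\<Union>V\<in>\<V>. linear_locus V) = van (\<Union>\<V>)"
proof -
  have "vanishing_ideal (\<Union>V\<in>\<V>. linear_locus V) = van (\<Union>(\<Union>V\<in>\<V>. linear_locus V))"
    by (rule vanishing_ideal_eq_van) (auto simp: linear_locus_def vec.subspace_scale)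
  also have "\<Union>(\<Union>V\<in>\<V>. linear_locus V) = (\<Union>V\<in>\<V>. \<Union>(linear_locus V))" by blast
  also have "\<dots> = (\<Union>V\<in>\<V>. V)"
  proof (rule SUP_cong[OF refl])
    fix V assume V: "V \<in> \<V>"
    show "\<Union>(linear_locus V) = V"
      by (rule Union_linear_locus) (simp_all only: line_spacesD(2,3)[OF assms V])
  qed
  also have "\<dots> = \<Union>\<V>" by simp
  finally show ?thesis .
qed

section \<open>The type of coplanar lines\<close>

lemma alpha_eqI:
  assumes "f \<in> J" "f \<noteq> 0" "form_of_degree t f"
    and "\<And>g s. g \<in> J \<Longrightarrow> g \<noteq> 0 \<Longrightarrow> form_of_degree s g \<Longrightarrow> t \<le> s"
  shows "alpha J = t"
  unfolding alpha_def by (rule Least_equality) (use assms in auto)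

lemma alpha_attained:
  assumes "f \<in> J" "f \<noteq> 0" "form_of_degree t f"
  obtains g where "g \<in> J" "g \<noteq> 0" "form_of_degree (alpha J) g"
  using LeastI[of "\<lambda>t. \<exists>f\<in>J. f \<noteq> 0 \<and> form_of_degree t f" t] assms unfolding alpha_def by blast

lemma alpha_le:
  assumes "f \<in> J" "f \<noteq> 0" "form_of_degree t f"
  shows "alpha J \<le> t"
  unfolding alpha_def by (rule Least_le) (use assms in blast)

lemma eval4_form_0:
  fixes f :: "'k::alg_closed_field poly4"
  assumes "form_of_degree 0 f" "eval4 f 0 = 0"
  shows "f = 0"
proof (rule zero_if_eval4_zero)
  fix v
  have "eval4 f (0 *s v) = 0 ^ 0 * eval4 f v" by (rule eval4_scale[OF assms(1)])
  then show "eval4 f v = 0" using assms(2) by simp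
qed

lemma lineres_lform: "lineres p v (lform g) = [:dot4 g p, dot4 g (v :: 'k::alg_closed_field ^ 4):]"
proof -
  have "lineres p v (lform g) - [:dot4 g p, dot4 g v:] = 0"
    by (rule poly_0_if_vanishing) (simp add: poly_lineres)
  then show ?thesis by simp
qed

lemma lform_ne_0: "dot4 g (v :: 'a::field ^ 4) \<noteq> 0 \<Longrightarrow> lform g \<noteq> 0"
proof
  assume "dot4 g v \<noteq> 0" "lform g = 0"
  moreover have "eval4 (0 :: 'a poly4) v = 0" by (rule eval4.hom_zero)
  ultimately show False using eval4_lform[of g v] by simp
qed

lemma no_double_linear_form:
  fixes f :: "'k::alg_closed_field poly4"
  assumes "form_of_degree 1 f" "dbl f p"
  shows "f = 0"
proof -
  obtain g where g: "f = lform g" by (rule linear_form_lform[OF assms(1)])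
  show ?thesis
  proof (rule zero_if_eval4_zero)
    fix v
    have "poly (pderiv (lineres p v f)) 0 = 0" using assms(2) by (simp add: dbl_def)
    then show "eval4 f v = 0" by (simp add: g lineres_lform pderiv_pCons)
  qed
qed

lemma dbl_vanish: "dbl f p \<Longrightarrow> eval4 f p = 0"
  using poly_lineres[of p 0 f 0] by (auto simp: dbl_def)

text \<open>\<open>lform h\<close> and its square attain the degrees 1 and 2. The lower bounds are
  read off at the vertex 0 of the cones: a nonzero constant does not vanish there, and a nonzero
  linear form is not double there.\<close>

theorem coplanar_has_type:
  fixes \<V> :: "('k::alg_closed_field ^ 4) set set"
  assumes \<V>: "line_spaces \<V>" "\<V> \<noteq> {}" and h: "\<And>V v. V \<in> \<V> \<Longrightarrow> v \<in> V \<Longrightarrow> dot4 h v = 0" and x: "dot4 h x \<noteq> 0"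
  shows "has_type (\<Union>V\<in>\<V>. linear_locus V) 1 2"
proof -
  interpret line_family \<V> by (rule line_family_line_spaces[OF \<V>(1)])
  obtain V where V: "V \<in> \<V>" using \<V>(2) by blast
  have V0: "0 \<in> V" using line_spacesD[OF \<V>(1)] V by blast
  have hI: "lform h \<in> I" using h by (auto simp: van_def)
  have "alpha I = 1"
  proof (rule alpha_eqI[OF hI lform_ne_0[OF x] form_lform])
    fix g s assume g: "g \<in> I" "g \<noteq> 0" "form_of_degree s g"
    have "eval4 g 0 = 0" using g(1) V V0 by (auto simp: van_def)
    then have "s \<noteq> 0" using eval4_form_0[of g] g(2,3) by (cases "s = 0") simp_all
    then show "1 \<le> s" by simp
  qed
  moreover have "alpha (symbolic_power I 2) = 2"
  proof (rule alpha_eqI)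
    have "1 \<notin> van V" if "V \<in> \<V>" for V using ne[OF that] by (auto simp: van_def)
    moreover have "(lform h)\<^sup>2 * 1 \<in> I2" using I2_mult[OF hI hI] by (simp add: power2_eq_square)
    ultimately show "(lform h)\<^sup>2 \<in> symbolic_power I 2" unfolding symbolic_iff by blast
    show "(lform h)\<^sup>2 \<noteq> 0" using lform_ne_0[OF x] by simp
    show "form_of_degree 2 ((lform h)\<^sup>2)" by (rule form_power[OF form_lform])
    fix g s assume g: "g \<in> symbolic_power I 2" "g \<noteq> 0" "form_of_degree s g"
    have dbl: "dbl g 0" by (rule dbl_symbolic[OF g(1) V V0])
    have "s \<noteq> 0" using eval4_form_0[of g] g(2,3) dbl_vanish[OF dbl] by (cases "s = 0") simp_all
    moreover have "s \<noteq> 1" using no_double_linear_form[OF _ dbl] g(2,3) by (cases "s = 1") simp_all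
    ultimately show "2 \<le> s" by linarith
  qed
  ultimately show ?thesis unfolding has_type_def vanishing_ideal_lines[OF \<V>(1)] by simp
qed

text \<open>At a root \<open>a\<close> of p = (x - a) r the derivative has the value r(a). So a
  common root of \<open>p\<close> and \<open>pderiv p\<close> splits off the square of x - a in
  every characteristic.\<close>

lemma card_double_roots:
  fixes p :: "'a::field poly"
  assumes "finite A" "p \<noteq> 0" "\<And>x. x \<in> A \<Longrightarrow> poly p x = 0" "\<And>x. x \<in> A \<Longrightarrow> poly (pderiv p) x = 0"
  shows "2 * card A \<le> degree p"
  using assms
proof (induction A arbitrary: p rule: finite_induct)
  case (insert a A)
  have "poly p a = 0" using insert.prems(2) by simp
  then obtain r where r: "p = [:- a, 1:] * r" unfolding poly_eq_0_iff_dvd by (rule dvdE)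
  have "poly (pderiv p) a = poly r a" unfolding r pderiv_mult by (simp add: pderiv_pCons)
  then have "poly r a = 0" using insert.prems(3) by simp
  then obtain t where t: "r = [:- a, 1:] * t" unfolding poly_eq_0_iff_dvd by (rule dvdE)
  have p: "p = [:- a, 1:] * ([:- a, 1:] * t)" by (simp only: r t)
  have t0: "t \<noteq> 0" using insert.prems(1) p by auto
  have tz: "poly t x = 0" if x: "x \<in> A" for x
  proof -
    have "x \<noteq> a" using x insert.hyps(2) by blast
    moreover have "poly p x = (x - a) * ((x - a) * poly t x)" unfolding p poly_mult by simp
    then have "(x - a) * ((x - a) * poly t x) = 0" using insert.prems(2)[of x] x by simp
    ultimately show ?thesis by simp
  qed
  have "poly (pderiv t) x = 0" if x: "x \<in> A" for x
  proof -
    have "x \<noteq> a" using x insert.hyps(2) by blast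
    have "poly (pderiv p) x = (x - a) * ((x - a) * poly (pderiv t) x)"
      unfolding p pderiv_mult poly_add poly_mult tz[OF x] by (simp add: pderiv_pCons)
    then show ?thesis using insert.prems(3)[of x] x \<open>x \<noteq> a\<close> by simp
  qed
  then have "2 * card A \<le> degree t" using insert.IH[OF t0 tz] by blast
  moreover have "degree p = degree t + 2" unfolding p using t0 by (simp add: degree_mult_eq del: mult_pCons_left)
  ultimately show ?case using insert.hyps by simp
qed simp

text \<open>A general line through \<open>q\<close> in \<open>V\<close> meets the zero loci of the \<open>g j\<close> in distinct points.\<close>
lemma transversal_line:
  fixes V :: "('k::alg_closed_field ^ 4) set" and g :: "nat \<Rightarrow> 'k ^ 4"
  assumes V: "vec.subspace V" and q: "q \<in> V" and fin: "finite A"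
    and nz: "\<And>j. j \<in> A \<Longrightarrow> \<exists>v\<in>V. dot4 (g j) v \<noteq> 0"
    and ind: "\<And>j k. j \<in> A \<Longrightarrow> k \<in> A \<Longrightarrow> j \<noteq> k \<Longrightarrow> \<exists>v\<in>V. dot4 (g j) q * dot4 (g k) v - dot4 (g k) q * dot4 (g j) v \<noteq> 0"
  obtains v S where "finite S" "card S = card A" "\<forall>s\<in>S. q + s *s v \<in> V \<and> (\<exists>j\<in>A. dot4 (g j) (q + s *s v) = 0)"
proof -
  \<comment> \<open>A nonzero diagonal entry makes the line through \<open>q\<close> with direction
    \<open>v\<close> meet the zero locus of \<open>g j\<close> in one point. A nonzero off-diagonal
    entry says that the points for \<open>j\<close> and \<open>k\<close> are distinct.\<close>
  define F where "F = (\<lambda>(j, k) v. if j = k then dot4 (g j) v else dot4 (g j) q * dot4 (g k) v - dot4 (g k) q * dot4 (g j) v)"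
  have "\<exists>v\<in>V. \<forall>i\<in>A \<times> A. F i v \<noteq> 0"
  proof (rule generic_point)
    show "finite (A \<times> A)" using fin by simp
    show "line_closed V" using V by (rule line_closed_subspace)
    show "V \<noteq> {}" using q by blast
    fix i assume i: "i \<in> A \<times> A"
    obtain j k where jk: "i = (j, k)" by (cases i)
    show "linepoly (F i)"
    proof (cases "j = k")
      case True
      then have "F i = (\<lambda>v. dot4 (g j) v)" by (simp add: F_def jk)
      then show ?thesis using linepoly_dot4(2) by simp
    next
      case False
      then have "F i = (\<lambda>v. dot4 (g j) q * dot4 (g k) v - dot4 (g k) q * dot4 (g j) v)" by (simp add: F_def jk)
      moreover have "linepoly (\<lambda>v. dot4 (g j) q * dot4 (g k) v - dot4 (g k) q * dot4 (g j) v)"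
        by (intro linepoly_diff linepoly_mult linepoly_const linepoly_dot4)
      ultimately show ?thesis by simp
    qed
    show "\<exists>v\<in>V. F i v \<noteq> 0"
    proof (cases "j = k")
      case True
      then show ?thesis using nz[of j] i by (simp add: F_def jk)
    next
      case False
      then show ?thesis using ind[of j k] i by (simp add: F_def jk)
    qed
  qed
  then obtain v where v: "v \<in> V" "\<And>i. i \<in> A \<times> A \<Longrightarrow> F i v \<noteq> 0" by blast
  have nz': "dot4 (g j) v \<noteq> 0" if "j \<in> A" for j using v(2)[of "(j, j)"] that by (simp add: F_def)
  define s where "s j = - dot4 (g j) q / dot4 (g j) v" for j
  have inj: "inj_on s A"
  proof (rule inj_onI)
    fix j k assume jk: "j \<in> A" "k \<in> A" "s j = s k"
    show "j = k"
    proof (rule ccontr)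
      assume "j \<noteq> k"
      then have "dot4 (g j) q * dot4 (g k) v - dot4 (g k) q * dot4 (g j) v \<noteq> 0"
        using v(2)[of "(j, k)"] jk by (simp add: F_def)
      then show False using jk(3) nz'[OF jk(1)] nz'[OF jk(2)] by (simp add: s_def field_simps)
    qed
  qed
  show ?thesis
  proof (rule that[of "s ` A" v])
    show "finite (s ` A)" using fin by simp
    show "card (s ` A) = card A" using inj by (rule card_image)
    have "q + s j *s v \<in> V" for j using V q v(1) by (intro vec.subspace_add vec.subspace_scale)
    moreover have "dot4 (g j) (q + s j *s v) = 0" if "j \<in> A" for j using nz'[OF that] by (simp add: s_def)
    ultimately show "\<forall>s\<in>s ` A. q + s *s v \<in> V \<and> (\<exists>j\<in>A. dot4 (g j) (q + s *s v) = 0)" by blast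
  qed
qed

section \<open>The type of a pseudostar\<close>

text \<open>\<open>two\<close> says that the planes are distinct, \<open>three\<close> that no plane
  contains the intersection line of two others. Both are given by witnesses, which is the form that
  \<open>transversal_line\<close> consumes.\<close>

locale star_planes =
  fixes n :: nat and h :: "nat \<Rightarrow> 'k::alg_closed_field ^ 4"
  assumes n: "n \<ge> 2" and h_nz: "\<And>i. i \<in> {1..n} \<Longrightarrow> \<exists>x. dot4 (h i) x \<noteq> 0"
    and three: "\<And>i j k. i \<in> {1..n} \<Longrightarrow> j \<in> {1..n} \<Longrightarrow> k \<in> {1..n} \<Longrightarrow> i \<noteq> j \<Longrightarrow> i \<noteq> k \<Longrightarrow> j \<noteq> k \<Longrightarrow>
      \<exists>x. dot4 (h i) x = 0 \<and> dot4 (h j) x = 0 \<and> dot4 (h k) x \<noteq> 0"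
    and two: "\<And>i j. i \<in> {1..n} \<Longrightarrow> j \<in> {1..n} \<Longrightarrow> i \<noteq> j \<Longrightarrow> \<exists>x. dot4 (h i) x = 0 \<and> dot4 (h j) x \<noteq> 0"
begin

definition W :: "nat \<Rightarrow> ('k ^ 4) set" where
  "W i = {v. dot4 (h i) v = 0}"

definition \<V> :: "('k ^ 4) set set" where
  "\<V> = {W i \<inter> W j | i j. 1 \<le> i \<and> i < j \<and> j \<le> n}"

lemma line_spaces_\<V>: "line_spaces \<V>"
  unfolding line_spaces_def
proof (intro conjI ballI)
  have "\<V> \<subseteq> (\<lambda>(i, j). W i \<inter> W j) ` ({1..n} \<times> {1..n})" unfolding \<V>_def by force
  then show "finite \<V>" by (rule finite_subset) simp
  fix V assume "V \<in> \<V>"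
  then obtain i j where ij: "1 \<le> i" "i < j" "j \<le> n" "V = W i \<inter> W j" by (auto simp: \<V>_def)
  have s: "vec.subspace (W k)" for k unfolding W_def by (rule subspace_ker)
  have d: "vec.dim (W k) = 3" if "k \<in> {1..n}" for k
    using h_nz[OF that] dim_ker unfolding W_def by blast
  show "vec.subspace V" using s ij(4) vec.subspace_inter by blast
  have "W i \<noteq> W j" using two[of i j] ij unfolding W_def by auto
  then show "vec.dim V = 2" using dim_plane_Int[OF s d s d, of i j] ij by simp
qed

lemma mem_\<V>: "i \<in> {1..n} \<Longrightarrow> j \<in> {1..n} \<Longrightarrow> i \<noteq> j \<Longrightarrow> W i \<inter> W j \<in> \<V>"
  unfolding \<V>_def by (cases "i < j") (auto, metis Int_commute linorder_neqE_nat)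

sublocale line_family \<V>
  by (rule line_family_line_spaces[OF line_spaces_\<V>])

text \<open>A point \<open>q\<close> with nonzero value lies on none of the planes, so a general
  line through it meets them in \<open>n\<close> distinct zeros, more than the degree.\<close>

lemma zero_if_zero_on_planes:
  assumes f: "form_of_degree t f" "t < n" and van: "\<And>i v. i \<in> {1..n} \<Longrightarrow> v \<in> W i \<Longrightarrow> eval4 f v = 0"
  shows "f = 0"
proof (rule zero_if_eval4_zero, rule ccontr)
  fix q assume q: "eval4 f q \<noteq> 0"
  have hq: "dot4 (h i) q \<noteq> 0" if "i \<in> {1..n}" for i using van[OF that, of q] q by (auto simp: W_def)
  obtain v S where S: "finite S" "card S = card {1..n}"
    "\<forall>s\<in>S. q + s *s v \<in> UNIV \<and> (\<exists>j\<in>{1..n}. dot4 (h j) (q + s *s v) = 0)"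
  proof (rule transversal_line[OF vec.subspace_UNIV UNIV_I, of "{1..n}" h q])
    fix j k assume jk: "j \<in> {1..n}" "k \<in> {1..n}" "j \<noteq> k"
    obtain x where x: "dot4 (h j) x = 0" "dot4 (h k) x \<noteq> 0" using two[OF jk] by blast
    then show "\<exists>v\<in>UNIV. dot4 (h j) q * dot4 (h k) v - dot4 (h k) q * dot4 (h j) v \<noteq> 0"
      using hq[OF jk(1)] by (intro bexI[of _ x]) auto
  qed (use h_nz in auto)
  have "poly (lineres q v f) s = 0" if "s \<in> S" for s
    using S(3) that van by (fastforce simp: poly_lineres W_def)
  then have sub: "S \<subseteq> {s. poly (lineres q v f) s = 0}" by blast
  have "lineres q v f = 0"
  proof (rule ccontr)
    assume nz: "lineres q v f \<noteq> 0"
    have "card S \<le> card {s. poly (lineres q v f) s = 0}" by (rule card_mono[OF poly_roots_finite[OF nz] sub])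
    also have "\<dots> \<le> degree (lineres q v f)" by (rule card_poly_roots_bound[OF nz])
    also have "\<dots> \<le> t" by (rule degree_lineres[OF f(1)])
    finally show False using f(2) S(2) by simp
  qed
  then have "eval4 f q = 0" using poly_lineres[of q v f 0] by simp
  with q show False ..
qed

text \<open>Inside \<open>W i\<close> the other planes cut out \<open>n - 1\<close> distinct lines
  of the configuration, and a general line through \<open>q\<close> in \<open>W i\<close> meets them
  in distinct points.\<close>

lemma plane_transversal:
  assumes i: "i \<in> {1..n}" and q: "q \<in> W i" "q \<notin> \<Union>\<V>"
  obtains v S where "finite S" "card S = n - 1" "\<forall>s\<in>S. \<exists>V\<in>\<V>. q + s *s v \<in> V"
proof -
  have hq: "dot4 (h j) q \<noteq> 0" if "j \<in> {1..n} - {i}" for j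
  proof
    assume "dot4 (h j) q = 0"
    then have "q \<in> W i \<inter> W j" using q(1) by (simp add: W_def)
    then show False using mem_\<V>[OF i, of j] that q(2) by blast
  qed
  obtain v S where S: "finite S" "card S = card ({1..n} - {i})"
    "\<forall>s\<in>S. q + s *s v \<in> W i \<and> (\<exists>j\<in>{1..n} - {i}. dot4 (h j) (q + s *s v) = 0)"
  proof (rule transversal_line[of "W i" q "{1..n} - {i}" h])
    show "vec.subspace (W i)" unfolding W_def by (rule subspace_ker)
    show "\<exists>v\<in>W i. dot4 (h j) v \<noteq> 0" if "j \<in> {1..n} - {i}" for j
      using two[OF i, of j] that by (auto simp: W_def)
    fix j k assume jk: "j \<in> {1..n} - {i}" "k \<in> {1..n} - {i}" "j \<noteq> k"
    obtain x where "dot4 (h i) x = 0" "dot4 (h j) x = 0" "dot4 (h k) x \<noteq> 0" using three[OF i, of j k] jk by auto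
    then show "\<exists>v\<in>W i. dot4 (h j) q * dot4 (h k) v - dot4 (h k) q * dot4 (h j) v \<noteq> 0"
      using hq[OF jk(1)] by (intro bexI[of _ x]) (auto simp: W_def)
  qed (use q in auto)
  have all: "\<exists>V\<in>\<V>. q + s *s v \<in> V" if s: "s \<in> S" for s
  proof -
    obtain j where j: "j \<in> {1..n} - {i}" "dot4 (h j) (q + s *s v) = 0" using S(3) s by blast
    have "q + s *s v \<in> W i \<inter> W j" using S(3) s j(2) by (simp add: W_def)
    moreover have "W i \<inter> W j \<in> \<V>" using mem_\<V>[OF i, of j] j(1) by blast
    ultimately show ?thesis by blast
  qed
  have "card S = n - 1" using S(2) i by simp
  then show ?thesis by (rule that[OF S(1)]) (rule ballI, rule all)
qed

text \<open>Every line lies in two of the planes, so the product of all linear forms but one still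
  vanishes on it and the product of all is double there. For the lower bounds a form of smaller
  degree is shown to vanish on each plane and is then zero by
  \<open>zero_if_zero_on_planes\<close>.\<close>

theorem star_has_type: "has_type (\<Union>V\<in>\<V>. linear_locus V) (n - 1) n"
proof -
  have h0: "lform (h i) \<noteq> 0" if "i \<in> {1..n}" for i using h_nz[OF that] lform_ne_0 by blast
  have h_van: "lform (h i) \<in> van (W i \<inter> W j)" "lform (h j) \<in> van (W i \<inter> W j)" for i j by (auto simp: van_def W_def)
  have prodI: "(\<Prod>k\<in>{1..n} - {l}. lform (h k)) \<in> I" for l
    unfolding I_iff
  proof
    fix V assume "V \<in> \<V>"
    then obtain i j where ij: "1 \<le> i" "i < j" "j \<le> n" "V = W i \<inter> W j" by (auto simp: \<V>_def)
    show "(\<Prod>k\<in>{1..n} - {l}. lform (h k)) \<in> van V"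
    proof (cases "i = l")
      case True
      then show ?thesis unfolding ij(4) by (intro prod_van_in[of _ j] h_van) (use ij in auto)
    next
      case False
      then show ?thesis unfolding ij(4) by (intro prod_van_in[of _ i] h_van) (use ij in auto)
    qed
  qed
  have "alpha I = n - 1"
  proof (rule alpha_eqI)
    show "(\<Prod>k\<in>{1..n} - {1}. lform (h k)) \<in> I" by (rule prodI)
    show "(\<Prod>k\<in>{1..n} - {1}. lform (h k)) \<noteq> 0" using h0 by simp
    have "form_of_degree (card ({1..n} - {1})) (\<Prod>k\<in>{1..n} - {1}. lform (h k))"
      by (rule form_prod) (use form_lform in auto)
    then show "form_of_degree (n - 1) (\<Prod>k\<in>{1..n} - {1}. lform (h k))" using n by simp
    fix f s assume f: "f \<in> I" "f \<noteq> 0" "form_of_degree s f"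
    show "n - 1 \<le> s"
    proof (rule ccontr)
      assume less: "\<not> n - 1 \<le> s"
      have "eval4 f q = 0" if iq: "i \<in> {1..n}" "q \<in> W i" for i q
      proof (cases "q \<in> \<Union>\<V>")
        case True
        then show ?thesis using f(1) by (auto simp: van_def)
      next
        case False
        obtain v S where S: "finite S" "card S = n - 1" "\<forall>s\<in>S. \<exists>V\<in>\<V>. q + s *s v \<in> V"
          by (rule plane_transversal[OF iq False])
        have sub: "S \<subseteq> {s. poly (lineres q v f) s = 0}"
          using S(3) f(1) by (fastforce simp: poly_lineres van_def)
        have "lineres q v f = 0"
        proof (rule ccontr)
          assume nz: "lineres q v f \<noteq> 0"
          have "card S \<le> card {s. poly (lineres q v f) s = 0}" by (rule card_mono[OF poly_roots_finite[OF nz] sub])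
          also have "\<dots> \<le> degree (lineres q v f)" by (rule card_poly_roots_bound[OF nz])
          also have "\<dots> \<le> s" by (rule degree_lineres[OF f(3)])
          finally show False using less S(2) by simp
        qed
        then show ?thesis using poly_lineres[of q v f 0] by simp
      qed
      then have "f = 0" using zero_if_zero_on_planes[OF f(3)] less by auto
      with f(2) show False ..
    qed
  qed
  moreover have "alpha (symbolic_power I 2) = n"
  proof (rule alpha_eqI)
    define F where "F = (\<Prod>k\<in>{1..n}. lform (h k))"
    show "F \<noteq> 0" using h0 by (simp add: F_def)
    have "form_of_degree (card {1..n}) F" unfolding F_def by (rule form_prod) (use form_lform in auto)
    then show "form_of_degree n F" by simp
    show "F \<in> symbolic_power I 2"
      unfolding symbolic_iff
    proof
      fix V assume V: "V \<in> \<V>"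
      then obtain i j where ij: "1 \<le> i" "i < j" "j \<le> n" "V = W i \<inter> W j" by (auto simp: \<V>_def)
      \<comment> \<open>Multiplied by \<open>Q\<close>, the full product becomes the product of two
        members of \<open>I\<close>, those omitting \<open>j\<close> and \<open>i\<close>; and
        \<open>Q\<close> is nonzero on the line by \<open>three\<close>.\<close>
      define Q where "Q = (\<Prod>k\<in>{1..n} - {i, j}. lform (h k))"
      have "Q \<notin> van V" unfolding Q_def
      proof (rule prod_van_notin[OF closed[OF V] ne[OF V]])
        fix k assume k: "k \<in> {1..n} - {i, j}"
        obtain x where "dot4 (h i) x = 0" "dot4 (h j) x = 0" "dot4 (h k) x \<noteq> 0" using three[of i j k] ij k by auto
        then show "lform (h k) \<notin> van V" unfolding ij(4) by (auto simp: van_def W_def)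
      qed simp
      moreover have "F * Q \<in> I2"
      proof -
        have r1: "(\<Prod>k\<in>{1..n} - {j}. lform (h k)) = lform (h i) * Q"
          unfolding Q_def using ij by (subst prod.remove[of _ i]) (auto simp: Diff_insert2[symmetric] insert_commute)
        have r2: "(\<Prod>k\<in>{1..n} - {i}. lform (h k)) = lform (h j) * Q"
          unfolding Q_def using ij by (subst prod.remove[of _ j]) (auto simp: Diff_insert2[symmetric] insert_commute)
        have r3: "F = lform (h i) * (\<Prod>k\<in>{1..n} - {i}. lform (h k))"
          unfolding F_def using ij by (subst prod.remove[of _ i]) auto
        have "F * Q = (\<Prod>k\<in>{1..n} - {j}. lform (h k)) * (\<Prod>k\<in>{1..n} - {i}. lform (h k))"
          unfolding r3 r1 r2 by (simp add: mult_ac)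
        then show ?thesis using I2_mult[OF prodI[of j] prodI[of i]] by simp
      qed
      ultimately show "\<exists>s. s \<notin> van V \<and> F * s \<in> I2" by blast
    qed
    fix f s assume f: "f \<in> symbolic_power I 2" "f \<noteq> 0" "form_of_degree s f"
    show "n \<le> s"
    proof (rule ccontr)
      assume less: "\<not> n \<le> s"
      have "eval4 f q = 0" if iq: "i \<in> {1..n}" "q \<in> W i" for i q
      proof (cases "q \<in> \<Union>\<V>")
        case True
        then show ?thesis using dbl_symbolic[OF f(1)] dbl_vanish by blast
      next
        case False
        obtain v S where S: "finite S" "card S = n - 1" "\<forall>s\<in>S. \<exists>V\<in>\<V>. q + s *s v \<in> V"
          by (rule plane_transversal[OF iq False])
        have dbl: "dbl f (q + s *s v)" if "s \<in> S" for s using S(3) that dbl_symbolic[OF f(1)] by blast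
        have "lineres q v f = 0"
        proof (rule ccontr)
          assume nz: "lineres q v f \<noteq> 0"
          have "2 * card S \<le> degree (lineres q v f)"
            by (rule card_double_roots[OF S(1) nz])
               (rule dbl_lineres(1)[OF dbl], assumption, rule dbl_lineres(2)[OF dbl], assumption)
          also have "\<dots> \<le> s" by (rule degree_lineres[OF f(3)])
          \<comment> \<open>Here \<open>n \<ge> 2\<close> enters: the \<open>n - 1\<close> double
            zeros already force 2(n - 1), which is at least n.\<close>
          finally have "2 * (n - 1) \<le> s" unfolding S(2) .
          then show False using less n by linarith
        qed
        then show ?thesis using poly_lineres[of q v f 0] by simp
      qed
      then have "f = 0" using zero_if_zero_on_planes[OF f(3)] less by auto
      with f(2) show False ..
    qed
  qed
  ultimately show ?thesis unfolding has_type_def vanishing_ideal_lines[OF line_spaces_\<V>] by simp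
qed

end

section \<open>General plane sections\<close>

lemma nonzero_functional:
  fixes x :: "'k::field ^ 4"
  assumes "x \<noteq> 0"
  shows "\<exists>h. dot4 h x \<noteq> 0"
proof -
  have "vec.subspace {0 :: 'k ^ 4}" by (rule vec.subspace_single_0)
  moreover have "x \<notin> {0}" using assms by simp
  ultimately obtain h where "\<forall>u\<in>{0 :: 'k ^ 4}. dot4 h u = 0" "dot4 h x = 1" by (rule separating_functional)
  then show ?thesis by (intro exI[of _ h]) simp
qed

text \<open>Since \<open>U\<close> and \<open>V\<close> meet only in 0, \<open>a\<close> lies
  outside the sum of \<open>V\<close> and the span of \<open>b\<close>.\<close>

lemma dual_functional:
  fixes U V :: "('k::field ^ 4) set"
  assumes U: "vec.subspace U" and V: "vec.subspace V" and UV: "U \<inter> V = {0}"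
    and ab: "a \<in> U" "b \<in> U" "a \<notin> vec.span {b}"
  obtains h where "dot4 h a = 1" "dot4 h b = 0" "\<forall>v\<in>V. dot4 h v = 0"
proof -
  let ?T = "{x + y |x y. x \<in> vec.span {b} \<and> y \<in> V}"
  have T: "vec.subspace ?T" by (rule vec.subspace_sums[OF vec.subspace_span V])
  have "a \<notin> ?T"
  proof
    assume "a \<in> ?T"
    then obtain x y where xy: "a = x + y" "x \<in> vec.span {b}" "y \<in> V" by blast
    have "vec.span {b} \<subseteq> U" by (rule vec.span_minimal[OF _ U]) (use ab in simp)
    then have "a - x \<in> U" using vec.subspace_diff[OF U ab(1)] xy(2) by blast
    then have "y \<in> U \<inter> V" using xy by simp
    then have "y = 0" using UV by simp
    with xy ab(3) show False by simp
  qed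
  then obtain h where h: "\<forall>u\<in>?T. dot4 h u = 0" "dot4 h a = 1" by (rule separating_functional[OF T])
  have "b + 0 \<in> ?T" using vec.span_base[of b "{b}"] vec.subspace_0[OF V] by blast
  moreover have "0 + v \<in> ?T" if "v \<in> V" for v using vec.span_zero[of "{b}"] that by blast
  ultimately show ?thesis using that[of h] h by simp
qed

lemma skew_sum_UNIV:
  fixes U V :: "('k::field ^ 4) set"
  assumes U: "vec.subspace U" "vec.dim U = 2" and V: "vec.subspace V" "vec.dim V = 2" and UV: "U \<inter> V = {0}"
  obtains x y where "q = x + y" "x \<in> U" "y \<in> V"
proof -
  let ?T = "{x + y |x y. x \<in> U \<and> y \<in> V}"
  have "vec.dim {0 :: 'k ^ 4} = 0" by (simp add: vec.dim_eq_0)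
  then have "vec.dim ?T = 4" using vec.dim_sums_Int[OF U(1) V(1)] U(2) V(2) UV by (simp only:)
  then have d: "vec.dim (UNIV :: ('k ^ 4) set) \<le> vec.dim ?T" unfolding dim_UNIV4 by (simp only: order_refl)
  have "?T = UNIV"
    by (rule vec.subspace_dim_equal[OF vec.subspace_sums[OF U(1) V(1)] vec.subspace_UNIV _ d]) simp
  then have "q \<in> ?T" by (simp only: UNIV_I)
  then show ?thesis using that by blast
qed

section \<open>The choice of the plane\<close>

text \<open>The intersection of the span of \<open>a\<close> and \<open>b\<close> with the kernel of
  \<open>h\<close>, in a form linear in \<open>h\<close>, so that conditions on section points
  become polynomial conditions on the plane.\<close>

definition secpt :: "'k::field ^ 4 \<Rightarrow> 'k ^ 4 \<Rightarrow> 'k ^ 4 \<Rightarrow> 'k ^ 4" where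
  "secpt a b h = dot4 h b *s a - dot4 h a *s b"

lemma linepoly_secpt: "linepoly (\<lambda>h. secpt a b h $ i)"
  unfolding secpt_def vector_minus_component vector_smult_component
  by (intro linepoly_diff linepoly_mult linepoly_dot4 linepoly_const)

lemma dot4_secpt [simp]: "dot4 h (secpt a b h) = 0"
  by (simp add: secpt_def mult.commute)

text \<open>Two skew lines span the whole space, so a point \<open>q\<close> off the surface is a
  sum x + y with x in \<open>U\<close> and y in \<open>V\<close>. The functional is built so that
  the two section vectors are -x and -y; their sum is -q.\<close>

lemma skew_lines_section:
  fixes U V :: "('k::alg_closed_field ^ 4) set"
  assumes F: "F \<noteq> 0" "form_of_degree d F"
    and U: "vec.subspace U" "vec.dim U = 2" and V: "vec.subspace V" "vec.dim V = 2" and UV: "U \<inter> V = {0}"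
    and ab: "a \<in> U" "b \<in> U" "b \<noteq> 0" "a \<noteq> 0" "a \<notin> vec.span {b}" "b \<notin> vec.span {a}"
    and cd: "c \<in> V" "e \<in> V" "e \<noteq> 0" "c \<noteq> 0" "c \<notin> vec.span {e}" "e \<notin> vec.span {c}"
  shows "\<exists>h. eval4 F (secpt a b h + secpt c e h) \<noteq> 0"
proof -
  obtain q where q: "eval4 F q \<noteq> 0" using F(1) zero_if_eval4_zero by blast
  obtain x y where xy: "q = x + y" "x \<in> U" "y \<in> V" by (rule skew_sum_UNIV[OF U V UV])
  have "x \<in> vec.span {a, b}" using span_pair_eq[OF U ab(2,3,1,5)] xy(2) by blast
  then obtain x1 x2 where x: "x = x1 *s a + x2 *s b" unfolding in_span_pair by blast
  have "y \<in> vec.span {c, e}" using span_pair_eq[OF V cd(2,3,1,5)] xy(3) by blast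
  then obtain y1 y2 where y: "y = y1 *s c + y2 *s e" unfolding in_span_pair by blast
  have VU: "V \<inter> U = {0}" using UV by blast
  obtain ha where ha: "dot4 ha a = 1" "dot4 ha b = 0" "\<forall>v\<in>V. dot4 ha v = 0" by (rule dual_functional[OF U(1) V(1) UV ab(1,2,5)])
  obtain hb where hb: "dot4 hb b = 1" "dot4 hb a = 0" "\<forall>v\<in>V. dot4 hb v = 0" by (rule dual_functional[OF U(1) V(1) UV ab(2,1,6)])
  obtain hc where hc: "dot4 hc c = 1" "dot4 hc e = 0" "\<forall>v\<in>U. dot4 hc v = 0" by (rule dual_functional[OF V(1) U(1) VU cd(1,2,5)])
  obtain he where he: "dot4 he e = 1" "dot4 he c = 0" "\<forall>v\<in>U. dot4 he v = 0" by (rule dual_functional[OF V(1) U(1) VU cd(2,1,6)])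
  define h where "h = x2 *s ha - x1 *s hb + (y2 *s hc - y1 *s he)"
  have "dot4 h a = x2" "dot4 h b = - x1" "dot4 h c = y2" "dot4 h e = - y1"
    using ha hb hc he ab cd by (simp_all add: h_def)
  then have "secpt a b h + secpt c e h = (- 1) *s q"
    by (simp add: secpt_def xy(1) x y vec_eq_iff algebra_simps)
  then have "eval4 F (secpt a b h + secpt c e h) \<noteq> 0"
    using q eval4_scale[OF F(2), of "- 1" q] by simp
  then show ?thesis by blast
qed

text \<open>The vector \<open>p U + p V\<close> represents a point on the line joining the two
  section points, so a nonzero value there keeps this line out of the section of \<open>F\<close>.
  Each requirement holds for some \<open>h\<close>, hence \<open>generic_point\<close> yields one
  \<open>h\<close> for all.\<close>

lemma generic_plane:
  fixes \<V> :: "('k::alg_closed_field ^ 4) set set"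
  assumes \<V>: "line_spaces \<V>" and F: "F \<noteq> 0" "form_of_degree d F"
  obtains h p q x where "\<forall>V\<in>\<V>. p V \<in> V \<and> dot4 h (p V) = 0 \<and> p V \<noteq> 0 \<and> q V \<in> V \<and> dot4 h (q V) = 1"
    "\<forall>U\<in>\<V>. \<forall>V\<in>\<V>. U \<noteq> V \<longrightarrow> p V \<notin> U"
    "\<forall>U\<in>\<V>. \<forall>V\<in>\<V>. U \<noteq> V \<longrightarrow> U \<inter> V \<noteq> {0} \<longrightarrow> (\<exists>c\<in>U \<inter> V. dot4 h c \<noteq> 0)"
    "\<forall>U\<in>\<V>. \<forall>V\<in>\<V>. U \<inter> V = {0} \<longrightarrow> eval4 F (p U + p V) \<noteq> 0"
    "dot4 h x = 0" "eval4 F x \<noteq> 0"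
proof -
  note D = line_spacesD[OF \<V>]
  have "\<exists>ab. fst ab \<in> V \<and> snd ab \<in> V \<and> fst ab \<noteq> 0 \<and> snd ab \<noteq> 0 \<and> snd ab \<notin> vec.span {fst ab} \<and> fst ab \<notin> vec.span {snd ab}"
    if V: "V \<in> \<V>" for V
  proof -
    obtain a b where "a \<in> V" "b \<in> V" "a \<noteq> 0" "b \<noteq> 0" "b \<notin> vec.span {a}" "a \<notin> vec.span {b}"
      by (rule plane_basis[OF D(2,3)[OF V]])
    then show ?thesis by (intro exI[of _ "(a, b)"]) simp
  qed
  then have "\<forall>V\<in>\<V>. \<exists>ab. fst ab \<in> V \<and> snd ab \<in> V \<and> fst ab \<noteq> 0 \<and> snd ab \<noteq> 0 \<and> snd ab \<notin> vec.span {fst ab} \<and> fst ab \<notin> vec.span {snd ab}"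
    by (rule ballI)
  from bchoice[OF this] obtain ab where ab: "\<forall>V\<in>\<V>. fst (ab V) \<in> V \<and> snd (ab V) \<in> V \<and> fst (ab V) \<noteq> 0
      \<and> snd (ab V) \<noteq> 0 \<and> snd (ab V) \<notin> vec.span {fst (ab V)} \<and> fst (ab V) \<notin> vec.span {snd (ab V)}" by (rule exE)
  define a b where "a V = fst (ab V)" and "b V = snd (ab V)" for V
  have abV: "a V \<in> V" "b V \<in> V" "a V \<noteq> 0" "b V \<noteq> 0" "b V \<notin> vec.span {a V}" "a V \<notin> vec.span {b V}" if "V \<in> \<V>" for V
    using bspec[OF ab that] by (simp_all add: a_def b_def)
  define c where "c U V = (SOME x. x \<in> U \<inter> V \<and> x \<noteq> (0 :: 'k ^ 4))" for U V
  have c: "c U V \<in> U \<inter> V \<and> c U V \<noteq> 0" if "U \<in> \<V>" "V \<in> \<V>" "U \<inter> V \<noteq> {0}" for U V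
  proof -
    have "0 \<in> U \<inter> V" using D(4) that by blast
    then have "\<exists>x. x \<in> U \<inter> V \<and> x \<noteq> 0" using that(3) by blast
    then show ?thesis unfolding c_def by (rule someI_ex)
  qed
  obtain q0 where q0: "eval4 F q0 \<noteq> 0" using F(1) zero_if_eval4_zero by blast
  obtain c0 where c0: "c0 \<notin> vec.span {q0}"
  proof -
    have "vec.span {q0} \<noteq> UNIV"
    proof
      assume "vec.span {q0} = UNIV"
      then have "vec.dim (vec.span {q0}) = 4" using dim_UNIV4[where 'k='k] by (simp only:)
      then have "vec.dim {q0} = 4" unfolding vec.dim_span .
      then show False by (simp split: if_splits)
    qed
    then show thesis using that by blast
  qed
  \<comment> \<open>For the kernel of \<open>h0\<close> the vector \<open>secpt q0 c0 h0\<close> is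
    \<open>q0\<close> itself, a point off the surface.\<close>
  obtain h0 where h0: "\<forall>u\<in>vec.span {q0}. dot4 h0 u = 0" "dot4 h0 c0 = 1"
    by (rule separating_functional[OF vec.subspace_span c0])
  \<comment> \<open>The plane contains no line (\<open>X1\<close>), avoids a chosen nonzero common
    vector of any two lines that are not skew (\<open>X2\<close>), has \<open>F\<close> nonzero
    between the section points of skew lines (\<open>X3\<close>), and is not contained in the
    surface (\<open>f4\<close>).\<close>
  define X1 where "X1 = (\<lambda>V h. dot4 h (a V)) ` \<V>"
  define X2 where "X2 = (\<lambda>(U, V) h. dot4 h (c U V)) ` {(U, V) \<in> \<V> \<times> \<V>. U \<inter> V \<noteq> {0}}"
  define X3 where "X3 = (\<lambda>(U, V) h. eval4 F (secpt (a U) (b U) h + secpt (a V) (b V) h)) ` {(U, V) \<in> \<V> \<times> \<V>. U \<inter> V = {0}}"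
  define f4 where "f4 = (\<lambda>h. eval4 F (secpt q0 c0 h))"
  have "\<exists>h\<in>UNIV. \<forall>f\<in>X1 \<union> X2 \<union> X3 \<union> {f4}. f h \<noteq> 0"
  proof (rule generic_point)
    have "finite {(U, V) \<in> \<V> \<times> \<V>. P U V}" for P
      by (rule finite_subset[of _ "\<V> \<times> \<V>"]) (use D(1) in auto)
    then show "finite (X1 \<union> X2 \<union> X3 \<union> {f4})" using D(1) by (simp add: X1_def X2_def X3_def)
    show "line_closed (UNIV :: ('k ^ 4) set)" by (simp add: line_closed_def)
    show "(UNIV :: ('k ^ 4) set) \<noteq> {}" by simp
    fix f assume f: "f \<in> X1 \<union> X2 \<union> X3 \<union> {f4}"
    have l: "linepoly (\<lambda>h. eval4 F (secpt x y h + secpt z w h))" for x y z w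
      by (rule linepoly_eval4) (simp only: vector_add_component, intro linepoly_add linepoly_secpt)
    have l4: "linepoly f4" unfolding f4_def by (rule linepoly_eval4) (rule linepoly_secpt)
    show "linepoly f"
      using f l l4 linepoly_dot4(1) unfolding X1_def X2_def X3_def by fastforce
    show "\<exists>v\<in>UNIV. f v \<noteq> 0"
    proof -
      consider V where "V \<in> \<V>" "f = (\<lambda>h. dot4 h (a V))"
        | U V where "U \<in> \<V>" "V \<in> \<V>" "U \<inter> V \<noteq> {0}" "f = (\<lambda>h. dot4 h (c U V))"
        | U V where "U \<in> \<V>" "V \<in> \<V>" "U \<inter> V = {0}" "f = (\<lambda>h. eval4 F (secpt (a U) (b U) h + secpt (a V) (b V) h))"
        | "f = f4" using f unfolding X1_def X2_def X3_def by auto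
      then show ?thesis
      proof cases
        case 1
        then show ?thesis using nonzero_functional[OF abV(3)] by simp
      next
        case 2
        then show ?thesis using nonzero_functional[of "c U V"] c[of U V] by simp
      next
        case 3
        show ?thesis
          using skew_lines_section[OF F D(2,3)[OF 3(1)] D(2,3)[OF 3(2)] 3(3) abV(1,2,4,3,6,5)[OF 3(1)] abV(1,2,4,3,6,5)[OF 3(2)]]
          by (simp add: 3(4))
      next
        case 4
        have "dot4 h0 q0 = 0" using h0(1) vec.span_base[of q0 "{q0}"] by simp
        then have "secpt q0 c0 h0 = q0" using h0(2) by (simp add: secpt_def)
        then show ?thesis using q0 by (intro bexI[of _ h0]) (simp_all add: 4 f4_def)
      qed
    qed
  qed
  then obtain h where h: "\<And>f. f \<in> X1 \<union> X2 \<union> X3 \<union> {f4} \<Longrightarrow> f h \<noteq> 0" by blast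
  have hX1: "dot4 h (a V) \<noteq> 0" if "V \<in> \<V>" for V
    using h[of "\<lambda>h. dot4 h (a V)"] that by (simp add: X1_def)
  have hX2: "dot4 h (c U V) \<noteq> 0" if "U \<in> \<V>" "V \<in> \<V>" "U \<inter> V \<noteq> {0}" for U V
  proof (rule h[of "\<lambda>h. dot4 h (c U V)"])
    have "(\<lambda>h. dot4 h (c U V)) \<in> X2" unfolding X2_def using that by (intro image_eqI[of _ _ "(U, V)"]) auto
    then show "(\<lambda>h. dot4 h (c U V)) \<in> X1 \<union> X2 \<union> X3 \<union> {f4}" by blast
  qed
  define p where "p V = secpt (a V) (b V) h" for V
  define q where "q V = (1 / dot4 h (a V)) *s a V" for V
  have hX3: "eval4 F (p U + p V) \<noteq> 0" if "U \<in> \<V>" "V \<in> \<V>" "U \<inter> V = {0}" for U V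
    unfolding p_def
  proof (rule h[of "\<lambda>h. eval4 F (secpt (a U) (b U) h + secpt (a V) (b V) h)"])
    have "(\<lambda>h. eval4 F (secpt (a U) (b U) h + secpt (a V) (b V) h)) \<in> X3"
      unfolding X3_def using that by (intro image_eqI[of _ _ "(U, V)"]) auto
    then show "(\<lambda>h. eval4 F (secpt (a U) (b U) h + secpt (a V) (b V) h)) \<in> X1 \<union> X2 \<union> X3 \<union> {f4}" by blast
  qed
  have p0: "p V \<noteq> 0" if V: "V \<in> \<V>" for V
  proof
    assume "p V = 0"
    then have "dot4 h (a V) *s b V = dot4 h (b V) *s a V" by (simp add: p_def secpt_def)
    then have "(1 / dot4 h (a V)) *s (dot4 h (a V) *s b V) = (1 / dot4 h (a V)) *s (dot4 h (b V) *s a V)" by simp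
    then have "b V = (dot4 h (b V) / dot4 h (a V)) *s a V" using hX1[OF V] by (simp add: vector_smult_assoc)
    then have "b V \<in> vec.span {a V}" unfolding in_span_singleton by blast
    with abV(5)[OF V] show False ..
  qed
  have pV: "p V \<in> V" "q V \<in> V" if V: "V \<in> \<V>" for V
    unfolding p_def q_def secpt_def
    by (intro vec.subspace_diff vec.subspace_scale D(2)[OF V] abV(1,2)[OF V])+
  have p_notin: "p V \<notin> U" if UV: "U \<in> \<V>" "V \<in> \<V>" "U \<noteq> V" for U V
  proof
    assume pU: "p V \<in> U"
    then have ne: "U \<inter> V \<noteq> {0}" using p0[OF UV(2)] pV(1)[OF UV(2)] by blast
    have cc: "c U V \<in> U" "c U V \<in> V" using c[OF UV(1,2) ne] by auto
    \<comment> \<open>\<open>h\<close> vanishes at \<open>p V\<close> but not at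
      \<open>c U V\<close>, so these two vectors are independent; lying in both \<open>U\<close> and
      \<open>V\<close>, they would force equality.\<close>
    have "c U V \<notin> vec.span {p V}"
    proof
      assume "c U V \<in> vec.span {p V}"
      then obtain k where "c U V = k *s p V" unfolding in_span_singleton by blast
      then have "dot4 h (c U V) = 0" by (simp add: p_def)
      with hX2[OF UV(1,2) ne] show False ..
    qed
    then have "V = vec.span {c U V, p V}" "U = vec.span {c U V, p V}"
      using span_pair_eq[OF D(2,3)[OF UV(2)] pV(1)[OF UV(2)] p0[OF UV(2)] cc(2)]
        span_pair_eq[OF D(2,3)[OF UV(1)] pU p0[OF UV(2)] cc(1)] by blast+
    with UV(3) show False by blast
  qed
  show ?thesis
  proof (rule that[of p h q "secpt q0 c0 h"])
    show "\<forall>V\<in>\<V>. p V \<in> V \<and> dot4 h (p V) = 0 \<and> p V \<noteq> 0 \<and> q V \<in> V \<and> dot4 h (q V) = 1"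
      using pV p0 hX1 by (simp add: p_def q_def)
    show "\<forall>U\<in>\<V>. \<forall>V\<in>\<V>. U \<noteq> V \<longrightarrow> p V \<notin> U" using p_notin by blast
    show "\<forall>U\<in>\<V>. \<forall>V\<in>\<V>. U \<noteq> V \<longrightarrow> U \<inter> V \<noteq> {0} \<longrightarrow> (\<exists>c\<in>U \<inter> V. dot4 h c \<noteq> 0)"
      using c hX2 by blast
    show "\<forall>U\<in>\<V>. \<forall>V\<in>\<V>. U \<inter> V = {0} \<longrightarrow> eval4 F (p U + p V) \<noteq> 0" using hX3 by blast
    show "dot4 h (secpt q0 c0 h) = 0" by simp
    show "eval4 F (secpt q0 c0 h) \<noteq> 0" using h[of f4] by (simp add: f4_def)
  qed
qed

section \<open>Affine charts of a plane and homogenization\<close>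

text \<open>A basis of the plane with dual coordinates \<open>c\<close>, \<open>l\<close>,
  \<open>m\<close>, where \<open>c\<close> is prescribed: its zero line becomes the line at infinity
  of the chart with coordinates l/c and m/c.\<close>

lemma plane_coordinates:
  fixes h c p0 :: "'k::field ^ 4"
  assumes h: "dot4 h x \<noteq> 0" and p0: "dot4 h p0 = 0" "dot4 c p0 \<noteq> 0"
  obtains u v w l m where
    "\<And>y. dot4 h y = 0 \<Longrightarrow> y = dot4 c y *s u + dot4 l y *s v + dot4 m y *s w"
    "dot4 h u = 0" "dot4 h v = 0" "dot4 h w = 0" "dot4 c u = 1" "dot4 c v = 0" "dot4 c w = 0"
    "dot4 l u = 0" "dot4 l v = 1" "dot4 l w = 0" "dot4 m u = 0" "dot4 m v = 0" "dot4 m w = 1"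
proof -
  let ?T = "{y. dot4 h y = 0} \<inter> {y. dot4 c y = 0}"
  have T: "vec.subspace ?T" by (rule vec.subspace_inter[OF subspace_ker subspace_ker])
  have "{y. dot4 h y = 0} \<noteq> {y. dot4 c y = 0}" using p0 by blast
  then have dT: "vec.dim ?T = 2"
    by (intro dim_plane_Int subspace_ker dim_ker[OF h] dim_ker[OF p0(2)])
  obtain v w where vw: "v \<in> ?T" "w \<in> ?T" "v \<noteq> 0" "w \<noteq> 0" "w \<notin> vec.span {v}" "v \<notin> vec.span {w}"
    by (rule plane_basis[OF T dT])
  define u where "u = (1 / dot4 c p0) *s p0"
  have u: "dot4 h u = 0" "dot4 c u = 1" using p0 by (simp_all add: u_def)
  have sep: "\<exists>l. dot4 l u = 0 \<and> dot4 l s = 1 \<and> dot4 l t = 0" if st: "s \<in> ?T" "t \<in> ?T" "s \<notin> vec.span {t}" for s t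
  proof -
    have "s \<notin> vec.span {u, t}"
    proof
      assume "s \<in> vec.span {u, t}"
      then obtain k j where kj: "s = k *s u + j *s t" unfolding in_span_pair by blast
      have "dot4 c s = 0" "dot4 c t = 0" using st(1,2) by auto
      then have "k = 0" using kj u by simp
      then have "s \<in> vec.span {t}" using kj unfolding in_span_singleton by (intro exI[of _ j]) simp
      with st(3) show False ..
    qed
    then obtain l where l: "\<forall>y\<in>vec.span {u, t}. dot4 l y = 0" "dot4 l s = 1"
      by (rule separating_functional[OF vec.subspace_span])
    have "u \<in> vec.span {u, t}" "t \<in> vec.span {u, t}" by (rule vec.span_base, simp)+
    with l show ?thesis by blast
  qed
  obtain l where l: "dot4 l u = 0" "dot4 l v = 1" "dot4 l w = 0" using sep[OF vw(1,2,6)] by blast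
  obtain m where m: "dot4 m u = 0" "dot4 m w = 1" "dot4 m v = 0" using sep[OF vw(2,1,5)] by blast
  have hc: "dot4 h v = 0" "dot4 h w = 0" "dot4 c v = 0" "dot4 c w = 0" using vw(1,2) by auto
  have coord: "y = dot4 c y *s u + dot4 l y *s v + dot4 m y *s w" if y: "dot4 h y = 0" for y
  proof -
    have "y - dot4 c y *s u \<in> ?T" using y u by simp
    then have "y - dot4 c y *s u \<in> vec.span {w, v}"
      using span_pair_eq[OF T dT vw(1,3,2,5)] by blast
    then obtain j k where jk: "y - dot4 c y *s u = j *s w + k *s v" unfolding in_span_pair by blast
    have "dot4 l (y - dot4 c y *s u) = k" unfolding jk using l by simp
    moreover have "dot4 m (y - dot4 c y *s u) = j" unfolding jk using m by simp
    ultimately have "j = dot4 m y" "k = dot4 l y" using l m by simp_all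
    then show ?thesis using jk by (simp add: algebra_simps)
  qed
  show ?thesis by (rule that[OF coord u(1) hc(1,2) u(2) hc(3,4) l m(1,3,2)])
qed

lemma ev2_expand:
  assumes "tdeg_le t g"
  shows "ev2 g ab = (\<Sum>(i, j)\<in>deg_set t. coeff (coeff g i) j * fst ab ^ j * snd ab ^ i)"
proof -
  have g: "g = (\<Sum>ij\<in>deg_set t. [:[:coeff (coeff g (fst ij)) (snd ij):]:] * bmonom ij)"
  proof (rule poly_eqI, rule poly_eqI)
    fix i j
    show "coeff (coeff g i) j = coeff (coeff (\<Sum>ij\<in>deg_set t. [:[:coeff (coeff g (fst ij)) (snd ij):]:] * bmonom ij) i) j"
      unfolding coeff_sum_bmonom[OF finite_deg_set] using tdeg_leD[OF assms, of i j] by (auto simp: deg_set_def)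
  qed
  have m: "ev2 (bmonom (i, j)) ab = fst ab ^ j * snd ab ^ i" for i j
    by (simp add: bmonom_def ev2_def poly_monom)
  have "ev2 g ab = (\<Sum>ij\<in>deg_set t. coeff (coeff g (fst ij)) (snd ij) * ev2 (bmonom ij) ab)"
    by (subst g) simp
  also have "\<dots> = (\<Sum>(i, j)\<in>deg_set t. coeff (coeff g i) j * fst ab ^ j * snd ab ^ i)"
    by (intro sum.cong) (auto simp: m)
  finally show ?thesis .
qed

text \<open>With the first coordinate fixed, all coefficients vanish as values; letting it vary,
  they vanish as polynomials.\<close>

lemma bipoly_0_if_vanishing:
  fixes g :: "'k::alg_closed_field poly poly"
  assumes "\<And>ab. ev2 g ab = 0"
  shows "g = 0"
proof (rule poly_eqI)
  fix i
  have "poly (coeff g i) a = 0" for a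
  proof -
    have "map_poly (\<lambda>c. poly c a) g = 0"
      by (rule poly_0_if_vanishing) (use assms[of "(a, _)"] in \<open>simp add: ev2_def poly_poly_const\<close>)
    then have "coeff (map_poly (\<lambda>c. poly c a) g) i = 0" by simp
    then show ?thesis by (simp add: coeff_map_poly)
  qed
  then show "coeff g i = coeff 0 i" using poly_0_if_vanishing[of "coeff g i"] by simp
qed

text \<open>Homogenization of \<open>g\<close> to degree \<open>t\<close> in the coordinates
  \<open>c\<close>, \<open>l\<close>, \<open>m\<close>, with \<open>c\<close> as homogenizing
  variable; it is a form in all four variables.\<close>

definition homog :: "nat \<Rightarrow> 'k::field ^ 4 \<Rightarrow> 'k ^ 4 \<Rightarrow> 'k ^ 4 \<Rightarrow> 'k poly poly \<Rightarrow> 'k poly4" where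
  "homog t c l m g = (\<Sum>(i, j)\<in>deg_set t.
     cst (coeff (coeff g i) j) * (lform c ^ (t - (i + j)) * (lform l ^ j * lform m ^ i)))"

lemma form_homog: "form_of_degree t (homog t c l m g)"
  unfolding homog_def
proof (rule form_sum)
  fix ij assume "ij \<in> deg_set t"
  then obtain i j where ij: "ij = (i, j)" "i + j \<le> t" by (auto simp: deg_set_def)
  have "form_of_degree (0 + (t - (i + j) + (j + i))) (cst (coeff (coeff g i) j) * (lform c ^ (t - (i + j)) * (lform l ^ j * lform m ^ i)))"
    by (intro form_mult form_const form_power form_lform)
  then show "form_of_degree t (case ij of (i, j) \<Rightarrow> cst (coeff (coeff g i) j) * (lform c ^ (t - (i + j)) * (lform l ^ j * lform m ^ i)))"
    using ij by (simp add: add.commute)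
qed

lemma eval4_homog:
  assumes g: "tdeg_le t g" and c: "dot4 c x \<noteq> 0"
  shows "eval4 (homog t c l m g) x = dot4 c x ^ t * ev2 g (dot4 l x / dot4 c x, dot4 m x / dot4 c x)"
proof -
  have "eval4 (homog t c l m g) x = (\<Sum>(i, j)\<in>deg_set t.
     coeff (coeff g i) j * (dot4 c x ^ (t - (i + j)) * (dot4 l x ^ j * dot4 m x ^ i)))"
    unfolding homog_def eval4.hom_sum
    by (intro sum.cong) (auto simp: eval4.hom_mult eval4.hom_power)
  also have "\<dots> = (\<Sum>(i, j)\<in>deg_set t. dot4 c x ^ t * (coeff (coeff g i) j * (dot4 l x / dot4 c x) ^ j * (dot4 m x / dot4 c x) ^ i))"
  proof (intro sum.cong refl, clarify)
    fix i j assume "(i, j) \<in> deg_set t"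
    then have "dot4 c x ^ t = dot4 c x ^ (t - (i + j)) * (dot4 c x ^ j * dot4 c x ^ i)"
      by (simp add: power_add[symmetric] deg_set_def)
    then show "coeff (coeff g i) j * (dot4 c x ^ (t - (i + j)) * (dot4 l x ^ j * dot4 m x ^ i)) =
      dot4 c x ^ t * (coeff (coeff g i) j * (dot4 l x / dot4 c x) ^ j * (dot4 m x / dot4 c x) ^ i)"
      using c by (simp add: power_divide)
  qed
  also have "\<dots> = dot4 c x ^ t * ev2 g (dot4 l x / dot4 c x, dot4 m x / dot4 c x)"
    unfolding ev2_expand[OF g] sum_distrib_left by (intro sum.cong) auto
  finally show ?thesis .
qed

section \<open>The classification\<close>

lemma linear_form_functional:
  assumes "tdeg_le 1 (L :: 'k::field poly poly)"
  shows "\<exists>M. \<forall>y. dot4 c y \<noteq> 0 \<longrightarrow> ev2 L (dot4 l y / dot4 c y, dot4 m y / dot4 c y) = dot4 M y / dot4 c y"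
proof -
  obtain \<alpha> \<beta> \<gamma> where L: "L = lin \<alpha> \<beta> \<gamma>" using linear_form[OF assms] .
  show ?thesis
    by (intro exI[of _ "\<alpha> *s c + \<beta> *s l + \<gamma> *s m"]) (simp add: L add_divide_distrib)
qed

text \<open>\<open>N V\<close> records which lines of the plane star pass through the section point
  of \<open>V\<close>. It is always a pair of indices, and every pair occurs; the incidences between
  the lines and the planes \<open>P i\<close> are derived from this.\<close>

theorem star_of_CM:
  fixes \<V> :: "('k::alg_closed_field ^ 4) set set"
  assumes \<V>: "line_spaces \<V>" "\<V> \<noteq> {}" and d: "d \<ge> 3"
    and F: "F \<in> symbolic_power (van (\<Union>\<V>)) 2" "F \<noteq> 0" "form_of_degree d F"
    and no: "\<And>f. f \<in> van (\<Union>\<V>) \<Longrightarrow> form_of_degree (d - 2) f \<Longrightarrow> f = 0"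
    and cm: "cohen_macaulay (coord_ring Quot van (\<Union>\<V>))"
  shows "pseudostar (\<Union>V\<in>\<V>. linear_locus V)"
proof -
  interpret line_family \<V> by (rule line_family_line_spaces[OF \<V>(1)])
  note D = line_spacesD[OF \<V>(1)]
  obtain h p q x0 where g1: "\<forall>V\<in>\<V>. p V \<in> V \<and> dot4 h (p V) = 0 \<and> p V \<noteq> 0 \<and> q V \<in> V \<and> dot4 h (q V) = 1"
    and g2: "\<forall>U\<in>\<V>. \<forall>V\<in>\<V>. U \<noteq> V \<longrightarrow> p V \<notin> U"
    and g3: "\<forall>U\<in>\<V>. \<forall>V\<in>\<V>. U \<noteq> V \<longrightarrow> U \<inter> V \<noteq> {0} \<longrightarrow> (\<exists>c\<in>U \<inter> V. dot4 h c \<noteq> 0)"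
    and g4: "\<forall>U\<in>\<V>. \<forall>V\<in>\<V>. U \<inter> V = {0} \<longrightarrow> eval4 F (p U + p V) \<noteq> 0"
    and g5: "dot4 h x0 = 0" "eval4 F x0 \<noteq> 0"
    by (rule generic_plane[OF \<V>(1) F(2,3)])
  have pq: "p V \<in> V" "dot4 h (p V) = 0" "p V \<noteq> 0" "q V \<in> V" "dot4 h (q V) = 1" if "V \<in> \<V>" for V
    using bspec[OF g1 that] by simp_all
  have "\<forall>V\<in>\<V>. \<exists>e. dot4 e (p V) = 1 \<and> dot4 e (q V) = 0"
  proof
    fix V assume V: "V \<in> \<V>"
    have "p V \<notin> vec.span {q V}"
    proof
      assume "p V \<in> vec.span {q V}"
      then obtain k where k: "p V = k *s q V" unfolding in_span_singleton by blast
      have "dot4 h (k *s q V) = k" by (simp only: dot4_simps pq(5)[OF V] mult_1_right)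
      then have "k = 0" using pq(2)[OF V] by (simp only: k)
      then have "p V = 0" using k by simp
      with pq(3)[OF V] show False ..
    qed
    then obtain e where e: "\<forall>y\<in>vec.span {q V}. dot4 e y = 0" "dot4 e (p V) = 1"
      by (rule separating_functional[OF vec.subspace_span])
    have "q V \<in> vec.span {q V}" by (rule vec.span_base) simp
    with e show "\<exists>e. dot4 e (p V) = 1 \<and> dot4 e (q V) = 0" by blast
  qed
  from bchoice[OF this] obtain e where e: "\<forall>V\<in>\<V>. dot4 (e V) (p V) = 1 \<and> dot4 (e V) (q V) = 0" by (rule exE)
  have coord: "y = dot4 (e V) y *s p V + dot4 h y *s q V" if V: "V \<in> \<V>" and y: "y \<in> V" for V y
  proof -
    have eV: "dot4 (e V) (p V) = 1" "dot4 (e V) (q V) = 0" using bspec[OF e V] by simp_all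
    have "q V \<noteq> 0" using pq(5)[OF V] by auto
    moreover have "p V \<notin> vec.span {q V}"
      unfolding in_span_singleton using eV by auto
    ultimately have "V = vec.span {p V, q V}"
      by (rule span_pair_eq[OF D(2,3)[OF V] pq(4)[OF V] _ pq(1)[OF V]])
    then have "y \<in> vec.span {p V, q V}" using y by simp
    then obtain j k where y': "y = j *s p V + k *s q V" unfolding in_span_pair by blast
    have "dot4 (e V) y = j" "dot4 h y = k" unfolding y' using eV pq(2,5)[OF V] by simp_all
    with y' show ?thesis by simp
  qed
  have lsec: "line_section \<V> h p q e"
  proof
    show "\<V> \<noteq> {}" by (rule \<V>(2))
    show "c *s v \<in> V" if "V \<in> \<V>" "v \<in> V" for V c v by (rule vec.subspace_scale[OF D(2)[OF that(1)] that(2)])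
    show "y = dot4 (e V) y *s p V + dot4 h y *s q V" if "V \<in> \<V>" "y \<in> V" for V y by (rule coord[OF that])
    show "\<exists>l. (\<forall>u\<in>U. dot4 l u = 0) \<and> dot4 l (p V) \<noteq> 0" if UV: "U \<in> \<V>" "V \<in> \<V>" "U \<noteq> V" for U V
    proof -
      have "p V \<notin> U" using g2 UV by blast
      then obtain l where "\<forall>u\<in>U. dot4 l u = 0" "dot4 l (p V) = 1" by (rule separating_functional[OF D(2)[OF UV(1)]])
      then show ?thesis by (intro exI[of _ l]) simp
    qed
  qed (use pq in blast)+
  have sum_ne: "p U + p V \<noteq> 0" if UV: "U \<in> \<V>" "V \<in> \<V>" "U \<noteq> V" for U V
  proof
    assume "p U + p V = 0"
    then have "p V = (- 1) *s p U" by (simp add: vec_eq_iff eq_neg_iff_add_eq_0 add.commute)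
    then have "p V \<in> U" using vec.subspace_scale[OF D(2)[OF UV(1)] pq(1)[OF UV(1)], of "- 1"] by (simp only:)
    with bspec[OF bspec[OF g2 UV(1)] UV(2)] UV(3) show False by (elim impE) (simp_all only: not_False_eq_True)
  qed
  \<comment> \<open>The line at infinity must avoid the section points and also the points
    \<open>p U + p V\<close>, because both are evaluated in the affine chart.\<close>
  define r where "r UV = (if fst UV = snd UV then p (fst UV) else p (fst UV) + p (snd UV))" for UV
  have "\<exists>c\<in>UNIV. \<forall>UV\<in>\<V> \<times> \<V>. (\<lambda>UV c. dot4 c (r UV)) UV c \<noteq> 0"
  proof (rule generic_point)
    show "finite (\<V> \<times> \<V>)" using D(1) by simp
    show "line_closed (UNIV :: ('k ^ 4) set)" by (simp add: line_closed_def)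
    show "(UNIV :: ('k ^ 4) set) \<noteq> {}" by simp
    fix UV assume UV: "UV \<in> \<V> \<times> \<V>"
    show "linepoly (\<lambda>c. dot4 c (r UV))" by (rule linepoly_dot4(1))
    have m: "fst UV \<in> \<V>" "snd UV \<in> \<V>" using UV by (simp_all only: mem_Times_iff)
    have "r UV \<noteq> 0"
    proof (cases "fst UV = snd UV")
      case True
      then show ?thesis unfolding r_def using pq(3)[OF m(1)] by (rule if_P[THEN ssubst])
    next
      case False
      then show ?thesis unfolding r_def using sum_ne[OF m False] by (rule if_not_P[THEN ssubst])
    qed
    from nonzero_functional[OF this] show "\<exists>c\<in>UNIV. dot4 c (r UV) \<noteq> 0" by simp
  qed
  then obtain c where c: "\<forall>UV\<in>\<V> \<times> \<V>. dot4 c (r UV) \<noteq> 0" by (rule bexE)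
  have c1: "dot4 c (p V) \<noteq> 0" if "V \<in> \<V>" for V
    using bspec[OF c SigmaI[OF that that]] by (simp only: r_def fst_conv snd_conv if_True simp_thms)
  have c2: "dot4 c (p U + p V) \<noteq> 0" if "U \<in> \<V>" "V \<in> \<V>" "U \<noteq> V" for U V
    using bspec[OF c SigmaI[OF that(1,2)]] that(3) by (simp only: r_def fst_conv snd_conv if_False simp_thms)
  obtain V0 where V0: "V0 \<in> \<V>" using \<V>(2) by blast
  have hq: "dot4 h (q V0) \<noteq> 0" using pq(5)[OF V0] by simp
  obtain u v w l m where uvw: "\<And>y. dot4 h y = 0 \<Longrightarrow> y = dot4 c y *s u + dot4 l y *s v + dot4 m y *s w"
    "dot4 h u = 0" "dot4 h v = 0" "dot4 h w = 0" "dot4 c u = 1" "dot4 c v = 0" "dot4 c w = 0"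
    "dot4 l u = 0" "dot4 l v = 1" "dot4 l w = 0" "dot4 m u = 0" "dot4 m v = 0" "dot4 m w = 1"
    by (rule plane_coordinates[OF hq pq(2)[OF V0] c1[OF V0]]) blast
  define z where "z y = (dot4 l y / dot4 c y, dot4 m y / dot4 c y)" for y
  have zpt: "u + fst (z y) *s v + snd (z y) *s w = (1 / dot4 c y) *s y" if y: "dot4 h y = 0" "dot4 c y \<noteq> 0" for y
  proof -
    have "(1 / dot4 c y) *s y = (1 / dot4 c y) *s (dot4 c y *s u + dot4 l y *s v + dot4 m y *s w)"
      using uvw(1)[OF y(1)] by simp
    also have "\<dots> = u + fst (z y) *s v + snd (z y) *s w"
      using y(2) by (simp add: z_def vec_eq_iff field_simps)
    finally show ?thesis ..
  qed
  define f where "f = planeres u v w F"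
  have ev_f: "ev2 f (z y) = (1 / dot4 c y) ^ d * eval4 F y" if y: "dot4 h y = 0" "dot4 c y \<noteq> 0" for y
    unfolding f_def ev2_planeres zpt[OF y] by (rule eval4_scale[OF F(3)])
  have "\<exists>y\<in>{y. dot4 h y = 0}. \<forall>b\<in>(UNIV :: bool set). (\<lambda>b y. if b then eval4 F y else dot4 c y) b y \<noteq> 0"
  proof (rule generic_point)
    show "line_closed {y. dot4 h y = 0}" by (rule line_closed_subspace[OF subspace_ker])
    show "{y. dot4 h y = 0} \<noteq> {}" using g5(1) by blast
    have "linepoly (\<lambda>y. eval4 F y)" by (rule linepoly_eval4) (rule linepoly_nth)
    then show "linepoly (\<lambda>y. if b then eval4 F y else dot4 c y)" for b using linepoly_dot4(2)[of c] by (cases b) simp_all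
    show "\<exists>y\<in>{y. dot4 h y = 0}. (if b then eval4 F y else dot4 c y) \<noteq> 0" for b
      using g5 pq(2)[OF V0] c1[OF V0] by (cases b) auto
  qed simp
  then obtain y where y: "dot4 h y = 0" "\<And>b. (if b then eval4 F y else dot4 c y) \<noteq> 0" by blast
  have y1: "eval4 F y \<noteq> 0" "dot4 c y \<noteq> 0" using y(2)[of True] y(2)[of False] by simp_all
  have "ev2 f (z y) \<noteq> 0" using ev_f[OF y(1) y1(2)] y1 by simp
  then have f0: "f \<noteq> 0" by auto
  have f_deg: "tdeg_le d f" unfolding f_def by (rule tdeg_le_planeres[OF F(3)])
  define Y where "Y = (\<lambda>V. z (p V)) ` \<V>"
  have finY: "finite Y" using D(1) by (simp add: Y_def)
  have sing: "sing_at f y" if y: "y \<in> Y" for y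
  proof -
    obtain V where V: "V \<in> \<V>" "y = z (p V)" using y unfolding Y_def by blast
    show ?thesis unfolding f_def
    proof (rule sing_at_planeres)
      have "(1 / dot4 c (p V)) *s p V \<in> V" by (rule vec.subspace_scale[OF D(2)[OF V(1)] pq(1)[OF V(1)]])
      then show "dbl F (u + fst y *s v + snd y *s w)"
        unfolding V(2) zpt[OF pq(2)[OF V(1)] c1[OF V(1)]] by (rule dbl_symbolic[OF F(1) V(1)])
    qed
  qed
  \<comment> \<open>The hypothesis of \<open>star_arrangement\<close>: a curve of degree
    \<open>d - 2\<close> through all section points homogenizes to a form that
    \<open>CM_section\<close> forces to vanish on the whole plane.\<close>
  have dense: "\<exists>y\<in>Y. ev2 g y \<noteq> 0" if g: "g \<noteq> 0" "tdeg_le (d - 2) g" for g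
  proof (rule ccontr)
    assume n: "\<not> ?thesis"
    define G where "G = homog (d - 2) c l m g"
    have Gp: "eval4 G (p V) = 0" if V: "V \<in> \<V>" for V
    proof -
      have "ev2 g (z (p V)) = 0" using n V unfolding Y_def by blast
      then show ?thesis unfolding G_def eval4_homog[OF g(2) c1[OF V]] z_def by simp
    qed
    have G0: "eval4 G y = 0" if "dot4 h y = 0" for y
      by (rule line_section.CM_section[OF lsec cm form_homog Gp[unfolded G_def] no that, folded G_def])
    have "ev2 g ab = 0" for ab
    proof -
      define y where "y = u + fst ab *s v + snd ab *s w"
      have "dot4 h y = 0" "dot4 c y = 1" "dot4 l y = fst ab" "dot4 m y = snd ab" using uvw by (simp_all add: y_def)
      then show ?thesis using G0[of y] eval4_homog[OF g(2), of c y l m] by (simp add: G_def)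
    qed
    then have "g = 0" by (rule bipoly_0_if_vanishing)
    with g(1) show False ..
  qed
  obtain L cc where L: "\<forall>i<d. tdeg_le 1 (L i)" "f = [:[:cc:]:] * (\<Prod>i<d. L i)"
    "\<forall>i j. i < j \<longrightarrow> j < d \<longrightarrow> (\<exists>y\<in>Y. {k. k < d \<and> ev2 (L k) y = 0} = {i, j})"
    "\<forall>y\<in>Y. \<exists>i j. i < j \<and> j < d \<and> {k. k < d \<and> ev2 (L k) y = 0} = {i, j}"
    by (rule star_arrangement[OF d f0 f_deg finY sing dense])
  have "\<forall>i\<in>{..<d}. \<exists>M. \<forall>y. dot4 c y \<noteq> 0 \<longrightarrow> ev2 (L i) (dot4 l y / dot4 c y, dot4 m y / dot4 c y) = dot4 M y / dot4 c y"
    using L(1) linear_form_functional by blast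
  from bchoice[OF this] obtain M where M: "\<forall>i\<in>{..<d}. \<forall>y. dot4 c y \<noteq> 0 \<longrightarrow>
      ev2 (L i) (dot4 l y / dot4 c y, dot4 m y / dot4 c y) = dot4 (M i) y / dot4 c y" by (rule exE)
  have evL: "ev2 (L i) (z y) = 0 \<longleftrightarrow> dot4 (M i) y = 0" if "i < d" "dot4 c y \<noteq> 0" for i y
    using M that by (simp add: z_def)
  define N where "N V = {k. k < d \<and> dot4 (M k) (p V) = 0}" for V
  have N_eq: "{k. k < d \<and> ev2 (L k) (z (p V)) = 0} = N V" if V: "V \<in> \<V>" for V
    unfolding N_def using evL[OF _ c1[OF V]] by blast
  have pair: "\<exists>V\<in>\<V>. N V = {i, j}" if ij: "i < d" "j < d" "i \<noteq> j" for i j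
  proof -
    have *: "\<exists>V\<in>\<V>. N V = {i, j}" if lt: "i < j" "j < d" for i j
    proof -
      have "\<exists>y\<in>Y. {k. k < d \<and> ev2 (L k) y = 0} = {i, j}" using L(3)[rule_format, OF lt] .
      then obtain V where V: "V \<in> \<V>" "{k. k < d \<and> ev2 (L k) (z (p V)) = 0} = {i, j}" unfolding Y_def by (elim bexE imageE) simp
      then have "N V = {i, j}" using N_eq[OF V(1)] by simp
      with V(1) show ?thesis by (rule bexI[rotated])
    qed
    show ?thesis
    proof (cases "i < j")
      case True
      then show ?thesis using *[of i j] ij by simp
    next
      case False
      then have "j < i" using ij by simp
      from *[OF this ij(1)] show ?thesis by (simp add: insert_commute)
    qed
  qed
  have idx: "\<exists>i j. i < j \<and> j < d \<and> N V = {i, j}" if V: "V \<in> \<V>" for V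
  proof -
    have "z (p V) \<in> Y" unfolding Y_def using V by (rule imageI)
    from bspec[OF L(4) this] show ?thesis unfolding N_eq[OF V] .
  qed
  \<comment> \<open>If both section points lie on \<open>L i\<close>, so does
    \<open>p U + p V\<close>; then \<open>F\<close> vanishes there, which the choice of the plane
    forbids for skew lines.\<close>
  have meet: "U \<inter> V \<noteq> {0}" if UV: "U \<in> \<V>" "V \<in> \<V>" "U \<noteq> V" and i: "i \<in> N U" "i \<in> N V" for U V i
  proof
    assume "U \<inter> V = {0}"
    with bspec[OF bspec[OF g4 UV(1)] UV(2)] have nz: "eval4 F (p U + p V) \<noteq> 0" by (rule mp)
    have i': "i < d" "dot4 (M i) (p U + p V) = 0" using i by (simp_all add: N_def)
    have h0: "dot4 h (p U + p V) = 0" using pq(2) UV by simp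
    have "ev2 (L i) (z (p U + p V)) = 0" using evL[OF i'(1) c2[OF UV]] i'(2) by blast
    with i'(1) have "\<exists>i\<in>{..<d}. ev2 (L i) (z (p U + p V)) = 0" by (intro bexI[of _ i]) simp_all
    then have "(\<Prod>i<d. ev2 (L i) (z (p U + p V))) = 0" by (rule prod_zero[OF finite_lessThan])
    then have "ev2 f (z (p U + p V)) = 0" unfolding L(2) ev2_simps by (simp only: mult_zero_right)
    with ev_f[OF h0 c2[OF UV]] nz c2[OF UV] show False by simp
  qed
  have "\<forall>i\<in>{..<d}. \<exists>P. vec.subspace P \<and> vec.dim P = 3 \<and> (\<forall>V\<in>\<V>. i \<in> N V \<longrightarrow> V \<subseteq> P)
     \<and> (\<forall>y\<in>P. dot4 h y = 0 \<longrightarrow> dot4 (M i) y = 0)"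
  proof
    fix i assume "i \<in> {..<d}"
    then have i: "i < d" by simp
    \<comment> \<open>Two indices other than \<open>i\<close> exist because
      \<open>d \<ge> 3\<close>; the plane \<open>P\<close> is spanned by the lines belonging to {i,
      j} and {i, k}.\<close>
    have "\<exists>j<3. \<exists>k<3. j \<noteq> i \<and> k \<noteq> i \<and> j \<noteq> k" by presburger
    then obtain j k where "j < 3" "k < 3" and jk': "j \<noteq> i" "k \<noteq> i" "j \<noteq> k" by blast
    then have jk: "j < d" "k < d" "j \<noteq> i" "k \<noteq> i" "j \<noteq> k" using d by simp_all
    obtain V1 where V1: "V1 \<in> \<V>" "N V1 = {i, j}" using pair[of i j] i jk by auto
    obtain V2 where V2: "V2 \<in> \<V>" "N V2 = {i, k}" using pair[of i k] i jk by auto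
    \<comment> \<open>The section point of \<open>V3\<close> is off the line \<open>L i\<close>, so
      \<open>M i\<close> does not vanish identically on the plane \<open>h = 0\<close>.\<close>
    obtain V3 where V3: "V3 \<in> \<V>" "N V3 = {j, k}" using pair[of j k] i jk by auto
    have iN: "i \<in> N V1" "i \<in> N V2" "i \<notin> N V3" using V1 V2 V3 jk by auto
    have "k \<in> N V2" "k \<notin> N V1" using V1 V2 jk by auto
    then have ne: "V1 \<noteq> V2" by blast
    define P where "P = {x + y |x y. x \<in> V1 \<and> y \<in> V2}"
    have P: "vec.subspace P" unfolding P_def by (rule vec.subspace_sums[OF D(2)[OF V1(1)] D(2)[OF V2(1)]])
    have V1P: "V1 \<subseteq> P"
    proof
      fix x assume "x \<in> V1"
      then have "x + 0 \<in> P" unfolding P_def using D(4)[OF V2(1)] by blast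
      then show "x \<in> P" by simp
    qed
    have V2P: "V2 \<subseteq> P"
    proof
      fix x assume "x \<in> V2"
      then have "0 + x \<in> P" unfolding P_def using D(4)[OF V1(1)] by blast
      then show "x \<in> P" by simp
    qed
    have sI: "vec.subspace (V1 \<inter> V2)" by (rule vec.subspace_inter[OF D(2)[OF V1(1)] D(2)[OF V2(1)]])
    have "vec.dim P + vec.dim (V1 \<inter> V2) = 4"
      unfolding P_def using vec.dim_sums_Int[OF D(2)[OF V1(1)] D(2)[OF V2(1)]] D(3)[OF V1(1)] D(3)[OF V2(1)] by simp
    moreover have "vec.dim (V1 \<inter> V2) \<noteq> 0"
    proof
      assume "vec.dim (V1 \<inter> V2) = 0"
      then have "V1 \<inter> V2 \<subseteq> {0}" unfolding vec.dim_eq_0 .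
      moreover have "0 \<in> V1 \<inter> V2" using D(4) V1(1) V2(1) by blast
      ultimately show False using meet[OF V1(1) V2(1) ne iN(1,2)] by blast
    qed
    moreover have "\<not> vec.dim (V1 \<inter> V2) \<ge> 2"
    proof
      assume ge: "vec.dim (V1 \<inter> V2) \<ge> 2"
      have "V1 \<inter> V2 = V1" by (rule vec.subspace_dim_equal[OF sI D(2)[OF V1(1)]]) (use ge D(3)[OF V1(1)] in auto)
      moreover have "V1 \<inter> V2 = V2" by (rule vec.subspace_dim_equal[OF sI D(2)[OF V2(1)]]) (use ge D(3)[OF V2(1)] in auto)
      ultimately show False using ne by blast
    qed
    ultimately have dP: "vec.dim P = 3" by linarith
    let ?K = "{y. dot4 h y = 0}"
    have dK: "vec.dim ?K = 3" by (rule dim_ker[OF hq])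
    have p12: "p V2 \<notin> vec.span {p V1}"
    proof
      assume "p V2 \<in> vec.span {p V1}"
      then obtain a where "p V2 = a *s p V1" unfolding in_span_singleton by blast
      then have "p V2 \<in> V1" using vec.subspace_scale[OF D(2)[OF V1(1)] pq(1)[OF V1(1)]] by simp
      then show False using g2 V1(1) V2(1) ne by blast
    qed
    have "?K \<noteq> P" using V1P pq(4,5)[OF V1(1)] by auto
    then have dT: "vec.dim (?K \<inter> P) = 2" by (rule dim_plane_Int[OF subspace_ker dK P dP])
    have pT: "p V1 \<in> ?K \<inter> P" "p V2 \<in> ?K \<inter> P"
      using pq(1,2)[OF V1(1)] pq(1,2)[OF V2(1)] V1P V2P by auto
    have T: "?K \<inter> P = vec.span {p V2, p V1}"
      by (rule span_pair_eq[OF vec.subspace_inter[OF subspace_ker P] dT pT(1) pq(3)[OF V1(1)] pT(2) p12])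
    have M12: "dot4 (M i) (p V1) = 0" "dot4 (M i) (p V2) = 0" using iN by (simp_all add: N_def)
    have sec: "dot4 (M i) y = 0" if y: "y \<in> P" "dot4 h y = 0" for y
    proof -
      have "y \<in> vec.span {p V2, p V1}" using y unfolding T[symmetric] by simp
      then obtain a b where "y = a *s p V2 + b *s p V1" unfolding in_span_pair by blast
      then show ?thesis using M12 by simp
    qed
    have M3: "dot4 (M i) (p V3) \<noteq> 0" using iN(3) i by (simp add: N_def)
    let ?Mi = "{y. dot4 (M i) y = 0}"
    have "?K \<noteq> ?Mi" using M3 pq(2)[OF V3(1)] by blast
    then have dS: "vec.dim (?K \<inter> ?Mi) = 2" by (rule dim_plane_Int[OF subspace_ker dK subspace_ker dim_ker[OF M3]])
    have pS: "p V1 \<in> ?K \<inter> ?Mi" "p V2 \<in> ?K \<inter> ?Mi" using pq(2) V1(1) V2(1) M12 by auto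
    have S: "?K \<inter> ?Mi = vec.span {p V2, p V1}"
      by (rule span_pair_eq[OF vec.subspace_inter[OF subspace_ker subspace_ker] dS pS(1) pq(3)[OF V1(1)] pS(2) p12])
    \<comment> \<open>A further line \<open>V\<close> with index \<open>i\<close> meets
      \<open>V1\<close> outside the section plane, and its section point lies on the line through
      those of \<open>V1\<close> and \<open>V2\<close>. So \<open>V\<close> is spanned by two
      vectors of \<open>P\<close>.\<close>
    have all: "V \<subseteq> P" if V: "V \<in> \<V>" "i \<in> N V" for V
    proof (cases "V = V1")
      case True
      then show ?thesis using V1P by simp
    next
      case False
      have "p V \<in> ?K \<inter> ?Mi" using pq(2)[OF V(1)] V(2) by (simp add: N_def)
      then have pP: "p V \<in> P" unfolding S T[symmetric] by blast
      have "V \<inter> V1 \<noteq> {0}" by (rule meet[OF V(1) V1(1) False V(2) iN(1)])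
      then obtain a where a: "a \<in> V" "a \<in> V1" "dot4 h a \<noteq> 0" using g3 V(1) V1(1) False by blast
      have "a \<notin> vec.span {p V}"
      proof
        assume "a \<in> vec.span {p V}"
        then obtain b where "a = b *s p V" unfolding in_span_singleton by blast
        then show False using a(3) pq(2)[OF V(1)] by simp
      qed
      then have "V = vec.span {a, p V}" by (rule span_pair_eq[OF D(2,3)[OF V(1)] pq(1,3)[OF V(1)] a(1)])
      moreover have "vec.span {a, p V} \<subseteq> P" by (rule vec.span_minimal[OF _ P]) (use a(2) V1P pP in auto)
      ultimately show ?thesis by simp
    qed
    show "\<exists>P. vec.subspace P \<and> vec.dim P = 3 \<and> (\<forall>V\<in>\<V>. i \<in> N V \<longrightarrow> V \<subseteq> P)
     \<and> (\<forall>y\<in>P. dot4 h y = 0 \<longrightarrow> dot4 (M i) y = 0)"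
      using P dP all sec by (intro exI[of _ P]) blast
  qed
  from bchoice[OF this] obtain P where P: "\<forall>i\<in>{..<d}. vec.subspace (P i) \<and> vec.dim (P i) = 3 \<and> (\<forall>V\<in>\<V>. i \<in> N V \<longrightarrow> V \<subseteq> P i)
     \<and> (\<forall>y\<in>P i. dot4 h y = 0 \<longrightarrow> dot4 (M i) y = 0)" by (rule exE)
  have P1: "vec.subspace (P i)" "vec.dim (P i) = 3" if "i < d" for i using P that by simp_all
  have P2: "V \<subseteq> P i" if "i < d" "V \<in> \<V>" "i \<in> N V" for i V using P that by simp
  have P3: "dot4 (M i) y = 0" if "i < d" "y \<in> P i" "dot4 h y = 0" for i y using P that by simp
  \<comment> \<open>If two of the planes agreed, the line belonging to {i, k} would have its section
    point on \<open>L j\<close> as well.\<close>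
  have P_ne: "P i \<noteq> P j" if ij: "i < d" "j < d" "i \<noteq> j" for i j
  proof
    assume eq: "P i = P j"
    have "\<exists>k<3. k \<noteq> i \<and> k \<noteq> j" by presburger
    then obtain k where "k < 3" and k': "k \<noteq> i" "k \<noteq> j" by blast
    then have k: "k < d" "k \<noteq> i" "k \<noteq> j" using d by simp_all
    obtain V where V: "V \<in> \<V>" "N V = {i, k}" using pair[of i k] ij k by auto
    have "p V \<in> P j" using P2[OF ij(1) V(1)] V(2) pq(1)[OF V(1)] eq by auto
    then have "j \<in> N V" using P3[OF ij(2) _ pq(2)[OF V(1)]] ij(2) by (simp add: N_def)
    with V(2) ij k show False by auto
  qed
  have V_eq: "V = P i \<inter> P j" if V: "V \<in> \<V>" "i \<in> N V" "j \<in> N V" "i \<noteq> j" for V i j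
  proof -
    have ij: "i < d" "j < d" using V by (simp_all add: N_def)
    show ?thesis
    proof (rule vec.subspace_dim_equal[OF D(2)[OF V(1)] vec.subspace_inter[OF P1(1)[OF ij(1)] P1(1)[OF ij(2)]]])
      show "V \<subseteq> P i \<inter> P j" using P2 ij V by blast
      show "vec.dim (P i \<inter> P j) \<le> vec.dim V"
        using dim_plane_Int[OF P1[OF ij(1)] P1[OF ij(2)] P_ne[OF ij V(4)]] D(3)[OF V(1)] by simp
    qed
  qed
  \<comment> \<open>The factors are numbered from 0, the planes of a pseudostar from 1.\<close>
  define H where "H k = linear_locus (P (k - 1))" for k
  show ?thesis
    unfolding pseudostar_def
  proof (intro exI conjI)
    show "d \<ge> 2" using d by simp
    show "\<forall>i\<in>{1..d}. is_plane (H i)"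
    proof
      fix i assume "i \<in> {1..d}"
      then have "i - 1 < d" by auto
      from P1[OF this] show "is_plane (H i)" unfolding is_plane_def H_def by (intro exI[of _ "P (i - 1)"] conjI refl)
    qed
    show "inj_on H {1..d}"
    proof (rule inj_onI, rule ccontr)
      fix a b assume ab: "a \<in> {1..d}" "b \<in> {1..d}" "H a = H b" "a \<noteq> b"
      then have lt: "a - 1 < d" "b - 1 < d" "a - 1 \<noteq> b - 1" by auto
      have "vec.dim (P (a - 1)) \<noteq> 0" "vec.dim (P (b - 1)) \<noteq> 0" using P1(2) lt by simp_all
      then have "P (a - 1) = P (b - 1)"
        using linear_locus_mono_iff[OF P1(1)[OF lt(1)], of "P (b - 1)"] linear_locus_mono_iff[OF P1(1)[OF lt(2)], of "P (a - 1)"]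
          ab(3) unfolding H_def by (intro equalityI) (simp_all only: order_refl simp_thms)
      with P_ne[OF lt] show False ..
    qed
    show "\<forall>i j l. 1 \<le> i \<and> i < j \<and> j < l \<and> l \<le> d \<longrightarrow> \<not> (\<exists>L. is_line L \<and> L \<subseteq> H i \<inter> H j \<inter> H l)"
    proof (intro allI impI notI)
      fix i j k assume ijk: "1 \<le> i \<and> i < j \<and> j < k \<and> k \<le> d" and "\<exists>L. is_line L \<and> L \<subseteq> H i \<inter> H j \<inter> H k"
      then obtain V where V: "vec.subspace V" "vec.dim V = 2" "linear_locus V \<subseteq> H i \<inter> H j \<inter> H k"
        unfolding is_line_def by blast
      have lt: "i - 1 < d" "j - 1 < d" "k - 1 < d" "i - 1 \<noteq> j - 1" "i - 1 \<noteq> k - 1" "j - 1 \<noteq> k - 1" using ijk by auto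
      have sub: "V \<subseteq> P (i - 1)" "V \<subseteq> P (j - 1)" "V \<subseteq> P (k - 1)"
        using V(3) linear_locus_mono_iff[OF V(1)] V(2) unfolding H_def by auto
      obtain U where U: "U \<in> \<V>" "N U = {i - 1, j - 1}" using pair[OF lt(1,2,4)] by blast
      have U_eq: "U = P (i - 1) \<inter> P (j - 1)" by (rule V_eq[OF U(1)]) (use U(2) lt(4) in auto)
      have "V = U"
        by (rule vec.subspace_dim_equal[OF V(1) D(2)[OF U(1)]]) (use sub U_eq V(2) D(3)[OF U(1)] in auto)
      \<comment> \<open>A common line of three planes would be the line of the first two indices,
        and its section point would lie on a third line of the star.\<close>
      then have "p U \<in> P (k - 1)" using sub(3) pq(1)[OF U(1)] by blast
      then have "k - 1 \<in> N U" using P3[OF lt(3) _ pq(2)[OF U(1)]] lt(3) by (simp add: N_def)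
      with U(2) lt(5,6) show False by auto
    qed
    show "(\<Union>V\<in>\<V>. linear_locus V) = \<Union> {H i \<inter> H j | i j. 1 \<le> i \<and> i < j \<and> j \<le> d}"
    proof
      show "(\<Union>V\<in>\<V>. linear_locus V) \<subseteq> \<Union> {H i \<inter> H j | i j. 1 \<le> i \<and> i < j \<and> j \<le> d}"
      proof (rule UN_least)
        fix V assume V: "V \<in> \<V>"
        obtain i j where ij: "i < j" "j < d" "N V = {i, j}" using idx[OF V] by blast
        have "V = P i \<inter> P j" by (rule V_eq[OF V]) (use ij in auto)
        then have "linear_locus V = H (Suc i) \<inter> H (Suc j)" unfolding H_def by (simp add: linear_locus_Int)
        then have "linear_locus V \<in> {H i \<inter> H j | i j. 1 \<le> i \<and> i < j \<and> j \<le> d}"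
          using ij(1,2) by (intro CollectI exI[of _ "Suc i"] exI[of _ "Suc j"]) simp
        then show "linear_locus V \<subseteq> \<Union> {H i \<inter> H j | i j. 1 \<le> i \<and> i < j \<and> j \<le> d}" by (rule Union_upper)
      qed
      show "\<Union> {H i \<inter> H j | i j. 1 \<le> i \<and> i < j \<and> j \<le> d} \<subseteq> (\<Union>V\<in>\<V>. linear_locus V)"
      proof (rule Union_least)
        fix A assume "A \<in> {H i \<inter> H j | i j. 1 \<le> i \<and> i < j \<and> j \<le> d}"
        then obtain i j where ij: "A = H i \<inter> H j" "1 \<le> i" "i < j" "j \<le> d" by blast
        have lt: "i - 1 < d" "j - 1 < d" "i - 1 \<noteq> j - 1" using ij by auto
        obtain U where U: "U \<in> \<V>" "N U = {i - 1, j - 1}" using pair[OF lt] by blast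
        have "U = P (i - 1) \<inter> P (j - 1)" by (rule V_eq[OF U(1)]) (use U(2) lt(3) in auto)
        then have "A = linear_locus U" unfolding ij(1) H_def by (simp add: linear_locus_Int)
        then show "A \<subseteq> (\<Union>V\<in>\<V>. linear_locus V)" using U(1) by blast
      qed
    qed
  qed
qed

theorem pseudostar_has_type:
  fixes Z :: "('k::alg_closed_field ^ 4) set set"
  assumes "pseudostar Z"
  shows "\<exists>d>1. has_type Z (d - 1) d"
proof -
  obtain n :: nat and H where nH: "n \<ge> 2" "\<forall>i\<in>{1..n}. is_plane (H i)" "inj_on H {1..n}"
    "\<forall>i j l. 1 \<le> i \<and> i < j \<and> j < l \<and> l \<le> n \<longrightarrow> \<not> (\<exists>L. is_line L \<and> L \<subseteq> H i \<inter> H j \<inter> H l)"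
    "Z = \<Union> {H i \<inter> H j | i j. 1 \<le> i \<and> i < j \<and> j \<le> n}"
    using assms[unfolded pseudostar_def] by - (elim exE conjE, rule that, assumption+)
  have "\<forall>i\<in>{1..n}. \<exists>h. H i = linear_locus {v. dot4 h v = 0} \<and> (\<exists>x. dot4 h x \<noteq> 0)"
  proof
    fix i assume "i \<in> {1..n}"
    then obtain W where W: "vec.subspace W" "vec.dim W = 3" "H i = linear_locus W" using nH(2) unfolding is_plane_def by blast
    obtain h x where h: "W = {v. dot4 h v = 0}" "dot4 h x = 1" by (rule plane_ker[OF W(1,2)])
    have "dot4 h x \<noteq> 0" using h(2) by simp
    then show "\<exists>h. H i = linear_locus {v. dot4 h v = 0} \<and> (\<exists>x. dot4 h x \<noteq> 0)" using W(3) h(1) by blast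
  qed
  from bchoice[OF this] obtain h where h: "\<forall>i\<in>{1..n}. H i = linear_locus {v. dot4 (h i) v = 0} \<and> (\<exists>x. dot4 (h i) x \<noteq> 0)" by (rule exE)
  have H: "H i = linear_locus {v. dot4 (h i) v = 0}" "\<exists>x. dot4 (h i) x \<noteq> 0" if "i \<in> {1..n}" for i using bspec[OF h that] by simp_all
  have dim3: "vec.dim {v. dot4 (h i) v = 0} = 3" if "i \<in> {1..n}" for i using H(2)[OF that] dim_ker by blast
  have ne: "{v. dot4 (h i) v = 0} \<noteq> {v. dot4 (h j) v = 0}" if ij: "i \<in> {1..n}" "j \<in> {1..n}" "i \<noteq> j" for i j
  proof
    assume "{v. dot4 (h i) v = 0} = {v. dot4 (h j) v = 0}"
    then have "H i = H j" using H(1) ij by simp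
    with inj_onD[OF nH(3)] ij show False by blast
  qed
  interpret star_planes n h
  proof
    show "n \<ge> 2" by (rule nH(1))
    show "\<exists>x. dot4 (h i) x \<noteq> 0" if "i \<in> {1..n}" for i by (rule H(2)[OF that])
    show "\<exists>x. dot4 (h i) x = 0 \<and> dot4 (h j) x \<noteq> 0" if ij: "i \<in> {1..n}" "j \<in> {1..n}" "i \<noteq> j" for i j
    proof (rule ccontr)
      assume "\<not> ?thesis"
      then have "{v. dot4 (h i) v = 0} \<subseteq> {v. dot4 (h j) v = 0}" by blast
      then have "{v. dot4 (h i) v = 0} = {v. dot4 (h j) v = 0}"
        by (rule vec.subspace_dim_equal[OF subspace_ker subspace_ker]) (simp only: dim3[OF ij(1)] dim3[OF ij(2)] order_refl)
      with ne[OF ij] show False ..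
    qed
    show "\<exists>x. dot4 (h i) x = 0 \<and> dot4 (h j) x = 0 \<and> dot4 (h k) x \<noteq> 0"
      if ijk: "i \<in> {1..n}" "j \<in> {1..n}" "k \<in> {1..n}" "i \<noteq> j" "i \<noteq> k" "j \<noteq> k" for i j k
    proof (rule ccontr)
      assume n: "\<not> ?thesis"
      let ?V = "{v. dot4 (h i) v = 0} \<inter> {v. dot4 (h j) v = 0}"
      have "vec.dim ?V = 2" by (rule dim_plane_Int[OF subspace_ker dim3[OF ijk(1)] subspace_ker dim3[OF ijk(2)] ne[OF ijk(1,2,4)]])
      then have line: "is_line (linear_locus ?V)"
        unfolding is_line_def using vec.subspace_inter[OF subspace_ker subspace_ker] by blast
      have "?V \<subseteq> {v. dot4 (h k) v = 0}" using n by blast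
      then have "linear_locus ?V \<subseteq> H i \<inter> H j \<inter> H k"
        unfolding H(1)[OF ijk(1)] H(1)[OF ijk(2)] H(1)[OF ijk(3)] linear_locus_def by blast
      then have sub: "linear_locus ?V \<subseteq> \<Inter>(H ` {i, j, k})" by auto
      \<comment> \<open>The condition in \<open>pseudostar\<close> speaks of increasing indices, so
        the three are sorted.\<close>
      obtain a b c where abc: "a < b" "b < c" "{a, b, c} = {i, j, k}"
      proof -
        consider "i < j" "j < k" | "i < k" "k < j" | "j < i" "i < k" | "j < k" "k < i" | "k < i" "i < j" | "k < j" "j < i"
          using ijk(4,5,6) by linarith
        then show thesis
        proof cases
          case 1 then show thesis by (rule that) simp
        next
          case 2 then show thesis by (rule that) auto
        next
          case 3 then show thesis by (rule that) auto
        next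
          case 4 then show thesis by (rule that) auto
        next
          case 5 then show thesis by (rule that) auto
        next
          case 6 then show thesis by (rule that) auto
        qed
      qed
      have "linear_locus ?V \<subseteq> H a \<inter> H b \<inter> H c" using sub unfolding abc(3)[symmetric] by auto
      moreover have "{a, b, c} \<subseteq> {1..n}" unfolding abc(3) using ijk by simp
      then have "1 \<le> a \<and> a < b \<and> b < c \<and> c \<le> n" using abc(1,2) by simp
      ultimately show False using nH(4) line by blast
    qed
  qed
  have "{H i \<inter> H j | i j. 1 \<le> i \<and> i < j \<and> j \<le> n} = linear_locus ` \<V>"
  proof -
    have e: "H i \<inter> H j = linear_locus (W i \<inter> W j)" if "1 \<le> i" "i < j" "j \<le> n" for i j
      using H(1)[of i] H(1)[of j] that unfolding W_def by (simp add: linear_locus_Int)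
    show ?thesis
    proof
      show "{H i \<inter> H j | i j. 1 \<le> i \<and> i < j \<and> j \<le> n} \<subseteq> linear_locus ` \<V>"
        unfolding \<V>_def using e by blast
      show "linear_locus ` \<V> \<subseteq> {H i \<inter> H j | i j. 1 \<le> i \<and> i < j \<and> j \<le> n}"
      proof
        fix A assume "A \<in> linear_locus ` \<V>"
        then obtain i j where "1 \<le> i" "i < j" "j \<le> n" "A = linear_locus (W i \<inter> W j)" unfolding \<V>_def by blast
        then show "A \<in> {H i \<inter> H j | i j. 1 \<le> i \<and> i < j \<and> j \<le> n}" using e by blast
      qed
    qed
  qed
  then have "Z = (\<Union>V\<in>\<V>. linear_locus V)" using nH(5) by simp
  then have "has_type Z (n - 1) n" using star_has_type by simp
  then show ?thesis using nH(1) by (intro exI[of _ n]) simp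
qed

section \<open>Both directions for a union of lines\<close>

theorem theorem2p13:
  fixes l :: "nat \<Rightarrow> ('k::alg_closed_field ^ 4) set set" and s :: nat
  assumes "s \<ge> 1"
    and "\<And>i. i \<in> {1..s} \<Longrightarrow> is_line (l i)"
  shows "(ACM (\<Union>i\<in>{1..s}. l i) \<and> (\<exists>d>1. has_type (\<Union>i\<in>{1..s}. l i) (d - 1) d) \<longrightarrow>
            pseudostar (\<Union>i\<in>{1..s}. l i) \<or> coplanar_lines (l ` {1..s})) \<and>
         (pseudostar (\<Union>i\<in>{1..s}. l i) \<or> coplanar_lines (l ` {1..s}) \<longrightarrow>
            (\<exists>d>1. has_type (\<Union>i\<in>{1..s}. l i) (d - 1) d))"
proof -
  have "\<forall>i\<in>{1..s}. \<exists>V. vec.subspace V \<and> vec.dim V = 2 \<and> l i = linear_locus V"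
    using assms(2) unfolding is_line_def by blast
  from bchoice[OF this] obtain W where W: "\<forall>i\<in>{1..s}. vec.subspace (W i) \<and> vec.dim (W i) = 2 \<and> l i = linear_locus (W i)" by (rule exE)
  define \<V> where "\<V> = W ` {1..s}"
  have ls: "line_spaces \<V>" unfolding line_spaces_def \<V>_def using W by simp
  have \<V>_ne: "\<V> \<noteq> {}" using assms(1) by (simp add: \<V>_def)
  define Z where "Z = (\<Union>i\<in>{1..s}. l i)"
  have Z: "Z = (\<Union>V\<in>\<V>. linear_locus V)" unfolding Z_def \<V>_def using W by simp
  note D = line_spacesD[OF ls]
  interpret line_family \<V> by (rule line_family_line_spaces[OF ls])
  have I: "vanishing_ideal Z = I" unfolding Z by (rule vanishing_ideal_lines[OF ls])
  have coplanarI: "coplanar_lines (l ` {1..s})" if h: "\<And>V v. V \<in> \<V> \<Longrightarrow> v \<in> V \<Longrightarrow> dot4 h v = 0" and x: "dot4 h x \<noteq> 0" for h x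
    unfolding coplanar_lines_def
  proof (intro exI conjI ballI)
    show "is_plane (linear_locus {v. dot4 h v = 0})"
      unfolding is_plane_def using subspace_ker dim_ker[OF x] by blast
    fix A assume "A \<in> l ` {1..s}"
    then obtain i where i: "i \<in> {1..s}" "A = l i" by blast
    have "W i \<subseteq> {v. dot4 h v = 0}" using h[of "W i"] i(1) unfolding \<V>_def by blast
    then show "A \<subseteq> linear_locus {v. dot4 h v = 0}"
      using W i unfolding linear_locus_def by auto
  qed
  have a: "pseudostar Z \<or> coplanar_lines (l ` {1..s})" if acm: "ACM Z" and d: "d > 1" "has_type Z (d - 1) d" for d
  proof -
    have alpha: "alpha I = d - 1" "alpha (symbolic_power I 2) = d" using d(2) unfolding has_type_def I by simp_all
    have "\<forall>V\<in>\<V>. \<exists>h. (\<forall>v\<in>V. dot4 h v = 0) \<and> (\<exists>x. dot4 h x \<noteq> 0)"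
    proof
      fix V assume V: "V \<in> \<V>"
      have "V \<noteq> UNIV"
      proof
        assume "V = UNIV"
        then have "vec.dim V = 4" using dim_UNIV4[where 'k='k] by (simp only:)
        with D(3)[OF V] show False by simp
      qed
      then obtain x where x: "x \<notin> V" by blast
      obtain h where h: "\<forall>u\<in>V. dot4 h u = 0" "dot4 h x = 1" by (rule separating_functional[OF D(2)[OF V] x])
      have "dot4 h x \<noteq> 0" using h(2) by simp
      then show "\<exists>h. (\<forall>v\<in>V. dot4 h v = 0) \<and> (\<exists>x. dot4 h x \<noteq> 0)" using h(1) by blast
    qed
    from bchoice[OF this] obtain hh where hh: "\<forall>V\<in>\<V>. (\<forall>v\<in>V. dot4 (hh V) v = 0) \<and> (\<exists>x. dot4 (hh V) x \<noteq> 0)" by (rule exE)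
    \<comment> \<open>A product of linear forms, one through each line, shows that \<open>I\<close>
      and its symbolic square contain nonzero forms; only then is the value of \<open>alpha\<close>
      the degree of an actual form.\<close>
    define u where "u = (\<Prod>V\<in>\<V>. lform (hh V))"
    have u0: "u \<noteq> 0" unfolding u_def using D(1) hh lform_ne_0 by auto
    have uI: "u \<in> I" unfolding I_iff u_def
    proof
      fix V assume V: "V \<in> \<V>"
      show "(\<Prod>V\<in>\<V>. lform (hh V)) \<in> van V"
        by (rule prod_van_in[OF D(1) V]) (use hh V in \<open>simp add: van_def\<close>)
    qed
    have uf: "form_of_degree (card \<V>) u" unfolding u_def by (rule form_prod[OF D(1)]) (rule form_lform)
    have "u * u \<in> symbolic_power I 2"
      unfolding symbolic_iff
    proof
      fix V assume "V \<in> \<V>"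
      then have "1 \<notin> van V" using ne[of V] by (auto simp: van_def)
      then show "\<exists>s. s \<notin> van V \<and> u * u * s \<in> I2" using I2_mult[OF uI uI] by (intro exI[of _ 1]) simp
    qed
    moreover have "u * u \<noteq> 0" using u0 by simp
    moreover have "form_of_degree (card \<V> + card \<V>) (u * u)" by (rule form_mult[OF uf uf])
    ultimately obtain F where F: "F \<in> symbolic_power I 2" "F \<noteq> 0" "form_of_degree (alpha (symbolic_power I 2)) F"
      by (rule alpha_attained)
    show ?thesis
    proof (cases "d = 2")
      case True
      \<comment> \<open>For \<open>d = 2\<close> a linear form vanishes on all lines, and its kernel
        is the common plane.\<close>
      obtain g where g: "g \<in> I" "g \<noteq> 0" "form_of_degree (alpha I) g" by (rule alpha_attained[OF uI u0 uf])
      have "form_of_degree 1 g" using g(3) alpha(1) True by simp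
      then obtain h where h: "g = lform h" by (rule linear_form_lform)
      obtain x where x: "dot4 h x \<noteq> 0" using g(2) zero_if_eval4_zero[of g] unfolding h by auto
      have "coplanar_lines (l ` {1..s})"
      proof (rule coplanarI[OF _ x])
        fix V v assume "V \<in> \<V>" "v \<in> V"
        then have "eval4 g v = 0" using g(1) by (auto simp: van_def)
        then show "dot4 h v = 0" by (simp add: h)
      qed
      then show ?thesis ..
    next
      case False
      then have d3: "d \<ge> 3" using d(1) by simp
      have no: "f = 0" if f: "f \<in> I" "form_of_degree (d - 2) f" for f
      proof (rule ccontr)
        assume "f \<noteq> 0"
        then have "alpha I \<le> d - 2" using alpha_le f by blast
        with alpha(1) d3 show False by simp
      qed
      have "cohen_macaulay (coord_ring Quot I)" using acm unfolding ACM_def I .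
      then have "pseudostar Z"
        unfolding Z using star_of_CM[OF ls \<V>_ne d3 F(1,2) _ no] F(3) alpha(2) by simp
      then show ?thesis ..
    qed
  qed
  have b1: "\<exists>d>1. has_type Z (d - 1) d" if "pseudostar Z" using pseudostar_has_type[OF that] .
  have b2: "\<exists>d>1. has_type Z (d - 1) d" if cop: "coplanar_lines (l ` {1..s})"
  proof -
    obtain P where P: "vec.subspace P" "vec.dim P = 3" "\<forall>L\<in>l ` {1..s}. L \<subseteq> linear_locus P"
      using cop unfolding coplanar_lines_def is_plane_def by blast
    obtain h x where h: "P = {v. dot4 h v = 0}" "dot4 h x = 1" by (rule plane_ker[OF P(1,2)])
    have "has_type (\<Union>V\<in>\<V>. linear_locus V) 1 2"
    proof (rule coplanar_has_type[OF ls \<V>_ne])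
      show "dot4 h x \<noteq> 0" using h(2) by simp
      fix V v assume V: "V \<in> \<V>" "v \<in> V"
      then obtain i where i: "i \<in> {1..s}" "V = W i" unfolding \<V>_def by blast
      have "linear_locus V \<subseteq> linear_locus P" using P(3) W i by auto
      then have "V \<subseteq> P" using linear_locus_mono_iff[OF D(2)[OF V(1)], of P] D(3)[OF V(1)] by simp
      then show "dot4 h v = 0" using V(2) h(1) by blast
    qed
    then show ?thesis unfolding Z by (intro exI[of _ 2]) simp
  qed
  show ?thesis
    unfolding Z_def[symmetric] using a b1 b2 by blast
qed

end
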